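(* Let $K_1,\dots,K_n\in C^2_+$ be convex bodies in $\mathbb{R}^n$ with centroid at the origin. (i) If $\phi_1,\dots,\phi_n\in Conc(0,\infty)$, then $$as^*(\phi_1,K_1;\cdots;\phi_n,K_n)\le as^*(\phi_1,(B_{K_1^\circ})^\circ;\cdots;\phi_n,(B_{K_n^\circ})^\circ).$$ Equality holds if the $K_i$ are ellipsoids that are dilates of one another. (ii) If $\phi_1,\dots,\phi_n\in Conc(0,\infty)$ are homogeneous of degrees $r_1,\dots,r_n\in[0,1)$ respectively, then $$\left(\frac{as^*(\phi_1,K_1;\cdots;\phi_n,K_n)}{as^*(\phi_1,B^n_2;\cdots;\phi_n,B^n_2)}\right)^n\le\prod_{i=1}^n\left(\frac{|K_i|}{|B^n_2|}\right)^{2r_i-1},$$ with equality if the $K_i$ are ellipsoids that are dilates of one another.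
   Context: Let $n\ge2$. $|\cdot|$ denotes volume in $\mathbb{R}^n$, $B^n_2$ the unit Euclidean ball, $S^{n-1}=\partial B^n_2$, and $\sigma$ the usual surface area measure on $S^{n-1}$. $K\in C^2_+$ means that $K$ is a convex body in $\mathbb{R}^n$ with the origin in its interior and with $C^2$ boundary having everywhere strictly positive Gaussian curvature. $h_K(u)=\max_{x\in K}\langle x,u\rangle$ is the support function, and the curvature function $f_K(u)$, $u\in S^{n-1}$, is the reciprocal of the Gauss curvature of $\partial K$ at the point with outer unit normal $u$. The polar body is $K^\circ=\{y\in\mathbb{R}^n:\langle x,y\rangle\le1\ \forall x\in K\}$. For a convex body $L$, $B_L$ is the origin-symmetric Euclidean ball with $|B_L|=|L|$. $Conc(0,\infty)$ is the set of functions $\phi:(0,\infty)\to(0,\infty)$ such that either $\phi$ is a nonzero constant function, or $\phi$ is concave with $\lim_{t\to0}\phi(t)=0$ and $\lim_{t\to\infty}\phi(t)/t=0$. $\phi$ is homogeneous of degree $r$ if $\phi(\lambda t)=\lambda^r\phi(t)$ for all $\lambda,t>0$. The general mixed $L_\phi^*$-affine surface area, for $\phi_i\in Conc(0,\infty)$ and $K_i\in C^2_+$, is $$as^*(\phi_1,K_1;\cdots;\phi_n,K_n)=\int_{S^{n-1}}\prod_{i=1}^n\left[\frac{\phi_i\big(f_{K_i}(u)h_{K_i}^{n+1}(u)\big)}{h_{K_i}(u)^n}\right]^{\frac1n}d\sigma(u).$$ Two bodies are dilates of one another if one is a positive scalar multiple of the other. *)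

theory Defs
  imports "HOL-Analysis.Analysis"
begin

definition C2_on :: "(real^'n) set \<Rightarrow> (real^'n \<Rightarrow> real) \<Rightarrow> (real^'n \<Rightarrow> real^'n) \<Rightarrow> bool" where
  "C2_on U g G \<longleftrightarrow>
     (\<exists>H :: real^'n \<Rightarrow> real^'n^'n.
        (\<forall>y\<in>U. (g has_derivative (\<lambda>v. G y \<bullet> v)) (at y)) \<and>
        (\<forall>y\<in>U. (G has_derivative (\<lambda>v. H y *v v)) (at y)) \<and>
        continuous_on U H)"
  \<comment> \<open>\<open>g\<close> is twice continuously differentiable on the open set \<open>U\<close>, with gradient \<open>G\<close>.\<close>

definition C2_hypersurface :: "(real^'n) set \<Rightarrow> bool" where
  "C2_hypersurface M \<longleftrightarrow>
     (\<forall>x\<in>M. \<exists>U g G. open U \<and> x \<in> U \<and> C2_on U g G \<and> (\<forall>y\<in>U. G y \<noteq> 0) \<and>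
                    M \<inter> U = {y\<in>U. g y = 0})"

definition outer_normal :: "(real^'n) set \<Rightarrow> real^'n \<Rightarrow> real^'n" where
  "outer_normal K x = (THE u. norm u = 1 \<and> (\<forall>y\<in>K. y \<bullet> u \<le> x \<bullet> u))"
  \<comment> \<open>The Gauss map of the boundary of a convex body \<open>K\<close>; only meaningful at smooth boundary points.\<close>

definition gauss_curvature :: "(real^'n) set \<Rightarrow> real^'n \<Rightarrow> real" where
  "gauss_curvature K x =
     (let u = outer_normal K x;
          D = frechet_derivative (outer_normal K) (at x within frontier K)
      in det (matrix (\<lambda>v. D (v - (v \<bullet> u) *\<^sub>R u) + (v \<bullet> u) *\<^sub>R u)))"
  \<comment> \<open>The Gauss curvature is the determinant of the differential of the Gauss map as an endomorphism of
    the tangent space, the orthogonal complement of \<open>u\<close>. Only the restriction of \<open>D\<close> to that space is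
    determined; it is extended here by the identity on the normal line, which does not change
    the determinant.\<close>

definition C2_plus :: "(real^'n) set \<Rightarrow> bool" where
  "C2_plus K \<longleftrightarrow>
     compact K \<and> convex K \<and> 0 \<in> interior K \<and>
     C2_hypersurface (frontier K) \<and> (\<forall>x\<in>frontier K. 0 < gauss_curvature K x)"

definition curvature_fun :: "(real^'n) set \<Rightarrow> real^'n \<Rightarrow> real" where
  "curvature_fun K u = 1 / gauss_curvature K (THE x. x \<in> frontier K \<and> outer_normal K x = u)"

definition support_fun :: "(real^'n) set \<Rightarrow> real^'n \<Rightarrow> real" where
  "support_fun K u = (SUP x\<in>K. x \<bullet> u)"

definition polar_body :: "(real^'n) set \<Rightarrow> (real^'n) set" where
  "polar_body K = {y. \<forall>x\<in>K. x \<bullet> y \<le> 1}"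

definition vol :: "(real^'n) set \<Rightarrow> real" where
  "vol L = measure lborel L"

definition volume_ball :: "(real^'n) set \<Rightarrow> (real^'n) set" where
  "volume_ball L = (THE B. (\<exists>r\<ge>0. B = cball 0 r) \<and> vol B = vol L)"

definition centroid :: "(real^'n) set \<Rightarrow> real^'n" where
  "centroid K = (1 / vol K) *\<^sub>R (LINT x:K|lborel. x)"

definition sphere_measure :: "(real^'n) measure" where
  "sphere_measure =
     scale_measure (of_nat CARD('n))
       (distr (restrict_space lborel (cball 0 1 - {0})) (restrict_space borel (sphere 0 1))
          (\<lambda>x. x /\<^sub>R norm x))"
  \<comment> \<open>Surface area on the unit sphere in polar coordinates: the measure of \<open>A\<close> is \<open>n\<close> times the volume of
    the cone \<open>{t u. u \<in> A, 0 < t \<le> 1}\<close>.\<close>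

definition Conc :: "(real \<Rightarrow> real) set" where
  "Conc = {\<phi>. (\<forall>t>0. 0 < \<phi> t) \<and>
     ((\<exists>c. c \<noteq> 0 \<and> (\<forall>t>0. \<phi> t = c)) \<or>
      (concave_on {0<..} \<phi> \<and> (\<phi> \<longlongrightarrow> 0) (at_right 0) \<and> ((\<lambda>t. \<phi> t / t) \<longlongrightarrow> 0) at_top))}"
  \<comment> \<open>Functions on \<open>(0,\<infinity>)\<close>; values at non-positive arguments are unconstrained and never used.\<close>

definition homogeneous :: "real \<Rightarrow> (real \<Rightarrow> real) \<Rightarrow> bool" where
  "homogeneous r \<phi> \<longleftrightarrow> (\<forall>l>0. \<forall>t>0. \<phi> (l * t) = l powr r * \<phi> t)"

definition mixed_asa :: "(nat \<Rightarrow> real \<Rightarrow> real) \<Rightarrow> (nat \<Rightarrow> (real^'n) set) \<Rightarrow> real" where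
  "mixed_asa \<phi> K =
     (LINT u|sphere_measure.
        (\<Prod>i=1..CARD('n).
           (\<phi> i (curvature_fun (K i) u * support_fun (K i) u ^ (CARD('n) + 1))
              / support_fun (K i) u ^ CARD('n)) powr (1 / real CARD('n))))"
  \<comment> \<open>The general mixed affine surface area \<open>as\<^sup>*(\<phi>\<^sub>1,K\<^sub>1;\<dots>;\<phi>\<^sub>n,K\<^sub>n)\<close>.\<close>

definition ellipsoid :: "(real^'n) set \<Rightarrow> bool" where
  "ellipsoid E \<longleftrightarrow> (\<exists>(A :: real^'n^'n) a. invertible A \<and> E = (\<lambda>x. a + A *v x) ` cball 0 1)"

definition dilates :: "(real^'n) set \<Rightarrow> (real^'n) set \<Rightarrow> bool" where
  "dilates K L \<longleftrightarrow> (\<exists>c>0. K = (\<lambda>x. c *\<^sub>R x) ` L)"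

end

theory Submission
  imports Defs
begin

text \<open>
  For \<open>\<tau>\<^sub>i = |K\<^sub>i| / |K\<^sub>i\<^sup>\<circ>|\<close> a supporting line of the concave function \<open>\<phi>\<^sub>i\<close> at \<open>\<tau>\<^sub>i\<close> bounds
  \<open>\<phi>\<^sub>i(f h\<^sup>n\<^sup>+\<^sup>1) / h\<^sup>n\<close> by a nonnegative combination of \<open>h\<^sup>-\<^sup>n\<close> and \<open>f h\<close>, whose integrals over the sphere are
  \<open>n |K\<^sub>i\<^sup>\<circ>|\<close> and \<open>n |K\<^sub>i|\<close>. With the inequality between the arithmetic and geometric means this gives
  \<open>as\<^sup>* \<le> n \<Prod>\<^sub>i (|K\<^sub>i\<^sup>\<circ>| \<phi>\<^sub>i(\<tau>\<^sub>i))\<^bsup>1/n\<^esup>\<close>, with equality for ellipsoids that are dilates of one another,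
  because \<open>f h\<^sup>n\<^sup>+\<^sup>1\<close> is constant on an ellipsoid. Both parts then follow from the Blaschke--Santalo
  inequality \<open>|K| |K\<^sup>\<circ>| \<le> |B|\<^sup>2\<close> for bodies with centroid \<open>0\<close>.

  That inequality is proved in functional form, after Lehec, by induction on the dimension: a function
  is cut by a median hyperplane, both halves are projected to the hyperplane along the line
  through their barycentres, and the one-dimensional case is the Prekopa--Leindler inequality in
  logarithmic coordinates. The integral of \<open>f h\<close> is computed with the
  positively homogeneous extension of the Gauss map, which maps \<open>K\<close> onto the unit ball with Jacobian \<open>\<kappa> / h\<close>.
\<close>

section \<open>The one-dimensional Prekopa--Leindler inequality\<close>

text \<open>The supporting line at \<open>\<tau>\<^sub>i\<close> is Jensen's inequality in disguise:
  under the measure \<open>h\<^sup>-\<^sup>n d\<sigma>\<close>, of total mass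
  \<open>n |K\<^sup>\<circ>|\<close>, the function \<open>f h\<^sup>n\<^sup>+\<^sup>1\<close> has
  mean \<open>|K| / |K\<^sup>\<circ>|\<close>. For given polar volume the bound increases with
  \<open>|K|\<close>, which Santalo caps at \<open>|B|\<^sup>2 / |K\<^sup>\<circ>|\<close>. This is
  the volume of the ball on the right of (i), so that side is the same bound at its largest value.
  In (ii) homogeneity splits each factor into a power of \<open>|K| / |B|\<close> and a power
  \<open>1 - r > 0\<close> of the Santalo quotient
  \<open>|K| |K\<^sup>\<circ>| / |B|\<^sup>2\<close>. The induction alternates between two forms of
  the functional inequality: cutting only yields a good translate of the function, whereas the
  projections to the hyperplane need an inequality for centered functions. The passage from the
  first form to the second exploits that the hypothesis is symmetric in the two functions. Gaussians
  of the gauge and of the support function carry the result over to bodies. Integrals over the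
  sphere are treated throughout as integrals of functions of \<open>y / |y|\<close> over the
  punctured ball; this is why the Gauss map is extended to a map in the full dimension.\<close>

text \<open>Copies of \<open>A / 2\<close> and \<open>B / 2\<close>, shifted by nearly extremal points \<open>b\<close> of \<open>B\<close> and \<open>a\<close> of \<open>A\<close>, lie in \<open>C\<close>
  and overlap only in a short interval.\<close>

lemma emeasure_half_sum:
  fixes A B C :: "real set"
  assumes A: "A \<in> sets borel" and B: "B \<in> sets borel" and C: "C \<in> sets borel"
    and bdd: "bounded A" "bounded B" and ne: "A \<noteq> {}" "B \<noteq> {}"
    and mid: "\<And>a b. a \<in> A \<Longrightarrow> b \<in> B \<Longrightarrow> (a + b) / 2 \<in> C"
  shows "emeasure lborel A + emeasure lborel B \<le> 2 * emeasure lborel C"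
proof (rule ennreal_le_epsilon)
  fix e :: real assume e: "0 < e"
  define a0 where "a0 = Sup A" define b0 where "b0 = Inf B"
  have bA: "bdd_above A" and bB: "bdd_below B"
    using bdd by (auto intro: bounded_imp_bdd_above bounded_imp_bdd_below)
  \<comment> \<open>Losses of at most \<open>e/2\<close> at either end make an overlap of length at
    most \<open>e/2\<close>, which the final doubling turns into \<open>e\<close>.\<close>
  obtain a where a: "a \<in> A" "a0 - e/2 < a"
    using less_cSup_iff[OF ne(1) bA, of "a0 - e/2"] e unfolding a0_def by auto
  obtain b where b: "b \<in> B" "b < b0 + e/2"
    using cInf_less_iff[OF ne(2) bB, of "b0 + e/2"] e unfolding b0_def by auto
  have leA: "x \<le> a0" if "x \<in> A" for x using cSup_upper[OF that bA] unfolding a0_def .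
  have leB: "b0 \<le> x" if "x \<in> B" for x using cInf_lower[OF that bB] unfolding b0_def .
  define A' where "A' = (\<lambda>c. (2 * c - b)) -` A" 
  define B' where "B' = (\<lambda>c. (2 * c - a)) -` B" 
  have mA': "A' \<in> sets borel" unfolding A'_def using A by (intro measurable_sets_borel[OF _ A]) simp
  have mB': "B' \<in> sets borel" unfolding B'_def using B by (intro measurable_sets_borel[OF _ B]) simp
  have scale: "emeasure lborel X = 2 * emeasure lborel ((\<lambda>c. 2 * c - d) -` X)" if "X \<in> sets borel" for X :: "real set" and d
  proof -
    have [measurable]: "X \<in> sets borel" by fact
    have "emeasure lborel X = (\<integral>\<^sup>+x. indicator X x \<partial>lborel)" by simp
    also have "\<dots> = 2 * (\<integral>\<^sup>+x. indicator X (-d + 2 * x) \<partial>lborel)"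
      by (subst nn_integral_real_affine[where c=2 and t="-d"]) auto
    also have "(\<integral>\<^sup>+x. indicator X (-d + 2 * x) \<partial>lborel) = (\<integral>\<^sup>+x. indicator ((\<lambda>c. 2 * c - d) -` X) x \<partial>lborel)"
      by (intro nn_integral_cong) (auto simp: indicator_def)
    also have "\<dots> = emeasure lborel ((\<lambda>c. 2 * c - d) -` X)"
      by (intro nn_integral_indicator) (simp add: measurable_sets_borel[OF _ that])
    finally show ?thesis .
  qed
  have sub: "A' \<union> B' \<subseteq> C"
  proof
    fix c assume "c \<in> A' \<union> B'"
    thus "c \<in> C" using mid[of "2*c-b" b] mid[of a "2*c-a"] a(1) b(1) by (auto simp: A'_def B'_def)
  qed
  have int: "A' \<inter> B' \<subseteq> {(a + b0)/2 .. (a0+b)/2}"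
    using leA leB by (force simp: A'_def B'_def field_simps)
  have len: "(a0+b)/2 - (a+b0)/2 \<le> e/2" using a b by (simp add: field_simps)
  have "emeasure lborel (A' \<inter> B') \<le> emeasure lborel {(a + b0)/2 .. (a0+b)/2}"
    by (rule emeasure_mono[OF int]) simp
  also have "\<dots> \<le> ennreal (e/2)"
    by (cases "(a + b0)/2 \<le> (a0+b)/2") (use len in \<open>simp_all add: ennreal_leI\<close>)
  finally have ov: "emeasure lborel (A' \<inter> B') \<le> ennreal (e/2)" .
  have "emeasure lborel A' + emeasure lborel B' = emeasure lborel (A' \<union> B') + emeasure lborel (A' \<inter> B')"
    using mA' mB' by (intro emeasure_Un_Int) simp_all
  also have "\<dots> \<le> emeasure lborel C + ennreal (e/2)"
    by (intro add_mono ov emeasure_mono sub) (use C in simp)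
  finally have "2 * (emeasure lborel A' + emeasure lborel B') \<le> 2 * (emeasure lborel C + ennreal (e/2))"
    by (rule mult_left_mono) simp
  also have "2 * (emeasure lborel C + ennreal (e/2)) = 2 * emeasure lborel C + ennreal e"
    using e by (simp add: distrib_left) (simp add: ennreal_mult[symmetric] ennreal_numeral[symmetric] del: ennreal_numeral)
  finally show "emeasure lborel A + emeasure lborel B \<le> 2 * emeasure lborel C + ennreal e"
    using scale[OF A, of b] scale[OF B, of a] by (simp add: A'_def B'_def distrib_left)
qed

text \<open>Layer-cake formula by Fubini. Levels in (0,1) suffice because it is applied to
  \<open>F\<close> and \<open>G\<close> bounded by 1, while cutting \<open>H\<close> at height 1
  only decreases its integral.\<close>

lemma nn_integral_superlevel:
  fixes F :: "real \<Rightarrow> real"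
  assumes [measurable]: "F \<in> borel_measurable borel"
  shows "(\<integral>\<^sup>+l. emeasure lborel {x. l < F x} * indicator {0<..<1} l \<partial>lborel)
       = (\<integral>\<^sup>+x. ennreal (min 1 (F x)) \<partial>lborel)"
proof -
  have "(\<integral>\<^sup>+x. ennreal (min 1 (F x)) \<partial>lborel) =
    (\<integral>\<^sup>+x. (\<integral>\<^sup>+l. indicator {l. l < F x} l * indicator {0<..<1} l \<partial>lborel) \<partial>lborel)"
  proof (intro nn_integral_cong)
    fix x
    have "(\<integral>\<^sup>+l. indicator {l. l < F x} l * indicator {0<..<1} l \<partial>lborel) = (\<integral>\<^sup>+l. indicator {0<..<min 1 (F x)} l \<partial>lborel)"
      by (intro nn_integral_cong) (auto simp: indicator_def)
    also have "\<dots> = ennreal (min 1 (F x))"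
      by (simp del: min_def, cases "0 \<le> min 1 (F x)") (auto simp: ennreal_neg)
    finally show "ennreal (min 1 (F x)) = (\<integral>\<^sup>+l. indicator {l. l < F x} l * indicator {0<..<1} l \<partial>lborel)" by simp
  qed
  also have "\<dots> = (\<integral>\<^sup>+l. (\<integral>\<^sup>+x. indicator {l. l < F x} l * indicator {0<..<1} l \<partial>lborel) \<partial>lborel)"
    by (rule lborel_pair.Fubini') simp
  also have "\<dots> = (\<integral>\<^sup>+l. emeasure lborel {x. l < F x} * indicator {0<..<1} l \<partial>lborel)"
  proof (intro nn_integral_cong)
    fix l :: real
    have [measurable]: "{x. l < F x} \<in> sets borel" by simp
    have "(\<integral>\<^sup>+x. indicator {l. l < F x} l * indicator {0<..<1} l \<partial>lborel) = (\<integral>\<^sup>+x. indicator {x. l < F x} x * indicator {0<..<1} l \<partial>lborel)"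
      by (intro nn_integral_cong) (auto simp: indicator_def)
    thus "(\<integral>\<^sup>+x. indicator {l. l < F x} l * indicator {0<..<1} l \<partial>lborel) = emeasure lborel {x. l < F x} * indicator {0<..<1} l"
      by (simp add: nn_integral_multc)
  qed
  finally show ?thesis by simp
qed

text \<open>With both suprema equal to 1, the superlevel sets of \<open>F\<close> and
  \<open>G\<close> are nonempty at every level in (0,1), so \<open>emeasure_half_sum\<close> applies
  level by level. The result is a sum, which is stronger than the product form used later.\<close>

lemma prekopa_leindler_normalized:
  fixes F G H :: "real \<Rightarrow> real"
  assumes [measurable]: "F \<in> borel_measurable borel" "G \<in> borel_measurable borel" "H \<in> borel_measurable borel"
    and le1: "\<And>x. F x \<le> 1" "\<And>x. G x \<le> 1" and H0: "\<And>x. 0 \<le> H x"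
    and supp: "\<And>x. x \<notin> {-k..k} \<Longrightarrow> F x = 0" "\<And>x. x \<notin> {-k..k} \<Longrightarrow> G x = 0"
    and sup1: "\<And>l. l < 1 \<Longrightarrow> \<exists>x. l < F x" "\<And>l. l < 1 \<Longrightarrow> \<exists>x. l < G x"
    and FGH: "\<And>a b. F a * G b \<le> (H ((a + b) / 2))\<^sup>2"
  shows "(\<integral>\<^sup>+x. ennreal (F x) \<partial>lborel) + (\<integral>\<^sup>+x. ennreal (G x) \<partial>lborel) \<le> 2 * (\<integral>\<^sup>+x. ennreal (H x) \<partial>lborel)"
proof -
  have "(\<integral>\<^sup>+x. ennreal (F x) \<partial>lborel) + (\<integral>\<^sup>+x. ennreal (G x) \<partial>lborel) =
     (\<integral>\<^sup>+x. ennreal (min 1 (F x)) \<partial>lborel) + (\<integral>\<^sup>+x. ennreal (min 1 (G x)) \<partial>lborel)"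
    using le1 by (simp only: min.absorb2)
  also have "\<dots> = (\<integral>\<^sup>+l. (emeasure lborel {x. l < F x} + emeasure lborel {x. l < G x}) * indicator {0<..<1} l \<partial>lborel)"
    unfolding nn_integral_superlevel[OF assms(1), symmetric] nn_integral_superlevel[OF assms(2), symmetric]
    by (subst nn_integral_add[symmetric]) (simp_all add: distrib_right)
  also have "\<dots> \<le> (\<integral>\<^sup>+l. 2 * (emeasure lborel {x. l < H x} * indicator {0<..<1} l) \<partial>lborel)"
  proof (intro nn_integral_mono)
    fix l :: real
    show "(emeasure lborel {x. l < F x} + emeasure lborel {x. l < G x}) * indicator {0<..<1} l
       \<le> 2 * (emeasure lborel {x. l < H x} * indicator {0<..<1} l)"
    proof (cases "l \<in> {0<..<1}")
      case True
      have "{x. l < F x} \<subseteq> {-k..k}" "{x. l < G x} \<subseteq> {-k..k}"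
        using supp True by force+
      hence bd: "bounded {x. l < F x}" "bounded {x. l < G x}"
        using bounded_subset[OF bounded_closed_interval] by blast+
      have "emeasure lborel {x. l < F x} + emeasure lborel {x. l < G x} \<le> 2 * emeasure lborel {x. l < H x}"
      proof (rule emeasure_half_sum)
        show "bounded {x. l < F x}" "bounded {x. l < G x}" by (fact bd)+
        show "{x. l < F x} \<noteq> {}" "{x. l < G x} \<noteq> {}" using sup1 True by auto
        fix a b assume "a \<in> {x. l < F x}" "b \<in> {x. l < G x}"
        hence "l * l < F a * G b" using True by (intro mult_strict_mono) auto
        also note FGH[of a b]
        finally have "l\<^sup>2 < (H ((a+b)/2))\<^sup>2" by (simp add: power2_eq_square)
        thus "(a + b) / 2 \<in> {x. l < H x}" using H0 power2_less_imp_less by blast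
      qed simp_all
      thus ?thesis using True by simp
    qed simp
  qed
  also have "\<dots> = 2 * (\<integral>\<^sup>+x. ennreal (min 1 (H x)) \<partial>lborel)"
    unfolding nn_integral_superlevel[OF assms(3), symmetric] by (subst nn_integral_cmult) simp_all
  also have "\<dots> \<le> 2 * (\<integral>\<^sup>+x. ennreal (H x) \<partial>lborel)"
    by (intro mult_left_mono nn_integral_mono ennreal_leI) auto
  finally show ?thesis .
qed

text \<open>Division of \<open>F\<close>, \<open>G\<close> by their suprema \<open>p\<close>,
  \<open>q\<close> and of \<open>H\<close> by \<open>sqrt (p * q)\<close> preserves the hypothesis.
  The arithmetic-geometric mean inequality then turns the sum \<open>I / p + J / q\<close> into the
  product \<open>I * J\<close>.\<close>

lemma prekopa_leindler_bounded:
  fixes F G H :: "real \<Rightarrow> real"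
  assumes [measurable]: "F \<in> borel_measurable borel" "G \<in> borel_measurable borel" "H \<in> borel_measurable borel"
    and nonneg: "\<And>x. 0 \<le> F x" "\<And>x. 0 \<le> G x" "\<And>x. 0 \<le> H x"
    and bnd: "\<And>x. F x \<le> C" "\<And>x. G x \<le> C"
    and supp: "\<And>x. x \<notin> {-k..k} \<Longrightarrow> F x = 0" "\<And>x. x \<notin> {-k..k} \<Longrightarrow> G x = 0"
    and FGH: "\<And>a b. F a * G b \<le> (H ((a + b) / 2))\<^sup>2"
  shows "(\<integral>\<^sup>+x. ennreal (F x) \<partial>lborel) * (\<integral>\<^sup>+x. ennreal (G x) \<partial>lborel) \<le> (\<integral>\<^sup>+x. ennreal (H x) \<partial>lborel)\<^sup>2"
proof (cases "(\<forall>x. F x = 0) \<or> (\<forall>x. G x = 0)")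
  case True
  thus ?thesis by auto
next
  case False
  then obtain xF xG where xFG: "F xF \<noteq> 0" "G xG \<noteq> 0" by blast
  define p where "p = (SUP x. F x)" define q where "q = (SUP x. G x)"
  have bF: "bdd_above (range F)" and bG: "bdd_above (range G)" using bnd by (auto intro!: bdd_aboveI)
  have Fp: "F x \<le> p" and Gq: "G x \<le> q" for x
    unfolding p_def q_def by (intro cSUP_upper bF bG UNIV_I)+
  have p: "0 < p" and q: "0 < q"
    using xFG nonneg(1)[of xF] nonneg(2)[of xG] Fp[of xF] Gq[of xG] by linarith+
  define h where "h = sqrt (p * q)"
  have h: "0 < h" "h\<^sup>2 = p * q" using p q by (auto simp: h_def)
  have main: "(\<integral>\<^sup>+x. ennreal (F x / p) \<partial>lborel) + (\<integral>\<^sup>+x. ennreal (G x / q) \<partial>lborel) \<le> 2 * (\<integral>\<^sup>+x. ennreal (H x / h) \<partial>lborel)"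
  proof (rule prekopa_leindler_normalized[where k=k])
    show "F x / p \<le> 1" "G x / q \<le> 1" for x using Fp Gq p q by simp_all
    show "\<exists>x. l < F x / p" if "l < 1" for l
    proof -
      have "l * p < p" using that p by simp
      then obtain x where "l * p < F x" unfolding p_def using less_cSUP_iff[OF _ bF] by auto
      thus ?thesis using p by (auto simp: field_simps)
    qed
    show "\<exists>x. l < G x / q" if "l < 1" for l
    proof -
      have "l * q < q" using that q by simp
      then obtain x where "l * q < G x" unfolding q_def using less_cSUP_iff[OF _ bG] by auto
      thus ?thesis using q by (auto simp: field_simps)
    qed
    show "F a / p * (G b / q) \<le> (H ((a + b) / 2) / h)\<^sup>2" for a b
      using FGH[of a b] p q by (simp add: power_divide h(2) divide_right_mono)
  qed (use nonneg supp h in auto)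
  have fin: "(\<integral>\<^sup>+x. ennreal (F x) \<partial>lborel) < \<infinity>" "(\<integral>\<^sup>+x. ennreal (G x) \<partial>lborel) < \<infinity>"
  proof -
    have *: "(\<integral>\<^sup>+x. ennreal (f x) \<partial>lborel) < \<infinity>" if "\<And>x. f x \<le> C" "\<And>x. x \<notin> {-k..k} \<Longrightarrow> f x = 0" for f :: "real \<Rightarrow> real"
    proof -
      have "(\<integral>\<^sup>+x. ennreal (f x) \<partial>lborel) \<le> (\<integral>\<^sup>+x. ennreal C * indicator {-k..k} x \<partial>lborel)"
        using that by (intro nn_integral_mono) (auto simp: indicator_def ennreal_leI)
      also have "\<dots> < \<infinity>" by (cases "-k \<le> k") (auto simp: nn_integral_cmult_indicator ennreal_mult_less_top)
      finally show ?thesis .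
    qed
    show "(\<integral>\<^sup>+x. ennreal (F x) \<partial>lborel) < \<infinity>" "(\<integral>\<^sup>+x. ennreal (G x) \<partial>lborel) < \<infinity>"
      by (intro * bnd supp; assumption)+
  qed
  show ?thesis
  proof (cases "(\<integral>\<^sup>+x. ennreal (H x) \<partial>lborel) = \<infinity>")
    case True thus ?thesis by (simp add: power2_eq_square ennreal_mult_top)
  next
    case False
    define I where "I = enn2real (\<integral>\<^sup>+x. ennreal (F x) \<partial>lborel)"
    define J where "J = enn2real (\<integral>\<^sup>+x. ennreal (G x) \<partial>lborel)"
    define L where "L = enn2real (\<integral>\<^sup>+x. ennreal (H x) \<partial>lborel)"
    have IJL: "(\<integral>\<^sup>+x. ennreal (F x) \<partial>lborel) = ennreal I" "(\<integral>\<^sup>+x. ennreal (G x) \<partial>lborel) = ennreal J"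
      "(\<integral>\<^sup>+x. ennreal (H x) \<partial>lborel) = ennreal L"
      using fin False by (simp_all add: I_def J_def L_def less_top)
    have nn: "0 \<le> I" "0 \<le> J" "0 \<le> L" by (simp_all add: I_def J_def L_def)
    have div: "(\<integral>\<^sup>+x. ennreal (f x / c) \<partial>lborel) = ennreal (r / c)"
      if "(\<integral>\<^sup>+x. ennreal (f x) \<partial>lborel) = ennreal r" "0 < c" "f \<in> borel_measurable borel" "\<And>x. 0 \<le> f x" "0 \<le> r"
      for f c r
    proof -
      have "(\<integral>\<^sup>+x. ennreal (f x / c) \<partial>lborel) = (\<integral>\<^sup>+x. ennreal (f x) / ennreal c \<partial>lborel)"
        using that by (simp add: divide_ennreal)
      also have "\<dots> = ennreal r / ennreal c" using that by (subst nn_integral_divide) auto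
      finally show ?thesis using that by (simp add: divide_ennreal)
    qed
    have "ennreal (I / p) + ennreal (J / q) \<le> 2 * ennreal (L / h)"
      using main unfolding div[OF IJL(1) p assms(1) nonneg(1) nn(1)] div[OF IJL(2) q assms(2) nonneg(2) nn(2)]
        div[OF IJL(3) h(1) assms(3) nonneg(3) nn(3)] .
    hence "ennreal (I / p + J / q) \<le> ennreal (2 * (L / h))"
      using nn p q h by (subst ennreal_mult) (simp_all add: ennreal_plus)
    hence le: "I / p + J / q \<le> 2 * (L / h)" using nn h by simp
    have "4 * (I / p) * (J / q) \<le> (I / p + J / q)\<^sup>2"
    proof -
      have "4 * x * y \<le> (x + y)\<^sup>2" for x y :: real
        using zero_le_power2[of "x - y"] by (simp add: power2_eq_square algebra_simps)
      thus ?thesis .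
    qed
    also have "\<dots> \<le> (2 * (L / h))\<^sup>2" using le nn p q by (intro power_mono) auto
    also have "\<dots> = 4 * L\<^sup>2 / (p * q)" by (simp add: power_mult_distrib power_divide h(2))
    finally have "I * J \<le> L\<^sup>2" using p q by (simp add: field_simps)
    thus ?thesis unfolding IJL using nn by (simp add: ennreal_mult[symmetric] ennreal_power ennreal_leI)
  qed
qed

text \<open>The minimum with \<open>of_nat k\<close> is finite, so \<open>enn2real\<close> loses
  nothing here. The sets \<open>Q k\<close> will be intervals on the line and cubes in a product,
  where the truncation is integrable with finite first moments.\<close>

definition trunc :: "(nat \<Rightarrow> 'a set) \<Rightarrow> ('a \<Rightarrow> ennreal) \<Rightarrow> nat \<Rightarrow> 'a \<Rightarrow> real" where
  "trunc Q \<phi> k x = enn2real (min (\<phi> x) (of_nat k)) * indicator (Q k) x"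

lemma trunc_measurable [measurable]:
  assumes [measurable]: "\<phi> \<in> borel_measurable M" "Q k \<in> sets M"
  shows "trunc Q \<phi> k \<in> borel_measurable M"
  unfolding trunc_def[abs_def] by measurable

lemma ennreal_trunc: "ennreal (trunc Q \<phi> k x) = min (\<phi> x) (of_nat k) * indicator (Q k) x"
proof -
  have "min (\<phi> x) (of_nat k) < top" by (simp add: min_less_iff_disj of_nat_less_top)
  thus ?thesis by (simp add: trunc_def indicator_def less_top)
qed

lemma trunc_bounds: "0 \<le> trunc Q \<phi> k x" "trunc Q \<phi> k x \<le> real k * indicator (Q k) x"
proof -
  have "enn2real (min (\<phi> x) (of_nat k)) \<le> enn2real (of_nat k)"
    by (intro enn2real_mono) (auto simp: of_nat_less_top)
  thus "0 \<le> trunc Q \<phi> k x" "trunc Q \<phi> k x \<le> real k * indicator (Q k) x"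
    by (auto simp: trunc_def indicator_def)
qed

lemma SUP_min_of_nat: "(SUP k. min (y::ennreal) (of_nat k)) = y"
proof -
  have "(SUP k. min y (of_nat k)) = inf y (SUP k. of_nat k)"
    by (subst inf_SUP) (simp add: inf_min)
  thus ?thesis by (simp add: ennreal_SUP_of_nat_eq_top)
qed

lemma nn_integral_trunc:
  assumes [measurable]: "\<phi> \<in> borel_measurable M" "\<And>k. Q k \<in> sets M"
    and inc: "incseq Q" and ex: "space M \<subseteq> (\<Union>k. Q k)"
  shows "(SUP k. \<integral>\<^sup>+x. ennreal (trunc Q \<phi> k x) \<partial>M) = (\<integral>\<^sup>+x. \<phi> x \<partial>M)"
    and "incseq (\<lambda>k. \<integral>\<^sup>+x. ennreal (trunc Q \<phi> k x) \<partial>M)"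
proof -
  have mono: "ennreal (trunc Q \<phi> k x) \<le> ennreal (trunc Q \<phi> l x)" if "k \<le> l" for k l x
  proof -
    have "min (\<phi> x) (of_nat k) \<le> min (\<phi> x) (of_nat l)" using that by (intro min.mono) auto
    moreover have "Q k \<subseteq> Q l" using inc that by (rule incseqD)
    ultimately show ?thesis by (auto simp: ennreal_trunc indicator_def)
  qed
  thus "incseq (\<lambda>k. \<integral>\<^sup>+x. ennreal (trunc Q \<phi> k x) \<partial>M)"
    by (intro incseq_SucI nn_integral_mono) auto
  have pt: "(SUP k. ennreal (trunc Q \<phi> k x)) = \<phi> x" if x: "x \<in> space M" for x
  proof (rule antisym)
    show "(SUP k. ennreal (trunc Q \<phi> k x)) \<le> \<phi> x"
      by (intro SUP_least) (simp add: ennreal_trunc indicator_def)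
    obtain m where m: "x \<in> Q m" using ex x by blast
    have "\<phi> x = (SUP k. min (\<phi> x) (of_nat k))" by (simp add: SUP_min_of_nat)
    also have "\<dots> \<le> (SUP k. ennreal (trunc Q \<phi> k x))"
    proof (rule SUP_least)
      fix k
      \<comment> \<open>Height and support are cut at the same index, so the index must exceed both
        \<open>k\<close> and the stage \<open>m\<close> at which \<open>x\<close> enters
        \<open>Q\<close>.\<close>
      have "min (\<phi> x) (of_nat k) \<le> min (\<phi> x) (of_nat (max k m))" by (intro min.mono) auto
      also have "\<dots> = ennreal (trunc Q \<phi> (max k m) x)"
        using m incseqD[OF inc, of m "max k m"] by (auto simp: ennreal_trunc)
      also have "\<dots> \<le> (SUP k. ennreal (trunc Q \<phi> k x))" by (rule SUP_upper) simp
      finally show "min (\<phi> x) (of_nat k) \<le> (SUP k. ennreal (trunc Q \<phi> k x))" .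
    qed
    finally show "\<phi> x \<le> (SUP k. ennreal (trunc Q \<phi> k x))" .
  qed
  have "(\<integral>\<^sup>+x. (SUP k. ennreal (trunc Q \<phi> k x)) \<partial>M) = (SUP k. \<integral>\<^sup>+x. ennreal (trunc Q \<phi> k x) \<partial>M)"
    by (intro nn_integral_monotone_convergence_SUP incseq_SucI le_funI mono) auto
  moreover have "(\<integral>\<^sup>+x. (SUP k. ennreal (trunc Q \<phi> k x)) \<partial>M) = (\<integral>\<^sup>+x. \<phi> x \<partial>M)"
    by (intro nn_integral_cong pt)
  ultimately show "(SUP k. \<integral>\<^sup>+x. ennreal (trunc Q \<phi> k x) \<partial>M) = (\<integral>\<^sup>+x. \<phi> x \<partial>M)" by simp
qed

lemma prekopa_leindler:
  fixes \<phi> \<psi> :: "real \<Rightarrow> ennreal" and H :: "real \<Rightarrow> real"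
  assumes [measurable]: "\<phi> \<in> borel_measurable borel" "\<psi> \<in> borel_measurable borel" "H \<in> borel_measurable borel"
    and H0: "\<And>x. 0 \<le> H x"
    and le: "\<And>a b. \<phi> a * \<psi> b \<le> ennreal ((H ((a + b) / 2))\<^sup>2)"
  shows "(\<integral>\<^sup>+x. \<phi> x \<partial>lborel) * (\<integral>\<^sup>+x. \<psi> x \<partial>lborel) \<le> (\<integral>\<^sup>+x. ennreal (H x) \<partial>lborel)\<^sup>2" (is "_ \<le> ?R")
proof -
  define Q where "Q k = {- real k..real k}" for k
  have Q: "Q k \<in> sets lborel" "incseq Q" for k by (auto simp: Q_def intro!: incseq_SucI)
  have ex: "space lborel \<subseteq> (\<Union>k. Q k)"
  proof
    fix x :: real
    obtain m :: nat where "\<bar>x\<bar> \<le> real m" using real_arch_simple by blast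
    hence "x \<in> Q m" by (auto simp: Q_def)
    thus "x \<in> (\<Union>k. Q k)" by blast
  qed
  have lb: "\<phi> \<in> borel_measurable lborel" "\<psi> \<in> borel_measurable lborel" by simp_all
  note tr = nn_integral_trunc[OF lb(1) Q ex] nn_integral_trunc[OF lb(2) Q ex]
  let ?A = "\<lambda>k. \<integral>\<^sup>+x. ennreal (trunc Q \<phi> k x) \<partial>lborel" and ?B = "\<lambda>k. \<integral>\<^sup>+x. ennreal (trunc Q \<psi> k x) \<partial>lborel"
  have kk: "?A k * ?B k \<le> ?R" for k
  proof (rule prekopa_leindler_bounded[where k="real k" and C="real k"])
    fix a b
    have "ennreal (trunc Q \<phi> k a) * ennreal (trunc Q \<psi> k b) \<le> \<phi> a * \<psi> b"
      by (intro mult_mono) (auto simp: ennreal_trunc indicator_def)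
    also note le[of a b]
    finally show "trunc Q \<phi> k a * trunc Q \<psi> k b \<le> (H ((a + b) / 2))\<^sup>2"
      by (simp add: ennreal_mult[symmetric] trunc_bounds)
  next
    show "trunc Q \<phi> k x = 0" "trunc Q \<psi> k x = 0" if "x \<notin> {- real k..real k}" for x
      using that by (simp_all add: trunc_def Q_def)
      show "trunc Q \<phi> k x \<le> real k" "trunc Q \<psi> k x \<le> real k" for x
      by (rule order_trans[OF trunc_bounds(2)], simp add: indicator_def)+
    show "trunc Q \<phi> k \<in> borel_measurable borel" "trunc Q \<psi> k \<in> borel_measurable borel"
      using trunc_measurable[OF lb(1) Q(1)] trunc_measurable[OF lb(2) Q(1)] by simp_all
  qed (use H0 in \<open>auto simp: trunc_bounds\<close>)
  \<comment> \<open>The bound for equal indices is extended to independent ones, since the two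
    suprema are taken one after the other.\<close>
  have "?A k * ?B l \<le> ?R" for k l
  proof -
    have "?A k * ?B l \<le> ?A (max k l) * ?B (max k l)"
      by (intro mult_mono incseqD[OF tr(2)] incseqD[OF tr(4)]) auto
    thus ?thesis using kk[of "max k l"] by (rule order_trans)
  qed
  hence "(SUP k. ?A k * (SUP l. ?B l)) \<le> ?R"
    by (simp add: SUP_mult_left_ennreal SUP_le_iff)
  thus ?thesis by (simp add: SUP_mult_right_ennreal[symmetric] tr(1,3))
qed

text \<open>Substitution \<open>x = exp a\<close> on compact intervals, then monotone convergence on
  both sides; \<open>Suc k\<close> keeps the interval nondegenerate already for
  \<open>k = 0\<close>.\<close>

lemma nn_integral_exp_substitution:
  fixes f :: "real \<Rightarrow> ennreal"
  assumes [measurable]: "f \<in> borel_measurable borel"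
  shows "(\<integral>\<^sup>+x. f x * indicator {0<..} x \<partial>lborel) = (\<integral>\<^sup>+a. f (exp a) * ennreal (exp a) \<partial>lborel)"
proof -
  have 1: "(\<integral>\<^sup>+x. f x * indicator {exp (- real (Suc k))..exp (real (Suc k))} x \<partial>lborel) =
     (\<integral>\<^sup>+a. f (exp a) * ennreal (exp a) * indicator {- real (Suc k)..real (Suc k)} a \<partial>lborel)" for k
    by (rule nn_integral_substitution_aux) (auto intro!: derivative_eq_intros continuous_intros)
  have "(\<integral>\<^sup>+x. f x * indicator {0<..} x \<partial>lborel) =
    (\<integral>\<^sup>+x. (SUP k. f x * indicator {exp (- real (Suc k))..exp (real (Suc k))} x) \<partial>lborel)"
  proof (intro nn_integral_cong)
    fix x :: real
    have "(SUP k. indicator {exp (- real (Suc k))..exp (real (Suc k))} x) = (indicator {0<..} x :: ennreal)"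
    proof (rule antisym)
      show "(SUP k. indicator {exp (- real (Suc k))..exp (real (Suc k))} x) \<le> (indicator {0<..} x :: ennreal)"
        by (intro SUP_least) (auto simp: indicator_def intro: less_le_trans[OF exp_gt_zero])
      show "(indicator {0<..} x :: ennreal) \<le> (SUP k. indicator {exp (- real (Suc k))..exp (real (Suc k))} x)"
      proof (cases "0 < x")
        case True
        obtain m :: nat where m: "\<bar>ln x\<bar> \<le> real m" using real_arch_simple by blast
        have "x \<in> {exp (- real (Suc m))..exp (real (Suc m))}"
        proof -
          have "exp (- real (Suc m)) \<le> exp (ln x)" "exp (ln x) \<le> exp (real (Suc m))" using m by auto
          thus ?thesis using True by simp
        qed
        thus ?thesis by (intro SUP_upper2[of m]) (auto simp: indicator_def)
      qed simp
    qed
    thus "f x * indicator {0<..} x = (SUP k. f x * indicator {exp (- real (Suc k))..exp (real (Suc k))} x)"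
      by (simp add: SUP_mult_left_ennreal[symmetric])
  qed
  also have "\<dots> = (SUP k. \<integral>\<^sup>+x. f x * indicator {exp (- real (Suc k))..exp (real (Suc k))} x \<partial>lborel)"
  proof (intro nn_integral_monotone_convergence_SUP incseq_SucI le_funI mult_left_mono)
    fix k x
    have "{exp (- real (Suc k))..exp (real (Suc k))} \<subseteq> {exp (- real (Suc (Suc k)))..exp (real (Suc (Suc k)))}"
      by simp
    thus "(indicator {exp (- real (Suc k))..exp (real (Suc k))} x :: ennreal) \<le>
        indicator {exp (- real (Suc (Suc k)))..exp (real (Suc (Suc k)))} x"
      by (metis indicator_simps(1) indicator_simps(2) subsetD zero_le_one zero_le order_refl)
  qed auto
  also have "\<dots> = (SUP k. \<integral>\<^sup>+a. f (exp a) * ennreal (exp a) * indicator {- real (Suc k)..real (Suc k)} a \<partial>lborel)"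
    by (simp only: 1)
  also have "\<dots> = (\<integral>\<^sup>+a. (SUP k. f (exp a) * ennreal (exp a) * indicator {- real (Suc k)..real (Suc k)} a) \<partial>lborel)"
    by (intro nn_integral_monotone_convergence_SUP[symmetric] incseq_SucI le_funI mult_left_mono)
       (auto simp: indicator_def)
  also have "\<dots> = (\<integral>\<^sup>+a. f (exp a) * ennreal (exp a) \<partial>lborel)"
  proof (intro nn_integral_cong)
    fix a :: real
    obtain m :: nat where m: "\<bar>a\<bar> \<le> real m" using real_arch_simple by blast
    have "(SUP k. indicator {- real (Suc k)..real (Suc k)} a) = (1::ennreal)"
      using m by (intro antisym SUP_least SUP_upper2[of m]) (auto simp: indicator_def)
    thus "(SUP k. f (exp a) * ennreal (exp a) * indicator {- real (Suc k)..real (Suc k)} a) = f (exp a) * ennreal (exp a)"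
      by (simp add: SUP_mult_left_ennreal[symmetric])
  qed
  finally show ?thesis .
qed

text \<open>The number is the square root of \<pi>/2, but its numerical value never enters:
  \<open>gauss_moment_ball\<close> trades its powers for the volume of the unit ball.\<close>

definition half_gauss :: ennreal where
  "half_gauss = (\<integral>\<^sup>+u. ennreal (exp (- u\<^sup>2 / 2)) * indicator {0<..} u \<partial>lborel)"

text \<open>For \<open>s = exp a\<close>, \<open>t = exp b\<close> the product \<open>s * t\<close>
  is the square of \<open>exp ((a + b) / 2)\<close>, so a bound in terms of \<open>s * t\<close> is
  a midpoint bound. The factor \<open>exp m\<close> in \<open>H\<close> accounts for the two
  Jacobians \<open>exp a\<close> and \<open>exp b\<close>.\<close>

lemma santalo_half_line:
  fixes f g :: "real \<Rightarrow> ennreal"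
  assumes [measurable]: "f \<in> borel_measurable borel" "g \<in> borel_measurable borel"
    and c: "0 \<le> c"
    and le: "\<And>s t. 0 < s \<Longrightarrow> 0 < t \<Longrightarrow> f s * g t \<le> ennreal (c * exp (- (s * t)))"
  shows "(\<integral>\<^sup>+s. f s * indicator {0<..} s \<partial>lborel) * (\<integral>\<^sup>+t. g t * indicator {0<..} t \<partial>lborel)
    \<le> ennreal c * half_gauss\<^sup>2"
proof -
  define H where "H m = sqrt c * (exp (- (exp m)\<^sup>2 / 2) * exp m)" for m :: real
  have "(\<integral>\<^sup>+a. f (exp a) * ennreal (exp a) \<partial>lborel) * (\<integral>\<^sup>+a. g (exp a) * ennreal (exp a) \<partial>lborel)
    \<le> (\<integral>\<^sup>+m. ennreal (H m) \<partial>lborel)\<^sup>2"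
  proof (rule prekopa_leindler)
    fix a b :: real
    have "f (exp a) * ennreal (exp a) * (g (exp b) * ennreal (exp b)) = f (exp a) * g (exp b) * ennreal (exp a * exp b)"
      by (simp add: ennreal_mult mult_ac)
    also have "\<dots> \<le> ennreal (c * exp (- (exp a * exp b))) * ennreal (exp a * exp b)"
      by (intro mult_right_mono le) auto
    also have "\<dots> = ennreal (c * exp (- (exp a * exp b)) * (exp a * exp b))"
      using c by (simp add: ennreal_mult)
    also have "c * exp (- (exp a * exp b)) * (exp a * exp b) = (H ((a + b) / 2))\<^sup>2"
    proof -
      have e: "exp a * exp b = (exp ((a + b) / 2))\<^sup>2"
        by (simp add: power2_eq_square flip: exp_add)
      have "(exp (- X / 2))\<^sup>2 = exp (- X)" for X :: real
        by (simp add: power2_eq_square flip: exp_add)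
      thus ?thesis unfolding e H_def using c by (simp add: power_mult_distrib)
    qed
    finally show "f (exp a) * ennreal (exp a) * (g (exp b) * ennreal (exp b)) \<le> ennreal ((H ((a + b) / 2))\<^sup>2)" .
  qed (auto simp: H_def c)
  also have "(\<integral>\<^sup>+m. ennreal (H m) \<partial>lborel) = ennreal (sqrt c) * half_gauss"
    unfolding half_gauss_def H_def
    by (subst nn_integral_exp_substitution, simp, subst nn_integral_cmult[symmetric])
       (auto simp: ennreal_mult c)
  also have "(ennreal (sqrt c) * half_gauss)\<^sup>2 = ennreal c * half_gauss\<^sup>2"
    using c by (simp add: power_mult_distrib ennreal_power)
  finally show ?thesis by (simp add: nn_integral_exp_substitution)
qed

section \<open>The functional Santalo inequality\<close>

text \<open>The model of n-space for the induction on the dimension: the index set \<open>I\<close>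
  is a term and can grow by one element, whereas the dimension of \<open>real^'n\<close> is fixed by
  its type.\<close>

abbreviation LB :: "'i set \<Rightarrow> ('i \<Rightarrow> real) measure" where
  "LB I \<equiv> Pi\<^sub>M I (\<lambda>_. lborel)"

lemma product_sigma_finite_lborel: "product_sigma_finite (\<lambda>_::'i. lborel :: real measure)"
  by standard

lemma sigma_finite_LB: "finite I \<Longrightarrow> sigma_finite_measure (LB I)"
  using product_sigma_finite.sigma_finite[OF product_sigma_finite_lborel] .

lemma pair_sigma_finite_LB: "finite I \<Longrightarrow> pair_sigma_finite (LB I) (lborel :: real measure)"
  by (intro pair_sigma_finite.intro sigma_finite_LB) (simp_all add: lborel.sigma_finite_measure_axioms)

section \<open>Lebesgue measure on a finite product: translations, shears and splitting along a
  hyperplane\<close>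

lemma distr_LB_translate:
  fixes w :: "'i \<Rightarrow> real"
  assumes I: "finite I"
  shows "distr (LB I) (LB I) (\<lambda>x. \<lambda>j\<in>I. w j + x j) = LB I"
proof -
  interpret product_sigma_finite "\<lambda>_::'i. lborel :: real measure" by standard
  have m [measurable]: "(\<lambda>x. \<lambda>j\<in>I. w j + x j) \<in> measurable (LB I) (LB I)"
    by (intro measurable_restrict) measurable
  show ?thesis
  proof (rule PiM_eqI[OF I])
    fix A :: "'i \<Rightarrow> real set" assume A: "\<And>j. j \<in> I \<Longrightarrow> A j \<in> sets lborel"
    have pre: "emeasure lborel ((+) (w j) -` A j) = emeasure lborel (A j)"
      and preS: "(+) (w j) -` A j \<in> sets lborel" if "j \<in> I" for j
    proof -
      have [measurable]: "A j \<in> sets borel" using A[OF that] by simp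
      show "(+) (w j) -` A j \<in> sets lborel"
        using measurable_sets_borel[of "(+) (w j)" "borel" "A j"] by simp
      have "emeasure lborel (A j) = emeasure (distr lborel borel ((+) (w j))) (A j)"
        by (simp add: lborel_distr_plus)
      also have "\<dots> = emeasure lborel ((+) (w j) -` A j)" by (subst emeasure_distr) auto
      finally show "emeasure lborel ((+) (w j) -` A j) = emeasure lborel (A j)" by simp
    qed
    have "emeasure (distr (LB I) (LB I) (\<lambda>x. \<lambda>j\<in>I. w j + x j)) (Pi\<^sub>E I A)
       = emeasure (LB I) ((\<lambda>x. \<lambda>j\<in>I. w j + x j) -` (Pi\<^sub>E I A) \<inter> space (LB I))"
      using A I by (intro emeasure_distr sets_PiM_I_finite) auto
    also have "(\<lambda>x. \<lambda>j\<in>I. w j + x j) -` (Pi\<^sub>E I A) \<inter> space (LB I) = Pi\<^sub>E I (\<lambda>j. (+) (w j) -` A j)"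
      by (auto simp: space_PiM PiE_def Pi_def)
    also have "emeasure (LB I) \<dots> = (\<Prod>j\<in>I. emeasure lborel ((+) (w j) -` A j))"
      by (intro emeasure_PiM I preS)
    also have "\<dots> = (\<Prod>j\<in>I. emeasure lborel (A j))" by (intro prod.cong refl pre)
    finally show "emeasure (distr (LB I) (LB I) (\<lambda>x. \<lambda>j\<in>I. w j + x j)) (Pi\<^sub>E I A) = (\<Prod>j\<in>I. emeasure lborel (A j))" .
  qed simp
qed

lemma nn_integral_LB_translate:
  fixes \<phi> :: "('i \<Rightarrow> real) \<Rightarrow> ennreal"
  assumes I: "finite I" and [measurable]: "\<phi> \<in> borel_measurable (LB I)"
  shows "(\<integral>\<^sup>+x. \<phi> (\<lambda>j\<in>I. w j + x j) \<partial>LB I) = (\<integral>\<^sup>+x. \<phi> x \<partial>LB I)"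
proof -
  have m [measurable]: "(\<lambda>x. \<lambda>j\<in>I. w j + x j) \<in> measurable (LB I) (LB I)"
    by (intro measurable_restrict) measurable
  show ?thesis
    by (subst (2) distr_LB_translate[OF I, symmetric, of w]) (simp add: nn_integral_distr)
qed

text \<open>Oblique coordinates: with \<open>e\<close> the unit vector of the coordinate
  \<open>i\<close>, the value is \<open>z + \<sigma> s (v + e) + y\<close>. The hyperplane
  \<open>x i = z i\<close> is \<open>s = 0\<close>, and for \<open>s > 0\<close> the signs
  \<open>\<sigma> = 1\<close> and \<open>\<sigma> = -1\<close> sweep its two sides.\<close>

definition shear :: "'i set \<Rightarrow> 'i \<Rightarrow> ('i \<Rightarrow> real) \<Rightarrow> ('i \<Rightarrow> real) \<Rightarrow> real \<Rightarrow> ('i \<Rightarrow> real) \<times> real \<Rightarrow> ('i \<Rightarrow> real)" where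
  "shear I i z v \<sigma> = (\<lambda>(y, s). (\<lambda>j\<in>I. z j + \<sigma> * s * v j + y j)(i := z i + \<sigma> * s))"

lemma shear_measurable [measurable]:
  "shear I i z v \<sigma> \<in> measurable (LB I \<Otimes>\<^sub>M lborel) (LB (insert i I))"
  unfolding shear_def split_beta'
  by (rule measurable_fun_upd[where J=I]) (auto intro!: measurable_restrict)

text \<open>Fubini: for fixed \<open>s\<close> the part in \<open>I\<close> is a translation, and
  what remains in the coordinate \<open>i\<close> is an affine map with a factor of modulus
  1.\<close>

lemma distr_shear:
  fixes z v :: "'i \<Rightarrow> real"
  assumes I: "finite I" "i \<notin> I" and \<sigma>: "\<bar>\<sigma>\<bar> = 1"
  shows "distr (LB I \<Otimes>\<^sub>M lborel) (LB (insert i I)) (shear I i z v \<sigma>) = LB (insert i I)"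
proof (rule measure_eqI)
  interpret product_sigma_finite "\<lambda>_::'i. lborel :: real measure" by standard
  interpret P: pair_sigma_finite "LB I" "lborel :: real measure" by (rule pair_sigma_finite_LB[OF I(1)])
  fix A assume "A \<in> sets (distr (LB I \<Otimes>\<^sub>M lborel) (LB (insert i I)) (shear I i z v \<sigma>))"
  hence A [measurable]: "A \<in> sets (LB (insert i I))" by simp
  have upd [measurable]: "(\<lambda>(y, s). y(i := s)) \<in> measurable (LB I \<Otimes>\<^sub>M lborel) (LB (insert i I))"
    unfolding split_beta' by (rule measurable_fun_upd[where J=I]) auto
  define h :: "('i \<Rightarrow> real) \<Rightarrow> real \<Rightarrow> ennreal" where "h y s = indicator A (y(i := s))" for y s
  have h [measurable]: "case_prod h \<in> borel_measurable (LB I \<Otimes>\<^sub>M lborel)"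
    unfolding h_def using measurable_compose[OF upd, of "indicator A" borel] by (simp add: split_beta')
  have "emeasure (distr (LB I \<Otimes>\<^sub>M lborel) (LB (insert i I)) (shear I i z v \<sigma>)) A
     = (\<integral>\<^sup>+x. indicator A x \<partial>distr (LB I \<Otimes>\<^sub>M lborel) (LB (insert i I)) (shear I i z v \<sigma>))"
    by simp
  also have "\<dots> = (\<integral>\<^sup>+p. indicator A (shear I i z v \<sigma> p) \<partial>(LB I \<Otimes>\<^sub>M lborel))"
    by (intro nn_integral_distr) auto
  also have "\<dots> = (\<integral>\<^sup>+s. (\<integral>\<^sup>+y. h (\<lambda>j\<in>I. (z j + \<sigma> * s * v j) + y j) (z i + \<sigma> * s) \<partial>LB I) \<partial>lborel)"
    by (subst P.nn_integral_snd[symmetric]) (auto simp: h_def shear_def)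
  also have "\<dots> = (\<integral>\<^sup>+s. (\<integral>\<^sup>+y. h y (z i + \<sigma> * s) \<partial>LB I) \<partial>lborel)"
    by (intro nn_integral_cong nn_integral_LB_translate[OF I(1)]) measurable
  also have "\<dots> = (\<integral>\<^sup>+s. (\<integral>\<^sup>+y. h y s \<partial>LB I) \<partial>lborel)"
    using nn_integral_real_affine[of "\<lambda>s. \<integral>\<^sup>+y. h y s \<partial>LB I" \<sigma> "z i"] \<sigma> by auto
  also have "\<dots> = (\<integral>\<^sup>+y. (\<integral>\<^sup>+s. h y s \<partial>lborel) \<partial>LB I)"
    by (rule P.Fubini') measurable
  also have "\<dots> = (\<integral>\<^sup>+x. indicator A x \<partial>LB (insert i I))"
    unfolding h_def by (rule product_nn_integral_insert[OF I, symmetric]) measurable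
  finally show "emeasure (distr (LB I \<Otimes>\<^sub>M lborel) (LB (insert i I)) (shear I i z v \<sigma>)) A = emeasure (LB (insert i I)) A"
    by simp
qed simp

text \<open>These are the coordinates dual to \<open>shear\<close>: when \<open>c y\<close> is the
  sum of the \<open>v j * y j\<close>, a sheared point at height \<open>r\<close> (taken relative to
  \<open>z\<close>) and a dual point at height \<open>u\<close> on the same side have as pairing the
  pairing of their parts in \<open>I\<close> plus \<open>r * u\<close>.\<close>

lemma nn_integral_LB_split:
  fixes g :: "('i \<Rightarrow> real) \<Rightarrow> ennreal"
  assumes I: "finite I" "i \<notin> I" and [measurable]: "g \<in> borel_measurable (LB (insert i I))"
    and [measurable]: "c \<in> borel_measurable (LB I)"
  shows "(\<integral>\<^sup>+x. g x \<partial>LB (insert i I)) =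
     (\<integral>\<^sup>+(y, s). g (y(i := s - c y)) * indicator {0<..} s \<partial>(LB I \<Otimes>\<^sub>M lborel))
   + (\<integral>\<^sup>+(y, s). g (y(i := - s - c y)) * indicator {0<..} s \<partial>(LB I \<Otimes>\<^sub>M lborel))"
proof -
  interpret product_sigma_finite "\<lambda>_::'i. lborel :: real measure" by standard
  interpret P: pair_sigma_finite "LB I" "lborel :: real measure" by (rule pair_sigma_finite_LB[OF I(1)])
  have upd [measurable]: "(\<lambda>(y, s). y(i := a * s - c y)) \<in> measurable (LB I \<Otimes>\<^sub>M lborel) (LB (insert i I))" for a :: real
    unfolding split_beta' by (rule measurable_fun_upd[where J=I]) auto
  have gm [measurable]: "(\<lambda>(y, s). g (y(i := a * s - c y))) \<in> borel_measurable (LB I \<Otimes>\<^sub>M lborel)" for a :: real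
    using measurable_compose[OF upd, of g borel] by (simp add: split_beta')
  have gm1 [measurable]: "(\<lambda>(y, s). g (y(i := s - c y))) \<in> borel_measurable (LB I \<Otimes>\<^sub>M lborel)"
    using gm[of 1] by simp
  have gm2 [measurable]: "(\<lambda>(y, s). g (y(i := - s - c y))) \<in> borel_measurable (LB I \<Otimes>\<^sub>M lborel)"
    using gm[of "-1"] by simp
  have gy [measurable]: "(\<lambda>s. g (y(i := s - c y))) \<in> borel_measurable borel" if "y \<in> space (LB I)" for y
    using measurable_compose[OF measurable_Pair1'[OF that, of "lborel :: real measure"] gm1] by simp
  have "(\<integral>\<^sup>+x. g x \<partial>LB (insert i I)) = (\<integral>\<^sup>+y. (\<integral>\<^sup>+s. g (y(i := s)) \<partial>lborel) \<partial>LB I)"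
    by (rule product_nn_integral_insert[OF I]) measurable
  also have "\<dots> = (\<integral>\<^sup>+y. (\<integral>\<^sup>+s. g (y(i := s - c y)) * indicator {0<..} s \<partial>lborel)
      + (\<integral>\<^sup>+s. g (y(i := - s - c y)) * indicator {0<..} s \<partial>lborel) \<partial>LB I)"
  proof (rule nn_integral_cong)
    fix y assume y: "y \<in> space (LB I)"
    have [measurable]: "(\<lambda>s. g (y(i := s - c y))) \<in> borel_measurable borel" by (rule gy[OF y])
    have [measurable]: "(\<lambda>s. g (y(i := s))) \<in> borel_measurable borel"
      using measurable_compose[OF _ gy[OF y], of "\<lambda>s. s + c y" borel] by simp
    have "(\<integral>\<^sup>+s. g (y(i := s)) \<partial>lborel) = (\<integral>\<^sup>+s. g (y(i := s - c y)) \<partial>lborel)"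
      using nn_integral_real_affine[of "\<lambda>s. g (y(i := s))" 1 "- c y"] by simp
    also have "\<dots> = (\<integral>\<^sup>+s. g (y(i := s - c y)) * indicator {0<..} s + g (y(i := s - c y)) * indicator {..<0} s \<partial>lborel)"
    proof (rule nn_integral_cong_AE)
      show "AE s in lborel. g (y(i := s - c y)) = g (y(i := s - c y)) * indicator {0<..} s + g (y(i := s - c y)) * indicator {..<0} s"
        using AE_lborel_singleton[of "0::real"] by eventually_elim (auto simp: indicator_def)
    qed
    also have "\<dots> = (\<integral>\<^sup>+s. g (y(i := s - c y)) * indicator {0<..} s \<partial>lborel) + (\<integral>\<^sup>+s. g (y(i := s - c y)) * indicator {..<0} s \<partial>lborel)"
      by (intro nn_integral_add) auto
    also have "(\<integral>\<^sup>+s. g (y(i := s - c y)) * indicator {..<0} s \<partial>lborel) = (\<integral>\<^sup>+s. g (y(i := - s - c y)) * indicator {0<..} s \<partial>lborel)"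
      by (subst nn_integral_real_affine[where c="-1" and t=0]) (auto intro!: nn_integral_cong simp: indicator_def)
    finally show "(\<integral>\<^sup>+s. g (y(i := s)) \<partial>lborel) = (\<integral>\<^sup>+s. g (y(i := s - c y)) * indicator {0<..} s \<partial>lborel)
      + (\<integral>\<^sup>+s. g (y(i := - s - c y)) * indicator {0<..} s \<partial>lborel)" .
  qed
  also have "\<dots> = (\<integral>\<^sup>+y. (\<integral>\<^sup>+s. g (y(i := s - c y)) * indicator {0<..} s \<partial>lborel) \<partial>LB I)
      + (\<integral>\<^sup>+y. (\<integral>\<^sup>+s. g (y(i := - s - c y)) * indicator {0<..} s \<partial>lborel) \<partial>LB I)"
    by (intro nn_integral_add) measurable
  also have "\<dots> = (\<integral>\<^sup>+(y, s). g (y(i := s - c y)) * indicator {0<..} s \<partial>(LB I \<Otimes>\<^sub>M lborel))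
   + (\<integral>\<^sup>+(y, s). g (y(i := - s - c y)) * indicator {0<..} s \<partial>(LB I \<Otimes>\<^sub>M lborel))"
  proof -
    have m: "(\<lambda>(y, s). g (y(i := s - c y)) * indicator {0<..} s) \<in> borel_measurable (LB I \<Otimes>\<^sub>M lborel)"
      "(\<lambda>(y, s). g (y(i := - s - c y)) * indicator {0<..} s) \<in> borel_measurable (LB I \<Otimes>\<^sub>M lborel)"
      by measurable
    show ?thesis using lborel.nn_integral_fst[OF m(1)] lborel.nn_integral_fst[OF m(2)] by simp
  qed
  finally show ?thesis .
qed

text \<open>Since \<open>(s - 1)\<^sup>2 \<ge> 0\<close>, the Gaussian is at most
  \<open>exp (1/2 - s)\<close>, and the Gamma integral bounds the moment.\<close>

lemma gauss_moment_finite: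
  "(\<integral>\<^sup>+s. ennreal (s ^ m * exp (- s\<^sup>2 / 2)) * indicator {0<..} s \<partial>lborel) < \<infinity>"
proof -
  define h where "h s = exp (1/2) * (s powr (real (Suc m) - 1) / exp s)" for s :: real
  have "(h has_integral (exp (1/2) * Gamma (real (Suc m)))) {0..}"
    unfolding h_def by (intro has_integral_mult_right Gamma_integral_real) simp
  hence "(\<integral>\<^sup>+s. ennreal (h s) * indicator {0..} s \<partial>lborel) = ennreal (exp (1/2) * Gamma (real (Suc m)))"
    by (rule nn_integral_has_integral_lebesgue'[rotated]) (simp add: h_def)
  moreover have "(\<integral>\<^sup>+s. ennreal (s ^ m * exp (- s\<^sup>2 / 2)) * indicator {0<..} s \<partial>lborel)
      \<le> (\<integral>\<^sup>+s. ennreal (h s) * indicator {0..} s \<partial>lborel)"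
  proof (intro nn_integral_mono)
    fix s :: real
    show "ennreal (s ^ m * exp (- s\<^sup>2 / 2)) * indicator {0<..} s \<le> ennreal (h s) * indicator {0..} s"
    proof (cases "0 < s")
      case True
      have "exp (- s\<^sup>2 / 2) \<le> exp (1/2 - s)"
        using zero_le_power2[of "s - 1"] by (simp add: power2_eq_square algebra_simps)
      hence "s ^ m * exp (- s\<^sup>2 / 2) \<le> s ^ m * exp (1/2 - s)" using True by (intro mult_left_mono) auto
      also have "\<dots> = h s" using True by (simp add: h_def powr_realpow exp_diff)
      finally have "s ^ m * exp (- s\<^sup>2 / 2) \<le> h s" .
      thus ?thesis using True by (simp add: ennreal_leI)
    qed simp
  qed
  ultimately show ?thesis by (simp add: le_less_trans)
qed

lemma half_gauss_finite: "half_gauss < \<infinity>"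
  using gauss_moment_finite[of 0] by (simp add: half_gauss_def)

section \<open>The two forms of the functional inequality and the reduction to lower
  dimension\<close>

definition santalo_centered :: "'i set \<Rightarrow> bool" where
  "santalo_centered I \<longleftrightarrow> (\<forall>F G. F \<in> borel_measurable (LB I) \<longrightarrow> (\<forall>x. 0 \<le> F x) \<longrightarrow> integrable (LB I) F \<longrightarrow>
     (\<forall>j\<in>I. integrable (LB I) (\<lambda>x. F x * x j) \<and> (\<integral>x. F x * x j \<partial>LB I) = 0) \<longrightarrow>
     G \<in> borel_measurable (LB I) \<longrightarrow>
     (\<forall>x\<in>space (LB I). \<forall>y\<in>space (LB I). ennreal (F x) * G y \<le> ennreal (exp (- (\<Sum>j\<in>I. x j * y j)))) \<longrightarrow>
     (\<integral>\<^sup>+x. ennreal (F x) \<partial>LB I) * (\<integral>\<^sup>+x. G x \<partial>LB I) \<le> (4 * half_gauss\<^sup>2) ^ card I)"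

text \<open>\<open>z\<close> is chosen before \<open>g\<close>, so that later a \<open>g\<close>
  depending on \<open>z\<close> can be inserted. The constant in both forms is
  \<open>(2 \<pi>)\<^sup>n\<close>, the value for two standard Gaussians.\<close>

definition santalo_shifted :: "'i set \<Rightarrow> bool" where
  "santalo_shifted I \<longleftrightarrow> (\<forall>f. f \<in> borel_measurable (LB I) \<longrightarrow> (\<forall>x. 0 \<le> f x) \<longrightarrow> integrable (LB I) f \<longrightarrow>
     (\<forall>j\<in>I. integrable (LB I) (\<lambda>x. f x * x j)) \<longrightarrow>
     (\<exists>z. \<forall>g. g \<in> borel_measurable (LB I) \<longrightarrow>
        (\<forall>x\<in>space (LB I). \<forall>y\<in>space (LB I). ennreal (f (\<lambda>j\<in>I. z j + x j)) * g y \<le> ennreal (exp (- (\<Sum>j\<in>I. x j * y j)))) \<longrightarrow>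
        (\<integral>\<^sup>+x. ennreal (f x) \<partial>LB I) * (\<integral>\<^sup>+x. g x \<partial>LB I) \<le> (4 * half_gauss\<^sup>2) ^ card I))"

text \<open>Along each pair of fibres the one-dimensional hypothesis holds with a factor that
  depends only on the parts in \<open>I\<close>. Hence the marginals \<open>F\<close> and
  \<open>G\<close> satisfy the lower-dimensional hypothesis up to \<open>half_gauss\<^sup>2\<close>,
  and the conditions on first moments say that \<open>F\<close> is centered.\<close>

lemma santalo_half_space:
  fixes f :: "('i \<Rightarrow> real) \<times> real \<Rightarrow> real" and g :: "('i \<Rightarrow> real) \<times> real \<Rightarrow> ennreal"
  assumes Q: "santalo_centered I" and I: "finite I"
    and f0: "\<And>p. 0 \<le> f p" and fint: "integrable (LB I \<Otimes>\<^sub>M lborel) (\<lambda>p. f p * indicator {0<..} (snd p))"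
    and fmom: "\<And>j. j \<in> I \<Longrightarrow> integrable (LB I \<Otimes>\<^sub>M lborel) (\<lambda>p. f p * indicator {0<..} (snd p) * fst p j)"
    and fbar: "\<And>j. j \<in> I \<Longrightarrow> (\<integral>p. f p * indicator {0<..} (snd p) * fst p j \<partial>(LB I \<Otimes>\<^sub>M lborel)) = 0"
    and g [measurable]: "g \<in> borel_measurable (LB I \<Otimes>\<^sub>M lborel)"
    and f [measurable]: "f \<in> borel_measurable (LB I \<Otimes>\<^sub>M lborel)"
    and fg: "\<And>x y s t. x \<in> space (LB I) \<Longrightarrow> y \<in> space (LB I) \<Longrightarrow> 0 < s \<Longrightarrow> 0 < t \<Longrightarrow>
       ennreal (f (x, s)) * g (y, t) \<le> ennreal (exp (- ((\<Sum>j\<in>I. x j * y j) + s * t)))"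
  shows "(\<integral>\<^sup>+p. ennreal (f p * indicator {0<..} (snd p)) \<partial>(LB I \<Otimes>\<^sub>M lborel))
       * (\<integral>\<^sup>+(y, t). g (y, t) * indicator {0<..} t \<partial>(LB I \<Otimes>\<^sub>M lborel))
       \<le> half_gauss\<^sup>2 * (4 * half_gauss\<^sup>2) ^ card I"
proof -
  interpret P: pair_sigma_finite "LB I" "lborel :: real measure" by (rule pair_sigma_finite_LB[OF I])
  define F where "F y = (\<integral>s. f (y, s) * indicator {0<..} s \<partial>lborel)" for y
  define G where "G y = (\<integral>\<^sup>+t. g (y, t) * indicator {0<..} t \<partial>lborel)" for y
  have Fm [measurable]: "F \<in> borel_measurable (LB I)" unfolding F_def by measurable
  have Gm [measurable]: "G \<in> borel_measurable (LB I)" unfolding G_def by measurable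
  have F0: "0 \<le> F y" for y unfolding F_def using f0 by (intro integral_nonneg_AE AE_I2) auto
  have Fi: "integrable (LB I) F" and FI: "(\<integral>y. F y \<partial>LB I) = (\<integral>p. f p * indicator {0<..} (snd p) \<partial>(LB I \<Otimes>\<^sub>M lborel))"
    using P.integrable_fst'[OF fint] P.integral_fst'[OF fint] unfolding F_def by simp_all
  have Fj: "integrable (LB I) (\<lambda>y. F y * y j) \<and> (\<integral>y. F y * y j \<partial>LB I) = 0" if "j \<in> I" for j
    using P.integrable_fst'[OF fmom[OF that]] P.integral_fst'[OF fmom[OF that]] fbar[OF that] unfolding F_def by simp
  \<comment> \<open>On a fibre that is not integrable the Bochner integral \<open>F y\<close> is 0,
    so for every \<open>y\<close> only an inequality is available; it has the direction that is
    needed.\<close>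
  have Fle: "ennreal (F y) \<le> (\<integral>\<^sup>+s. ennreal (f (y, s)) * indicator {0<..} s \<partial>lborel)" for y
  proof (cases "integrable lborel (\<lambda>s. f (y, s) * indicator {0<..} s)")
    case True
    have "(\<integral>\<^sup>+s. ennreal (f (y, s)) * indicator {0<..} s \<partial>lborel) = (\<integral>\<^sup>+s. ennreal (f (y, s) * indicator {0<..} s) \<partial>lborel)"
      by (intro nn_integral_cong) (simp add: indicator_def)
    also have "\<dots> = ennreal (F y)" unfolding F_def using f0 by (intro nn_integral_eq_integral True AE_I2) simp
    finally show ?thesis by simp
  qed (simp add: F_def not_integrable_integral_eq)
  have FG: "ennreal (F x) * G y \<le> half_gauss\<^sup>2 * ennreal (exp (- (\<Sum>j\<in>I. x j * y j)))"
    if xy: "x \<in> space (LB I)" "y \<in> space (LB I)" for x y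
  proof -
    let ?e = "exp (- (\<Sum>j\<in>I. x j * y j))"
    have [measurable]: "(\<lambda>s. f (x, s)) \<in> borel_measurable borel" "(\<lambda>s. g (y, s)) \<in> borel_measurable borel"
      using measurable_Pair2[OF f xy(1)] measurable_Pair2[OF g xy(2)] by simp_all
    have "ennreal (F x) * G y \<le> (\<integral>\<^sup>+s. ennreal (f (x, s)) * indicator {0<..} s \<partial>lborel) * G y"
      by (intro mult_right_mono Fle) simp
    also have "\<dots> \<le> ennreal ?e * half_gauss\<^sup>2"
      unfolding G_def
    proof (rule santalo_half_line)
      fix s t :: real assume "0 < s" "0 < t"
      from fg[OF xy this] show "ennreal (f (x, s)) * g (y, t) \<le> ennreal (?e * exp (- (s * t)))"
        by (simp flip: exp_add)
    qed simp_all
    finally show ?thesis by (simp add: mult.commute)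
  qed
  have hg: "half_gauss \<noteq> 0"
  proof
    assume "half_gauss = 0"
    hence "AE u::real in lborel. ennreal (exp (- u\<^sup>2 / 2)) * indicator {0<..} u = 0"
      unfolding half_gauss_def by (subst (asm) nn_integral_0_iff_AE) auto
    hence "AE u::real in lborel. u \<notin> {0<..}" by eventually_elim (auto simp: indicator_def split: if_splits)
    hence "emeasure lborel ({0<..} :: real set) = 0" by (subst (asm) AE_iff_measurable[of "{0<..}"]) auto
    moreover have "emeasure lborel {1..2::real} \<le> emeasure lborel {0::real<..}" by (intro emeasure_mono) auto
    ultimately show False by simp
  qed
  have "(\<integral>\<^sup>+x. ennreal (F x) \<partial>LB I) * (\<integral>\<^sup>+y. G y \<partial>LB I) \<le> half_gauss\<^sup>2 * (4 * half_gauss\<^sup>2) ^ card I"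
  proof -
    \<comment> \<open>The lower-dimensional hypothesis has no free constant, so the factor
      \<open>half_gauss\<^sup>2\<close> is moved into \<open>G\<close> by its inverse, which
      requires it to be finite and nonzero.\<close>
    obtain r where r: "half_gauss = ennreal r" "0 \<le> r"
      using half_gauss_finite by (cases half_gauss) auto
    hence k: "inverse (half_gauss\<^sup>2) * half_gauss\<^sup>2 = 1"
      using hg unfolding r(1) by (simp add: ennreal_power inverse_ennreal ennreal_mult[symmetric])
    have "(\<integral>\<^sup>+x. ennreal (F x) \<partial>LB I) * (\<integral>\<^sup>+y. inverse (half_gauss\<^sup>2) * G y \<partial>LB I) \<le> (4 * half_gauss\<^sup>2) ^ card I"
    proof (rule Q[unfolded santalo_centered_def, rule_format])
      fix x y assume xy: "x \<in> space (LB I)" "y \<in> space (LB I)"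
      have "ennreal (F x) * (inverse (half_gauss\<^sup>2) * G y) = inverse (half_gauss\<^sup>2) * (ennreal (F x) * G y)"
        by (simp add: mult_ac)
      also have "\<dots> \<le> inverse (half_gauss\<^sup>2) * (half_gauss\<^sup>2 * ennreal (exp (- (\<Sum>j\<in>I. x j * y j))))"
        by (intro mult_left_mono FG xy) simp
      also have "\<dots> = ennreal (exp (- (\<Sum>j\<in>I. x j * y j)))" by (simp add: mult.assoc[symmetric] k)
      finally show "ennreal (F x) * (inverse (half_gauss\<^sup>2) * G y) \<le> ennreal (exp (- (\<Sum>j\<in>I. x j * y j)))" .
    qed (use F0 Fi Fj in auto)
    hence "half_gauss\<^sup>2 * ((\<integral>\<^sup>+x. ennreal (F x) \<partial>LB I) * (inverse (half_gauss\<^sup>2) * (\<integral>\<^sup>+y. G y \<partial>LB I))) \<le> half_gauss\<^sup>2 * (4 * half_gauss\<^sup>2) ^ card I"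
      by (intro mult_left_mono) (simp_all add: nn_integral_cmult)
    moreover have "half_gauss\<^sup>2 * ((\<integral>\<^sup>+x. ennreal (F x) \<partial>LB I) * (inverse (half_gauss\<^sup>2) * (\<integral>\<^sup>+y. G y \<partial>LB I)))
       = (inverse (half_gauss\<^sup>2) * half_gauss\<^sup>2) * ((\<integral>\<^sup>+x. ennreal (F x) \<partial>LB I) * (\<integral>\<^sup>+y. G y \<partial>LB I))"
      by (simp add: mult_ac)
    ultimately show ?thesis by (simp add: k)
  qed
  moreover have "(\<integral>\<^sup>+x. ennreal (F x) \<partial>LB I) = (\<integral>\<^sup>+p. ennreal (f p * indicator {0<..} (snd p)) \<partial>(LB I \<Otimes>\<^sub>M lborel))"
    using nn_integral_eq_integral[OF Fi] nn_integral_eq_integral[OF fint] F0 f0 FI by simp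
  moreover have "(\<integral>\<^sup>+y. G y \<partial>LB I) = (\<integral>\<^sup>+(y, t). g (y, t) * indicator {0<..} t \<partial>(LB I \<Otimes>\<^sub>M lborel))"
    unfolding G_def by (subst lborel.nn_integral_fst[symmetric]) (auto simp: split_beta')
  ultimately show ?thesis by simp
qed

lemma santalo_shifted_empty: "santalo_shifted {}"
  unfolding santalo_shifted_def by (auto simp: PiM_empty nn_integral_count_space_finite space_PiM)

text \<open>\<open>h\<close> may be negative: the right-hand side integrates its positive part. If
  \<open>h\<close> is not integrable, the Bochner integral is 0.\<close>

lemma ennreal_integral_le_nn_integral: "ennreal (\<integral>x. h x \<partial>M) \<le> (\<integral>\<^sup>+x. ennreal (h x) \<partial>M)"
proof (cases "integrable M h")
  case True
  have "ennreal (\<integral>x. h x \<partial>M) \<le> ennreal (\<integral>x. max 0 (h x) \<partial>M)"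
    using True by (intro ennreal_leI integral_mono) auto
  also have "\<dots> = (\<integral>\<^sup>+x. ennreal (max 0 (h x)) \<partial>M)"
    using True by (intro nn_integral_eq_integral[symmetric]) auto
  also have "\<dots> = (\<integral>\<^sup>+x. ennreal (h x) \<partial>M)" 
    by (intro nn_integral_cong) (auto simp: max_def ennreal_neg)
  finally show ?thesis .
qed (simp add: not_integrable_integral_eq)

definition cube :: "'i set \<Rightarrow> nat \<Rightarrow> ('i \<Rightarrow> real) set" where
  "cube I k = Pi\<^sub>E I (\<lambda>_. {- real k..real k})"

lemma
  assumes I: "finite I"
  shows cube_sets [measurable]: "cube I k \<in> sets (LB I)" and cube_incseq: "incseq (cube I)"
    and cube_exhaust: "space (LB I) \<subseteq> (\<Union>k. cube I k)"
    and cube_finite: "emeasure (LB I) (cube I k) < \<infinity>"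
proof -
  interpret product_sigma_finite "\<lambda>_::'a. lborel :: real measure" by standard
  show "cube I k \<in> sets (LB I)" unfolding cube_def by (intro sets_PiM_I_finite I) auto
  show "emeasure (LB I) (cube I k) < \<infinity>"
    unfolding cube_def by (subst emeasure_PiM) (auto simp: I ennreal_power)
  show "incseq (cube I)" unfolding cube_def by (intro incseq_SucI PiE_mono) auto
  show "space (LB I) \<subseteq> (\<Union>k. cube I k)"
  proof
    fix x assume x: "x \<in> space (LB I)"
    obtain m :: nat where m: "(\<Sum>j\<in>I. \<bar>x j\<bar>) \<le> real m" using real_arch_simple by blast
    have "x j \<in> {- real m..real m}" if "j \<in> I" for j
      using m member_le_sum[of j I "\<lambda>j. \<bar>x j\<bar>"] that I by (simp add: abs_le_iff)
    hence "x \<in> cube I m" using x by (auto simp: cube_def space_PiM PiE_def)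
    thus "x \<in> (\<Union>k. cube I k)" by blast
  qed
qed

lemma
  assumes I: "finite I" and G: "G \<in> borel_measurable (LB I)"
  shows trunc_integrable: "integrable (LB I) (trunc (cube I) G k)"
    and trunc_moment: "j \<in> I \<Longrightarrow> integrable (LB I) (\<lambda>x. trunc (cube I) G k x * x j)"
proof -
  note [measurable] = trunc_measurable[OF G cube_sets[OF I]]
  have ik: "integrable (LB I) (\<lambda>x. c * indicator (cube I k) x)" for c :: real and k
    using cube_finite[OF I, of k] cube_sets[OF I, of k] by (intro integrable_mult_right integrable_real_indicator) auto
  show "integrable (LB I) (trunc (cube I) G k)"
    using trunc_bounds[of "cube I" G k] by (intro Bochner_Integration.integrable_bound[OF ik[of "real k" k]] AE_I2) auto
  show "integrable (LB I) (\<lambda>x. trunc (cube I) G k x * x j)" if j: "j \<in> I"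
  proof (rule Bochner_Integration.integrable_bound[OF ik[of "real k * real k" k]])
    show "AE x in LB I. norm (trunc (cube I) G k x * x j) \<le> norm (real k * real k * indicator (cube I k) x)"
    proof (rule AE_I2)
      fix x
      show "norm (trunc (cube I) G k x * x j) \<le> norm (real k * real k * indicator (cube I k) x)"
      proof (cases "x \<in> cube I k")
        case True
        hence "\<bar>x j\<bar> \<le> real k" using j by (auto simp: cube_def PiE_def Pi_def abs_le_iff)
        thus ?thesis using trunc_bounds[of "cube I" G k x] True by (auto simp: abs_mult intro!: mult_mono)
      qed (use trunc_bounds[of "cube I" G k x] in auto)
    qed
  qed (use j in measurable)
qed

text \<open>A shift by \<open>z\<close> of \<open>G\<close> amounts to the factor \<open>exp \<langle>x, z\<rangle> \<ge> 1 + \<langle>x, z\<rangle>\<close> on \<open>F\<close>, and the linear term has integral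
  zero against the centered function \<open>F\<close>.\<close>

lemma santalo_shifted_imp_centered:
  assumes P: "santalo_shifted I" and I: "finite I"
  shows "santalo_centered I"
  unfolding santalo_centered_def
proof (intro allI impI)
  fix F :: "('a \<Rightarrow> real) \<Rightarrow> real" and G :: "('a \<Rightarrow> real) \<Rightarrow> ennreal"
  assume [measurable]: "F \<in> borel_measurable (LB I)" and F0: "\<forall>x. 0 \<le> F x" and Fi: "integrable (LB I) F"
    and Fj: "\<forall>j\<in>I. integrable (LB I) (\<lambda>x. F x * x j) \<and> (\<integral>x. F x * x j \<partial>LB I) = 0"
    and Gm [measurable]: "G \<in> borel_measurable (LB I)"
    and FG: "\<forall>x\<in>space (LB I). \<forall>y\<in>space (LB I). ennreal (F x) * G y \<le> ennreal (exp (- (\<Sum>j\<in>I. x j * y j)))"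
  let ?R = "(4 * half_gauss\<^sup>2) ^ card I"
  \<comment> \<open>The roles are exchanged: \<open>santalo_shifted\<close> is applied to a
    truncation of \<open>G\<close>, which has the finite mass and first moments that
    \<open>G\<close> itself may lack.\<close>
  have "(\<integral>\<^sup>+x. ennreal (F x) \<partial>LB I) * (\<integral>\<^sup>+x. ennreal (trunc (cube I) G k x) \<partial>LB I) \<le> ?R" for k
  proof -
    obtain z where z: "\<And>g. g \<in> borel_measurable (LB I) \<Longrightarrow>
        (\<And>x y. x\<in>space (LB I) \<Longrightarrow> y\<in>space (LB I) \<Longrightarrow> ennreal (trunc (cube I) G k (\<lambda>j\<in>I. z j + x j)) * g y \<le> ennreal (exp (- (\<Sum>j\<in>I. x j * y j)))) \<Longrightarrow>
        (\<integral>\<^sup>+x. ennreal (trunc (cube I) G k x) \<partial>LB I) * (\<integral>\<^sup>+x. g x \<partial>LB I) \<le> ?R"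
      using P[unfolded santalo_shifted_def, rule_format, of "trunc (cube I) G k"]
        trunc_measurable[OF Gm cube_sets[OF I]] trunc_integrable[OF I Gm] trunc_moment[OF I Gm] trunc_bounds(1)[of "cube I" G k]
      by blast
    define g where "g x = ennreal (F x * exp (\<Sum>j\<in>I. x j * z j))" for x
    have "(\<integral>\<^sup>+x. ennreal (trunc (cube I) G k x) \<partial>LB I) * (\<integral>\<^sup>+x. g x \<partial>LB I) \<le> ?R"
    proof (rule z)
      show "g \<in> borel_measurable (LB I)" unfolding g_def[abs_def] by measurable
      fix x y assume x: "x \<in> space (LB I)" and y: "y \<in> space (LB I)"
      have zx: "(\<lambda>j\<in>I. z j + x j) \<in> space (LB I)" by (auto simp: space_PiM)
      have "ennreal (trunc (cube I) G k (\<lambda>j\<in>I. z j + x j)) \<le> G (\<lambda>j\<in>I. z j + x j)"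
        by (simp add: ennreal_trunc indicator_def)
      hence "ennreal (trunc (cube I) G k (\<lambda>j\<in>I. z j + x j)) * g y \<le> G (\<lambda>j\<in>I. z j + x j) * g y"
        by (rule mult_right_mono) simp
      also have "\<dots> = (ennreal (F y) * G (\<lambda>j\<in>I. z j + x j)) * ennreal (exp (\<Sum>j\<in>I. y j * z j))"
        using F0 by (simp add: g_def ennreal_mult mult_ac)
      also have "\<dots> \<le> ennreal (exp (- (\<Sum>j\<in>I. y j * (\<lambda>j\<in>I. z j + x j) j))) * ennreal (exp (\<Sum>j\<in>I. y j * z j))"
        by (intro mult_right_mono FG[rule_format, OF y zx]) simp
      also have "\<dots> = ennreal (exp (- (\<Sum>j\<in>I. x j * y j)))"
        by (simp add: ennreal_mult[symmetric] algebra_simps sum.distrib flip: exp_add)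
      finally show "ennreal (trunc (cube I) G k (\<lambda>j\<in>I. z j + x j)) * g y \<le> ennreal (exp (- (\<Sum>j\<in>I. x j * y j)))" .
    qed
    moreover have "(\<integral>\<^sup>+x. ennreal (F x) \<partial>LB I) \<le> (\<integral>\<^sup>+x. g x \<partial>LB I)"
    proof -
      have "(\<integral>x. F x + (\<Sum>j\<in>I. (F x * x j) * z j) \<partial>LB I) = (\<integral>x. F x \<partial>LB I) + (\<Sum>j\<in>I. (\<integral>x. F x * x j \<partial>LB I) * z j)"
        using Fj by (subst Bochner_Integration.integral_add[OF Fi]) (auto intro!: Bochner_Integration.integrable_sum simp: Bochner_Integration.integral_sum)
      hence "(\<integral>x. F x \<partial>LB I) = (\<integral>x. F x + (\<Sum>j\<in>I. (F x * x j) * z j) \<partial>LB I)" using Fj by simp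
      hence "(\<integral>\<^sup>+x. ennreal (F x) \<partial>LB I) = ennreal (\<integral>x. F x + (\<Sum>j\<in>I. (F x * x j) * z j) \<partial>LB I)"
        using nn_integral_eq_integral[OF Fi] F0 by simp
      also have "\<dots> \<le> (\<integral>\<^sup>+x. ennreal (F x + (\<Sum>j\<in>I. (F x * x j) * z j)) \<partial>LB I)"
        by (rule ennreal_integral_le_nn_integral)
      also have "\<dots> \<le> (\<integral>\<^sup>+x. g x \<partial>LB I)"
        unfolding g_def
      proof (intro nn_integral_mono ennreal_leI)
        fix x
        have "F x + (\<Sum>j\<in>I. (F x * x j) * z j) = F x * (1 + (\<Sum>j\<in>I. x j * z j))"
          by (simp add: distrib_left sum_distrib_left mult_ac)
        also have "\<dots> \<le> F x * exp (\<Sum>j\<in>I. x j * z j)" using F0 by (intro mult_left_mono) (auto simp: exp_ge_add_one_self)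
        finally show "F x + (\<Sum>j\<in>I. (F x * x j) * z j) \<le> F x * exp (\<Sum>j\<in>I. x j * z j)" .
      qed
      finally show ?thesis .
    qed
    ultimately show ?thesis by (subst mult.commute) (meson mult_left_mono order_trans zero_le)
  qed
  thus "(\<integral>\<^sup>+x. ennreal (F x) \<partial>LB I) * (\<integral>\<^sup>+x. G x \<partial>LB I) \<le> ?R"
    by (subst nn_integral_trunc(1)[OF Gm cube_sets[OF I] cube_incseq[OF I] cube_exhaust[OF I], symmetric], subst SUP_mult_left_ennreal) (rule SUP_least)
qed

section \<open>Median hyperplanes and the induction step\<close>

lemma AE_LB_coordinate_neq:
  assumes I: "finite I" "i \<in> I"
  shows "AE x in LB I. x i \<noteq> t"
proof -
  interpret product_sigma_finite "\<lambda>_::'a. lborel :: real measure" by standard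
  have "emeasure (LB I) (Pi\<^sub>E I (\<lambda>j. if j = i then {t} else UNIV)) = (\<Prod>j\<in>I. emeasure lborel (if j = i then {t} else (UNIV :: real set)))"
    by (intro emeasure_PiM I) auto
  also have "\<dots> = 0" using I by (auto intro!: bexI[of _ i])
  finally have "Pi\<^sub>E I (\<lambda>j. if j = i then {t} else UNIV) \<in> null_sets (LB I)"
    using I by (intro null_setsI sets_PiM_I_finite) auto
  thus ?thesis
    by (rule AE_I') (auto simp: space_PiM PiE_def Pi_def)
qed

text \<open>The mass of \<open>{x. x i < t}\<close> depends continuously on \<open>t\<close> because
  hyperplanes are null sets, and it tends to 0 and to the full mass; the intermediate value theorem
  gives \<open>t\<close>.\<close>

lemma median_exists:
  fixes f :: "('i \<Rightarrow> real) \<Rightarrow> real"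
  assumes I: "finite I" "i \<in> I" and f: "integrable (LB I) f" and f0: "\<And>x. 0 \<le> f x"
    and pos: "0 < (\<integral>x. f x \<partial>LB I)"
  obtains t where "(\<integral>x. f x * indicator {x. x i > t} x \<partial>LB I) = (\<integral>x. f x \<partial>LB I) / 2"
    and "(\<integral>x. f x * indicator {x. x i < t} x \<partial>LB I) = (\<integral>x. f x \<partial>LB I) / 2"
proof -
  let ?m = "\<integral>x. f x \<partial>LB I"
  define A where "A t = (\<integral>x. f x * indicator {x. x i < t} x \<partial>LB I)" for t
  have [measurable]: "f \<in> borel_measurable (LB I)" using f by auto
  have [measurable]: "(\<lambda>x. x i) \<in> borel_measurable (LB I)" using I by measurable
  have int: "integrable (LB I) (\<lambda>x. f x * indicator {x. x i < t} x)" "integrable (LB I) (\<lambda>x. f x * indicator {x. x i > t} x)" for t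
    by (rule Bochner_Integration.integrable_bound[OF f]; auto simp: indicator_def)+
  have lim: "(\<lambda>n. A (tt n)) \<longlonglongrightarrow> (\<integral>x. f x * h x \<partial>LB I)"
    if "AE x in LB I. (\<lambda>n. f x * indicator {x. x i < tt n} x) \<longlonglongrightarrow> f x * h x" "h \<in> borel_measurable (LB I)" for tt :: "nat \<Rightarrow> real" and h
    unfolding A_def using that
    by (intro integral_dominated_convergence[where w=f] f) (auto simp: indicator_def f0)
  have "isCont A t" for t
    unfolding continuous_at_sequentially comp_def
  proof (intro allI impI)
    fix tt :: "nat \<Rightarrow> real" assume tt: "tt \<longlonglongrightarrow> t"
    show "(\<lambda>n. A (tt n)) \<longlonglongrightarrow> A t"
      unfolding A_def[of t]
    proof (rule lim)
      show "AE x in LB I. (\<lambda>n. f x * indicator {x. x i < tt n} x) \<longlonglongrightarrow> f x * indicator {x. x i < t} x"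
        using AE_LB_coordinate_neq[OF I, of t]
      proof eventually_elim
        fix x assume "x i \<noteq> t"
        have "eventually (\<lambda>n. (x i < tt n) = (x i < t)) sequentially"
        proof (cases "x i < t")
          case True thus ?thesis using order_tendstoD(1)[OF tt True] by (auto elim: eventually_mono)
        next
          case False
          hence tx: "t < x i" using \<open>x i \<noteq> t\<close> by simp
          thus ?thesis using order_tendstoD(2)[OF tt tx] by (auto elim: eventually_mono)
        qed
        hence "eventually (\<lambda>n. f x * indicator {x. x i < tt n} x = f x * indicator {x. x i < t} x) sequentially"
          by eventually_elim (auto simp: indicator_def)
        thus "(\<lambda>n. f x * indicator {x. x i < tt n} x) \<longlonglongrightarrow> f x * indicator {x. x i < t} x"
          by (rule tendsto_eventually)
      qed
    qed measurable
  qed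
  moreover have "(\<lambda>n. A (real n)) \<longlonglongrightarrow> (\<integral>x. f x * 1 \<partial>LB I)"
  proof (rule lim)
    show "AE x in LB I. (\<lambda>n. f x * indicator {x. x i < real n} x) \<longlonglongrightarrow> f x * 1"
    proof (rule AE_I2)
      fix x
      have "eventually (\<lambda>n. x i < real n) sequentially"
        using filterlim_real_sequentially filterlim_at_top_dense by blast
      hence "eventually (\<lambda>n. f x * indicator {x. x i < real n} x = f x * 1) sequentially"
        by eventually_elim auto
      thus "(\<lambda>n. f x * indicator {x. x i < real n} x) \<longlonglongrightarrow> f x * 1" by (rule tendsto_eventually)
    qed
  qed simp
  then obtain b :: nat where b: "?m / 2 < A (real b)"
    using order_tendstoD(1)[of "\<lambda>n. A (real n)" ?m sequentially "?m / 2"] pos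
    by (auto simp: eventually_sequentially)
  moreover have "(\<lambda>n. A (- real n)) \<longlonglongrightarrow> (\<integral>x. f x * 0 \<partial>LB I)"
  proof (rule lim)
    show "AE x in LB I. (\<lambda>n. f x * indicator {x. x i < - real n} x) \<longlonglongrightarrow> f x * 0"
    proof (rule AE_I2)
      fix x
      have "eventually (\<lambda>n. - x i < real n) sequentially"
        using filterlim_real_sequentially filterlim_at_top_dense by blast
      hence "eventually (\<lambda>n. f x * indicator {x. x i < - real n} x = f x * 0) sequentially"
        by eventually_elim auto
      thus "(\<lambda>n. f x * indicator {x. x i < - real n} x) \<longlonglongrightarrow> f x * 0" by (rule tendsto_eventually)
    qed
  qed simp
  then obtain a :: nat where a: "A (- real a) < ?m / 2"
    using order_tendstoD(2)[of "\<lambda>n. A (- real n)" 0 sequentially "?m / 2"] pos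
    by (auto simp: eventually_sequentially)
  ultimately obtain t where t: "A t = ?m / 2"
    using IVT[of A "- real a" "?m / 2" "real b"] by auto
  have "?m = (\<integral>x. f x * indicator {x. x i < t} x + f x * indicator {x. x i > t} x \<partial>LB I)"
  proof (rule integral_cong_AE)
    show "AE x in LB I. f x = f x * indicator {x. x i < t} x + f x * indicator {x. x i > t} x"
      using AE_LB_coordinate_neq[OF I, of t] by eventually_elim (auto simp: indicator_def)
  qed measurable
  also have "\<dots> = A t + (\<integral>x. f x * indicator {x. x i > t} x \<partial>LB I)"
    unfolding A_def by (intro Bochner_Integration.integral_add int)
  finally have "(\<integral>x. f x * indicator {x. x i > t} x \<partial>LB I) = ?m / 2" using t by simp
  with t that show ?thesis by (auto simp: A_def)
qed

text \<open>The direction \<open>v\<close> of the line through the barycentres of the two halves makes both projections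
  centered at the point \<open>z\<close> where this line meets the median hyperplane.\<close>

lemma santalo_shifted_insert:
  fixes I :: "'i set"
  assumes Q: "santalo_centered I" and I: "finite I" "i \<notin> I"
  shows "santalo_shifted (insert i I)"
  unfolding santalo_shifted_def
proof (intro allI impI)
  fix f :: "('i \<Rightarrow> real) \<Rightarrow> real"
  let ?J = "insert i I" let ?L = "LB (insert i I)" let ?M = "LB I \<Otimes>\<^sub>M (lborel :: real measure)"
  let ?R = "(4 * half_gauss\<^sup>2) ^ card ?J"
  assume fm [measurable]: "f \<in> borel_measurable ?L" and f0: "\<forall>x. 0 \<le> f x" and fi: "integrable ?L f"
    and fj: "\<forall>j\<in>?J. integrable ?L (\<lambda>x. f x * x j)"
  define m where "m = (\<integral>x. f x \<partial>?L)"
  have m0: "0 \<le> m" unfolding m_def using f0 by (intro integral_nonneg_AE AE_I2) auto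
  have fm': "(\<integral>\<^sup>+x. ennreal (f x) \<partial>?L) = ennreal m"
    unfolding m_def using f0 by (intro nn_integral_eq_integral fi) auto
  show "\<exists>z. \<forall>g. g \<in> borel_measurable ?L \<longrightarrow>
        (\<forall>x\<in>space ?L. \<forall>y\<in>space ?L. ennreal (f (\<lambda>j\<in>?J. z j + x j)) * g y \<le> ennreal (exp (- (\<Sum>j\<in>?J. x j * y j)))) \<longrightarrow>
        (\<integral>\<^sup>+x. ennreal (f x) \<partial>?L) * (\<integral>\<^sup>+x. g x \<partial>?L) \<le> ?R"
  proof (cases "m = 0")
    case True
    thus ?thesis unfolding fm' by simp
  next
    case False
    hence m: "0 < m" using m0 by simp
    obtain t where t: "(\<integral>x. f x * indicator {x. x i > t} x \<partial>?L) = m / 2"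
       "(\<integral>x. f x * indicator {x. x i < t} x \<partial>?L) = m / 2"
      using median_exists[OF _ _ fi, of i] I f0 m unfolding m_def by blast
    define side where "side \<sigma> = {x :: 'i \<Rightarrow> real. \<sigma> * (x i - t) > 0}" for \<sigma> :: real
    \<comment> \<open>Unnormalised barycentres: each side has mass \<open>m / 2\<close>, so the
      actual barycentre is \<open>2 / m\<close> times \<open>B \<sigma>\<close>.\<close>
    define B where "B \<sigma> j = (\<integral>x. f x * indicator (side \<sigma>) x * x j \<partial>?L)" for \<sigma> j
    have [measurable]: "(\<lambda>x. x j) \<in> borel_measurable ?L" if "j \<in> ?J" for j using that by measurable
    have xi [measurable]: "(\<lambda>x. x i) \<in> borel_measurable ?L" by measurable
    have side [measurable]: "indicator (side \<sigma>) \<in> borel_measurable ?L" for \<sigma> :: real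
      unfolding side_def indicator_def by measurable
    have mass: "(\<integral>x. f x * indicator (side \<sigma>) x \<partial>?L) = m / 2" if "\<sigma> = 1 \<or> \<sigma> = -1" for \<sigma>
    proof -
      have "side 1 = {x. x i > t}" "side (-1) = {x. x i < t}" by (auto simp: side_def)
      thus ?thesis using t that by auto
    qed
    have int_side: "integrable ?L (\<lambda>x. f x * indicator (side \<sigma>) x)" for \<sigma> :: real
    proof (rule Bochner_Integration.integrable_bound[OF fi])
      show "(\<lambda>x. f x * indicator (side \<sigma>) x) \<in> borel_measurable ?L" by measurable
    qed (auto simp: indicator_def)
    have int_side_j: "integrable ?L (\<lambda>x. f x * indicator (side \<sigma>) x * x j)" if j: "j \<in> ?J" for \<sigma> :: real and j
    proof (rule Bochner_Integration.integrable_bound[OF fj[rule_format, OF j]])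
      show "(\<lambda>x. f x * indicator (side \<sigma>) x * x j) \<in> borel_measurable ?L" using j by measurable
    qed (auto simp: indicator_def)
    \<comment> \<open>Each barycentre lies strictly on its own side; this makes the line through
      them transversal to the hyperplane, hence \<open>d > 0\<close>.\<close>
    have strict: "\<sigma> * (B \<sigma> i - t * m / 2) > 0" if s: "\<sigma> = 1 \<or> \<sigma> = -1" for \<sigma>
    proof -
      define k where "k x = f x * indicator (side \<sigma>) x * (\<sigma> * (x i - t))" for x
      have ki: "integrable ?L k"
      proof -
        have "integrable ?L (\<lambda>x. \<sigma> * (f x * indicator (side \<sigma>) x * x i - t * (f x * indicator (side \<sigma>) x)))"
          using int_side[of \<sigma>] int_side_j[of i \<sigma>] by (intro integrable_mult_right Bochner_Integration.integrable_diff) auto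
        thus ?thesis unfolding k_def by (simp add: algebra_simps)
      qed
      have kI: "(\<integral>x. k x \<partial>?L) = \<sigma> * (B \<sigma> i - t * m / 2)"
      proof -
        have "(\<integral>x. k x \<partial>?L) = (\<integral>x. \<sigma> * (f x * indicator (side \<sigma>) x * x i - t * (f x * indicator (side \<sigma>) x)) \<partial>?L)"
          by (intro Bochner_Integration.integral_cong) (auto simp: k_def algebra_simps)
        also have "\<dots> = \<sigma> * (B \<sigma> i - t * (\<integral>x. f x * indicator (side \<sigma>) x \<partial>?L))"
          using int_side[of \<sigma>] int_side_j[of i \<sigma>] unfolding B_def by (simp add: Bochner_Integration.integral_diff)
        finally show ?thesis using mass[OF s] by simp
      qed
      have k0: "0 \<le> k x" for x unfolding k_def using f0 by (auto simp: indicator_def side_def)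
      have "(\<integral>x. k x \<partial>?L) \<noteq> 0"
      proof
        assume "(\<integral>x. k x \<partial>?L) = 0"
        hence "AE x in ?L. k x = 0" using integral_nonneg_eq_0_iff_AE[OF ki] k0 by simp
        hence "AE x in ?L. f x * indicator (side \<sigma>) x = 0"
          by eventually_elim (auto simp: k_def indicator_def side_def)
        hence "(\<integral>x. f x * indicator (side \<sigma>) x \<partial>?L) = 0" by (rule integral_eq_zero_AE)
        thus False using mass[OF s] m by simp
      qed
      moreover have "0 \<le> (\<integral>x. k x \<partial>?L)" using k0 by (intro integral_nonneg_AE AE_I2)
      ultimately show ?thesis unfolding kI[symmetric] by (simp only: less_le) auto
    qed
    define d where "d = B 1 i - B (-1) i"
    have d: "0 < d" using strict[of 1] strict[of "-1"] unfolding d_def by simp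
    \<comment> \<open>\<open>v\<close> is the slope of that line over the coordinate
      \<open>i\<close>, and \<open>z\<close> is its point at height \<open>t\<close>, found by going
      back along the line from the barycentre of the upper side.\<close>
    define v where "v j = (B 1 j - B (-1) j) / d" for j
    define z where "z j = (if j = i then t else (2 / m) * (B 1 j - (B 1 i - t * m / 2) * v j))" for j
    have zi: "z i = t" by (simp add: z_def)
    \<comment> \<open>The first moments of the projected halves: they vanish for
      \<open>\<sigma> = 1\<close> by the choice of \<open>z\<close>, and then for
      \<open>\<sigma> = -1\<close> because \<open>v\<close> joins the two barycentres.\<close>
    have bary: "B \<sigma> j - z j * (m / 2) - (B \<sigma> i - t * (m / 2)) * v j = 0"
      if s: "\<sigma> = 1 \<or> \<sigma> = -1" and j: "j \<in> I" for \<sigma> j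
    proof -
      have ji: "j \<noteq> i" using j I by auto
      have 1: "z j * (m / 2) = B 1 j - (B 1 i - t * m / 2) * v j" using m ji by (simp add: z_def)
      have 2: "d * v j = B 1 j - B (-1) j" using d by (simp add: v_def)
      show ?thesis using s
      proof
        assume "\<sigma> = 1" thus ?thesis unfolding 1 by (simp add: algebra_simps)
      next
        assume "\<sigma> = -1" thus ?thesis using 2 unfolding 1 d_def by (simp add: algebra_simps)
      qed
    qed
    define T where "T = shear I i z v"
    have Tm [measurable]: "T \<sigma> \<in> measurable ?M ?L" for \<sigma> unfolding T_def by measurable
    have dT: "distr ?M ?L (T \<sigma>) = ?L" if "\<sigma> = 1 \<or> \<sigma> = -1" for \<sigma>
      unfolding T_def using that by (intro distr_shear I) auto
    have Ti: "T \<sigma> p i = t + \<sigma> * snd p" for \<sigma> p by (cases p) (simp add: T_def shear_def zi)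
    have Tj: "T \<sigma> p j = z j + \<sigma> * snd p * v j + fst p j" if "j \<in> I" for \<sigma> p j
      using that I by (cases p) (auto simp: T_def shear_def)
    have Tside: "indicator (side \<sigma>) (T \<sigma> p) = (indicator {0<..} (snd p) :: real)" if "\<sigma> = 1 \<or> \<sigma> = -1" for \<sigma> p
      using that by (auto simp: side_def indicator_def Ti)
    have trI: "integrable ?M (\<lambda>p. h (T \<sigma> p)) \<and> (\<integral>p. h (T \<sigma> p) \<partial>?M) = (\<integral>x. h x \<partial>?L)"
      if "integrable ?L h" and s: "\<sigma> = 1 \<or> \<sigma> = -1" for h :: "('i \<Rightarrow> real) \<Rightarrow> real" and \<sigma>
    proof -
      have [measurable]: "h \<in> borel_measurable ?L" using that by auto
      have "integrable (distr ?M ?L (T \<sigma>)) h" using that by (simp add: dT)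
      hence "integrable ?M (\<lambda>p. h (T \<sigma> p))" by (subst (asm) integrable_distr_eq) auto
      moreover have "(\<integral>x. h x \<partial>distr ?M ?L (T \<sigma>)) = (\<integral>p. h (T \<sigma> p) \<partial>?M)" by (rule integral_distr) auto
      ultimately show ?thesis using dT[OF s] by simp
    qed
    show ?thesis
    proof (intro exI[of _ z] allI impI)
      fix g :: "('i \<Rightarrow> real) \<Rightarrow> ennreal"
      assume gm [measurable]: "g \<in> borel_measurable ?L"
        and fg: "\<forall>x\<in>space ?L. \<forall>y\<in>space ?L. ennreal (f (\<lambda>j\<in>?J. z j + x j)) * g y \<le> ennreal (exp (- (\<Sum>j\<in>?J. x j * y j)))"
      define c where "c y = (\<Sum>j\<in>I. v j * y j)" for y :: "'i \<Rightarrow> real"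
      have cm [measurable]: "c \<in> borel_measurable (LB I)" 
      proof -
        have "(\<lambda>y. y j) \<in> borel_measurable (LB I)" if "j \<in> I" for j
          using measurable_component_singleton[OF that, of "\<lambda>_. lborel :: real measure"] by simp
        thus ?thesis unfolding c_def[abs_def]
          by (intro borel_measurable_sum borel_measurable_times borel_measurable_const)
      qed
      define gg where "gg \<sigma> p = g ((fst p)(i := \<sigma> * snd p - c (fst p)))" for \<sigma> p
      have half: "ennreal (m / 2) * (\<integral>\<^sup>+(y, s). gg \<sigma> (y, s) * indicator {0<..} s \<partial>?M) \<le> half_gauss\<^sup>2 * (4 * half_gauss\<^sup>2) ^ card I"
        if s: "\<sigma> = 1 \<or> \<sigma> = -1" for \<sigma>
      proof -
        have upd: "(\<lambda>p. (fst p)(i := \<sigma> * snd p - c (fst p))) \<in> measurable ?M ?L"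
          by (rule measurable_fun_upd[where J=I]) auto
        have e1: "(\<lambda>p. f (T \<sigma> p) * indicator {0<..} (snd p)) = (\<lambda>p. f (T \<sigma> p) * indicator (side \<sigma>) (T \<sigma> p))"
          by (simp add: Tside[OF s])
        note tr1 = trI[OF int_side[of \<sigma>] s, folded e1]
        have "(\<integral>\<^sup>+p. ennreal (f (T \<sigma> p) * indicator {0<..} (snd p)) \<partial>?M)
           * (\<integral>\<^sup>+(y, s). gg \<sigma> (y, s) * indicator {0<..} s \<partial>?M) \<le> half_gauss\<^sup>2 * (4 * half_gauss\<^sup>2) ^ card I"
        proof (rule santalo_half_space[OF Q I(1)])
          show "0 \<le> f (T \<sigma> p)" for p using f0 by simp
          show "integrable ?M (\<lambda>p. f (T \<sigma> p) * indicator {0<..} (snd p))" using tr1 by simp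
          show "gg \<sigma> \<in> borel_measurable ?M" unfolding gg_def[abs_def] using measurable_compose[OF upd gm] .
          show "(\<lambda>p. f (T \<sigma> p)) \<in> borel_measurable ?M" by measurable
        next
          fix j assume j: "j \<in> I"
          \<comment> \<open>The coordinate \<open>j\<close> of the oblique projection,
            \<open>x j - z j - v j * (x i - t)\<close>, weighted by \<open>f\<close> on one
            side.\<close>
          let ?h = "\<lambda>x. f x * indicator (side \<sigma>) x * x j - z j * (f x * indicator (side \<sigma>) x)
             - v j * (f x * indicator (side \<sigma>) x * x i - t * (f x * indicator (side \<sigma>) x))"
          have hi: "integrable ?L ?h"
            using int_side[of \<sigma>] int_side_j[of j \<sigma>] int_side_j[of i \<sigma>] j
            by (intro Bochner_Integration.integrable_diff integrable_mult_right) auto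
          have hI: "(\<integral>x. ?h x \<partial>?L) = 0"
          proof -
            have "(\<integral>x. ?h x \<partial>?L) = B \<sigma> j - z j * (\<integral>x. f x * indicator (side \<sigma>) x \<partial>?L)
                - v j * (B \<sigma> i - t * (\<integral>x. f x * indicator (side \<sigma>) x \<partial>?L))"
              using int_side[of \<sigma>] int_side_j[of j \<sigma>] int_side_j[of i \<sigma>] j unfolding B_def
              by (simp add: Bochner_Integration.integral_diff)
            thus ?thesis using bary[OF s j] mass[OF s] by (simp add: algebra_simps)
          qed
          have e2: "(\<lambda>p. f (T \<sigma> p) * indicator {0<..} (snd p) * fst p j) = (\<lambda>p. ?h (T \<sigma> p))"
            unfolding Tside[OF s] Ti Tj[OF j] by (simp add: algebra_simps)
          show "integrable ?M (\<lambda>p. f (T \<sigma> p) * indicator {0<..} (snd p) * fst p j)"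
            "(\<integral>p. f (T \<sigma> p) * indicator {0<..} (snd p) * fst p j \<partial>?M) = 0"
            unfolding e2 using trI[OF hi s] hI by simp_all
        next
          fix x y :: "'i \<Rightarrow> real" and r u :: real
          assume x: "x \<in> space (LB I)" and y: "y \<in> space (LB I)" and "0 < r" "0 < u"
          define X where "X = (\<lambda>j\<in>I. \<sigma> * r * v j + x j)(i := \<sigma> * r)"
          define Y where "Y = y(i := \<sigma> * u - c y)"
          have XY: "X \<in> space ?L" "Y \<in> space ?L"
            using x y by (auto simp: X_def Y_def space_PiM PiE_def extensional_def)
          have "T \<sigma> (x, r) = (\<lambda>j\<in>?J. z j + X j)"
            using I by (auto simp: T_def shear_def X_def fun_eq_iff zi)
          hence "ennreal (f (T \<sigma> (x, r))) * gg \<sigma> (y, u) \<le> ennreal (exp (- (\<Sum>j\<in>?J. X j * Y j)))"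
            using fg[rule_format, OF XY] unfolding gg_def fst_conv snd_conv Y_def[symmetric] by (simp only:)
          also have "(\<Sum>j\<in>?J. X j * Y j) = \<sigma> * r * (\<sigma> * u - c y) + (\<Sum>j\<in>I. X j * Y j)"
            using I by (simp add: X_def Y_def)
          also have "(\<Sum>j\<in>I. X j * Y j) = (\<Sum>j\<in>I. \<sigma> * r * (v j * y j) + x j * y j)"
            using I by (intro sum.cong) (auto simp: X_def Y_def algebra_simps)
          also have "\<dots> = \<sigma> * r * c y + (\<Sum>j\<in>I. x j * y j)"
            by (simp add: sum.distrib c_def sum_distrib_left)
          also have "\<sigma> * r * (\<sigma> * u - c y) + (\<sigma> * r * c y + (\<Sum>j\<in>I. x j * y j)) = (\<Sum>j\<in>I. x j * y j) + r * u"
            using s by (auto simp: algebra_simps)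
          finally show "ennreal (f (T \<sigma> (x, r))) * gg \<sigma> (y, u) \<le> ennreal (exp (- ((\<Sum>j\<in>I. x j * y j) + r * u)))" .
        qed
        moreover have "(\<integral>\<^sup>+p. ennreal (f (T \<sigma> p) * indicator {0<..} (snd p)) \<partial>?M) = ennreal (m / 2)"
          using tr1 mass[OF s] f0 by (subst nn_integral_eq_integral) auto
        ultimately show ?thesis by simp
      qed
      have sp: "(\<integral>\<^sup>+x. g x \<partial>?L) = (\<integral>\<^sup>+(y, s). gg 1 (y, s) * indicator {0<..} s \<partial>?M) + (\<integral>\<^sup>+(y, s). gg (-1) (y, s) * indicator {0<..} s \<partial>?M)"
        using nn_integral_LB_split[OF I gm cm] by (simp add: gg_def)
      \<comment> \<open>Origin of the 4: the mass \<open>m\<close> is twice the mass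
        \<open>m / 2\<close> used in \<open>half\<close>, and the integral of \<open>g\<close> is a
        sum over two sides.\<close>
      have "(\<integral>\<^sup>+x. ennreal (f x) \<partial>?L) * (\<integral>\<^sup>+x. g x \<partial>?L) = 2 * (ennreal (m / 2) * (\<integral>\<^sup>+x. g x \<partial>?L))"
      proof -
        have "ennreal m = 2 * ennreal (m / 2)" using m by (subst ennreal_numeral[symmetric], subst ennreal_mult[symmetric]) auto
        thus ?thesis unfolding fm' by (simp add: mult.assoc)
      qed
      also have "\<dots> \<le> 2 * (half_gauss\<^sup>2 * (4 * half_gauss\<^sup>2) ^ card I + half_gauss\<^sup>2 * (4 * half_gauss\<^sup>2) ^ card I)"
        unfolding sp distrib_left[of "ennreal (m / 2)"] by (intro mult_left_mono add_mono half) auto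
      also have "\<dots> = ?R"
        using I by (simp add: mult_ac flip: mult_2)
      finally show "(\<integral>\<^sup>+x. ennreal (f x) \<partial>?L) * (\<integral>\<^sup>+x. g x \<partial>?L) \<le> ?R" .
    qed
  qed
qed

text \<open>The induction passes through both forms: shifted on \<open>I\<close> gives centered on
  \<open>I\<close>, which gives shifted on \<open>insert i I\<close>.\<close>

theorem santalo_centered: "finite I \<Longrightarrow> santalo_centered I"
proof -
  have "finite I \<Longrightarrow> santalo_shifted I"
    by (induction rule: finite_induct)
       (auto intro: santalo_shifted_empty santalo_shifted_insert santalo_shifted_imp_centered)
  thus "finite I \<Longrightarrow> santalo_centered I" by (rule santalo_shifted_imp_centered)
qed

section \<open>The Blaschke--Santalo inequality\<close>

abbreviation basis_sum :: "('a::euclidean_space \<Rightarrow> real) \<Rightarrow> 'a" where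
  "basis_sum x \<equiv> \<Sum>b\<in>Basis. x b *\<^sub>R b"

lemma functional_santalo:
  fixes F :: "'a::euclidean_space \<Rightarrow> real" and G :: "'a \<Rightarrow> ennreal"
  assumes [measurable]: "F \<in> borel_measurable borel" "G \<in> borel_measurable borel"
    and F0: "\<And>x. 0 \<le> F x" and Fi: "integrable lborel F"
    and Fb: "\<And>b. b \<in> Basis \<Longrightarrow> integrable lborel (\<lambda>x. F x * (x \<bullet> b))"
    and F1: "\<And>b. b \<in> Basis \<Longrightarrow> (\<integral>x. F x * (x \<bullet> b) \<partial>lborel) = 0"
    and FG: "\<And>x y. ennreal (F x) * G y \<le> ennreal (exp (- (x \<bullet> y)))"
  shows "(\<integral>\<^sup>+x. ennreal (F x) \<partial>lborel) * (\<integral>\<^sup>+y. G y \<partial>lborel) \<le> (4 * half_gauss\<^sup>2) ^ DIM('a)"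
proof -
  let ?P = "LB (Basis :: 'a set)"
  have eq: "(lborel :: 'a measure) = distr ?P borel basis_sum" by (rule lborel_eq)
  have coord: "basis_sum x \<bullet> b = x b" if "b \<in> Basis" for x and b :: 'a
    using that by (simp add: inner_sum_left inner_Basis if_distrib sum.delta cong: if_cong)
  have ip: "basis_sum x \<bullet> basis_sum y = (\<Sum>b\<in>Basis. x b * y b)" for x y :: "'a \<Rightarrow> real"
    by (subst inner_sum_right) (simp add: coord mult.commute)
  have "(\<integral>\<^sup>+x. ennreal (F (basis_sum x)) \<partial>?P) * (\<integral>\<^sup>+y. G (basis_sum y) \<partial>?P) \<le> (4 * half_gauss\<^sup>2) ^ card (Basis :: 'a set)"
  proof (rule santalo_centered[OF finite_Basis, unfolded santalo_centered_def, rule_format])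
    show "integrable ?P (\<lambda>x. F (basis_sum x))"
      using Fi by (subst (asm) eq, subst (asm) integrable_distr_eq) auto
    fix b :: 'a assume b: "b \<in> Basis"
    have i: "integrable ?P (\<lambda>x. F (basis_sum x) * (basis_sum x \<bullet> b))"
      using Fb[OF b] by (subst (asm) eq, subst (asm) integrable_distr_eq) auto
    have "(\<integral>x. F (basis_sum x) * (basis_sum x \<bullet> b) \<partial>?P) = 0"
      using F1[OF b] by (subst (asm) eq, subst (asm) integral_distr) auto
    with i show "integrable ?P (\<lambda>x. F (basis_sum x) * x b) \<and> (\<integral>x. F (basis_sum x) * x b \<partial>?P) = 0"
      by (simp add: coord[OF b])
  next
    fix x y :: "'a \<Rightarrow> real"
    show "ennreal (F (basis_sum x)) * G (basis_sum y) \<le> ennreal (exp (- (\<Sum>b\<in>Basis. x b * y b)))"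
      using FG[of "basis_sum x" "basis_sum y"] by (simp only: ip)
  qed (use F0 in auto)
  moreover have "(\<integral>\<^sup>+x. ennreal (F x) \<partial>lborel) = (\<integral>\<^sup>+x. ennreal (F (basis_sum x)) \<partial>?P)"
    by (subst eq, subst nn_integral_distr) auto
  moreover have "(\<integral>\<^sup>+y. G y \<partial>lborel) = (\<integral>\<^sup>+y. G (basis_sum y) \<partial>?P)"
    by (subst eq, subst nn_integral_distr) auto
  ultimately show ?thesis by simp
qed

section \<open>Gaussian integrals of homogeneous functions\<close>

lemma nn_integral_lborel_scaleR:
  fixes f :: "'a::euclidean_space \<Rightarrow> ennreal"
  assumes [measurable]: "f \<in> borel_measurable borel" and s: "0 < s"
  shows "(\<integral>\<^sup>+y. f y \<partial>lborel) = ennreal (s ^ DIM('a)) * (\<integral>\<^sup>+z. f (s *\<^sub>R z) \<partial>lborel)"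
  using s by (subst lborel_affine[of s 0]) (simp_all add: nn_integral_density nn_integral_distr nn_integral_cmult)

definition gauss_moment :: "nat \<Rightarrow> ennreal" where
  "gauss_moment m = (\<integral>\<^sup>+s. ennreal (s ^ m * exp (- s\<^sup>2 / 2)) * indicator {0<..} s \<partial>lborel)"

lemma gauss_tail:
  fixes r :: real
  assumes r: "0 \<le> r"
  shows "ennreal (exp (- r\<^sup>2 / 2)) = (\<integral>\<^sup>+s. ennreal (s * exp (- s\<^sup>2 / 2)) * indicator {r..} s \<partial>lborel)"
proof -
  have "(\<integral>\<^sup>+s. ennreal (s * exp (- s\<^sup>2 / 2)) * indicator {r..} s \<partial>lborel) = ennreal (0 - (- exp (- r\<^sup>2 / 2)))"
  proof (rule nn_integral_FTC_atLeast[where F="\<lambda>s. - exp (- s\<^sup>2 / 2)"])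
    show "((\<lambda>s::real. - exp (- s\<^sup>2 / 2)) \<longlongrightarrow> 0) at_top" 
    proof -
      have "filterlim (\<lambda>s::real. s\<^sup>2) at_top at_top" by (rule filterlim_pow_at_top[OF _ filterlim_ident]) simp
      hence "filterlim (\<lambda>s::real. (1/2) * s\<^sup>2) at_top at_top" by (rule filterlim_tendsto_pos_mult_at_top[OF tendsto_const, rotated]) simp
      hence "filterlim (\<lambda>s::real. - ((1/2) * s\<^sup>2)) at_bot at_top" by (simp add: filterlim_uminus_at_bot)
      hence "((\<lambda>s::real. exp (- ((1/2) * s\<^sup>2))) \<longlongrightarrow> 0) at_top" by (rule filterlim_compose[OF exp_at_bot])
      from tendsto_minus[OF this] show ?thesis by simp
    qed
  qed (use r in \<open>auto intro!: derivative_eq_intros\<close>)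
  thus ?thesis by simp
qed

text \<open>The Gaussian of \<open>p x\<close> is the integral of
  \<open>s * exp (- s\<^sup>2 / 2)\<close> over \<open>s \<ge> p x\<close>. After exchanging the
  integrals and scaling by \<open>s\<close>, the volume element contributes
  \<open>s ^ DIM('a)\<close>, the function \<open>q\<close> contributes \<open>s ^ k\<close> and the
  density one more \<open>s\<close>, whence the index of the moment.\<close>

lemma nn_integral_gauss_homogeneous:
  fixes p :: "'a::euclidean_space \<Rightarrow> real" and q :: "'a \<Rightarrow> ennreal"
  assumes [measurable]: "p \<in> borel_measurable borel" "q \<in> borel_measurable borel"
    and p0: "\<And>x. 0 \<le> p x" and ph: "\<And>s x. 0 < s \<Longrightarrow> p (s *\<^sub>R x) = s * p x"
    and qh: "\<And>s x. 0 < s \<Longrightarrow> q (s *\<^sub>R x) = ennreal (s ^ k) * q x"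
  shows "(\<integral>\<^sup>+x. ennreal (exp (- (p x)\<^sup>2 / 2)) * q x \<partial>lborel)
     = gauss_moment (DIM('a) + k + 1) * (\<integral>\<^sup>+x. q x * indicator {x. p x \<le> 1} x \<partial>lborel)"
proof -
  let ?a = "\<lambda>x s. if p x \<le> s \<and> 0 < s then ennreal (s * exp (- s\<^sup>2 / 2)) * q x else 0"
  let ?I = "\<integral>\<^sup>+x. q x * indicator {x. p x \<le> 1} x \<partial>lborel"
  have "(\<integral>\<^sup>+x. ennreal (exp (- (p x)\<^sup>2 / 2)) * q x \<partial>lborel) =
      (\<integral>\<^sup>+x. (\<integral>\<^sup>+s. ?a x s \<partial>lborel) \<partial>lborel)"
  proof (rule nn_integral_cong)
    fix x :: 'a
    have "ennreal (exp (- (p x)\<^sup>2 / 2)) * q x = (\<integral>\<^sup>+s. ennreal (s * exp (- s\<^sup>2 / 2)) * indicator {p x..} s * q x \<partial>lborel)"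
      unfolding gauss_tail[OF p0] by (rule nn_integral_multc[symmetric]) measurable
    also have "\<dots> = (\<integral>\<^sup>+s. ?a x s \<partial>lborel)"
      using p0[of x] by (intro nn_integral_cong) (auto simp: indicator_def not_less)
    finally show "ennreal (exp (- (p x)\<^sup>2 / 2)) * q x = (\<integral>\<^sup>+s. ?a x s \<partial>lborel)" .
  qed
  also have "\<dots> = (\<integral>\<^sup>+s. (\<integral>\<^sup>+x. ?a x s \<partial>lborel) \<partial>lborel)"
    by (rule lborel_pair.Fubini') measurable
  also have "\<dots> = (\<integral>\<^sup>+s. ennreal (s ^ (DIM('a) + k + 1) * exp (- s\<^sup>2 / 2)) * indicator {0<..} s
       * ?I \<partial>lborel)"
  proof (rule nn_integral_cong)
    fix s :: real
    show "(\<integral>\<^sup>+x. ?a x s \<partial>lborel) =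
      ennreal (s ^ (DIM('a) + k + 1) * exp (- s\<^sup>2 / 2)) * indicator {0<..} s * ?I"
    proof (cases "0 < s")
      case s: True
      have "(\<integral>\<^sup>+x. ?a x s \<partial>lborel) =
        ennreal (s ^ DIM('a)) * (\<integral>\<^sup>+x. ?a (s *\<^sub>R x) s \<partial>lborel)"
        by (rule nn_integral_lborel_scaleR[OF _ s]) measurable
      also have "(\<integral>\<^sup>+x. ?a (s *\<^sub>R x) s \<partial>lborel)
         = (\<integral>\<^sup>+x. ennreal (s * exp (- s\<^sup>2 / 2)) * ennreal (s ^ k) * (q x * indicator {x. p x \<le> 1} x) \<partial>lborel)"
        using s by (intro nn_integral_cong) (auto simp: ph qh indicator_def mult_ac)
      also have "\<dots> = ennreal (s * exp (- s\<^sup>2 / 2)) * ennreal (s ^ k) * ?I"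
        by (rule nn_integral_cmult) measurable
      also have "ennreal (s ^ DIM('a)) * (ennreal (s * exp (- s\<^sup>2 / 2)) * ennreal (s ^ k) * ?I)
         = ennreal (s ^ (DIM('a) + k + 1) * exp (- s\<^sup>2 / 2)) * ?I"
        using s by (simp add: power_add ennreal_mult[symmetric] mult.assoc[symmetric]) (simp add: mult_ac)
      finally show ?thesis using s by simp
    qed simp
  qed
  also have "\<dots> = gauss_moment (DIM('a) + k + 1) * ?I"
    unfolding gauss_moment_def by (rule nn_integral_multc) measurable
  finally show ?thesis .
qed

lemma nn_integral_gauss_gauge:
  fixes p :: "'a::euclidean_space \<Rightarrow> real"
  assumes [measurable]: "p \<in> borel_measurable borel"
    and p0: "\<And>x. 0 \<le> p x" and ph: "\<And>s x. 0 < s \<Longrightarrow> p (s *\<^sub>R x) = s * p x"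
  shows "(\<integral>\<^sup>+x. ennreal (exp (- (p x)\<^sup>2 / 2)) \<partial>lborel) = gauss_moment (DIM('a) + 1) * emeasure lborel {x. p x \<le> 1}"
  using nn_integral_gauss_homogeneous[of p "\<lambda>_. 1" 0] p0 ph by simp

text \<open>One Gaussian integral computed twice, as a product and by homogeneity of the norm. This
  links the constant of the functional inequality to the volume of the ball.\<close>

lemma gauss_moment_ball:
  "gauss_moment (DIM('a) + 1) * emeasure lborel (cball (0::'a::euclidean_space) 1) = (2 * half_gauss) ^ DIM('a)"
proof -
  interpret product_sigma_finite "\<lambda>_::'a. lborel :: real measure" by standard
  have one: "(\<integral>\<^sup>+u. ennreal (exp (- u\<^sup>2 / 2)) \<partial>lborel) = 2 * half_gauss"
  proof -
    have "(\<integral>\<^sup>+u. ennreal (exp (- (u::real)\<^sup>2 / 2)) \<partial>lborel)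
      = (\<integral>\<^sup>+u. ennreal (exp (- (u::real)\<^sup>2 / 2)) * indicator {0<..} u + ennreal (exp (- u\<^sup>2 / 2)) * indicator {..<0} u \<partial>lborel)"
    proof (rule nn_integral_cong_AE)
      show "AE u::real in lborel. ennreal (exp (- u\<^sup>2 / 2)) = ennreal (exp (- u\<^sup>2 / 2)) * indicator {0<..} u + ennreal (exp (- u\<^sup>2 / 2)) * indicator {..<0} u"
        using AE_lborel_singleton[of "0::real"] by eventually_elim (auto simp: indicator_def)
    qed
    also have "\<dots> = half_gauss + (\<integral>\<^sup>+u. ennreal (exp (- (u::real)\<^sup>2 / 2)) * indicator {..<0} u \<partial>lborel)"
      unfolding half_gauss_def by (rule nn_integral_add) auto
    also have "(\<integral>\<^sup>+u. ennreal (exp (- (u::real)\<^sup>2 / 2)) * indicator {..<0} u \<partial>lborel) = half_gauss"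
      unfolding half_gauss_def
      by (subst nn_integral_real_affine[where c="-1" and t=0]) (auto intro!: nn_integral_cong simp: indicator_def)
    finally show ?thesis by (simp add: mult_2)
  qed
  have nb: "(norm (basis_sum x :: 'a))\<^sup>2 = (\<Sum>b\<in>Basis. (x b)\<^sup>2)" for x
  proof -
    have "(norm (basis_sum x :: 'a))\<^sup>2 = (\<Sum>b\<in>Basis. (basis_sum x \<bullet> b)\<^sup>2)"
      by (subst euclidean_inner[of "basis_sum x" "basis_sum x", folded power2_norm_eq_inner]) (simp add: power2_eq_square)
    also have "\<dots> = (\<Sum>b\<in>Basis. (x b)\<^sup>2)"
      by (intro sum.cong) (simp_all add: inner_sum_left inner_Basis if_distrib sum.delta cong: if_cong)
    finally show ?thesis .
  qed
  have "(\<integral>\<^sup>+x. ennreal (exp (- (norm (x::'a))\<^sup>2 / 2)) \<partial>lborel) = (\<integral>\<^sup>+x. ennreal (exp (- (norm (basis_sum x :: 'a))\<^sup>2 / 2)) \<partial>LB Basis)"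
    by (subst lborel_eq, subst nn_integral_distr) auto
  also have "\<dots> = (\<integral>\<^sup>+x. (\<Prod>b\<in>(Basis :: 'a set). ennreal (exp (- (x b)\<^sup>2 / 2))) \<partial>LB Basis)"
    unfolding nb by (intro nn_integral_cong) (simp add: prod_ennreal exp_sum[symmetric] sum_divide_distrib sum_negf)
  also have "\<dots> = (\<Prod>b\<in>(Basis :: 'a set). (\<integral>\<^sup>+u. ennreal (exp (- u\<^sup>2 / 2)) \<partial>lborel))"
    by (rule product_nn_integral_prod) auto
  also have "\<dots> = (2 * half_gauss) ^ DIM('a)" by (simp only: one prod_constant)
  finally have "(\<integral>\<^sup>+x. ennreal (exp (- (norm (x::'a))\<^sup>2 / 2)) \<partial>lborel) = (2 * half_gauss) ^ DIM('a)" .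
  moreover have "(\<integral>\<^sup>+x. ennreal (exp (- (norm (x::'a))\<^sup>2 / 2)) \<partial>lborel) = gauss_moment (DIM('a) + 1) * emeasure lborel {x::'a. norm x \<le> 1}"
    by (rule nn_integral_gauss_gauge) auto
  moreover have "{x::'a. norm x \<le> 1} = cball 0 1" by (auto simp: dist_norm)
  ultimately show ?thesis by simp
qed

lemma gauss_moment_nonzero: "gauss_moment m \<noteq> 0"
proof
  assume "gauss_moment m = 0"
  hence "AE s::real in lborel. ennreal (s ^ m * exp (- s\<^sup>2 / 2)) * indicator {0<..} s = 0"
    unfolding gauss_moment_def by (subst (asm) nn_integral_0_iff_AE) auto
  hence "AE s::real in lborel. s \<notin> {0<..}"
  proof eventually_elim
    fix s :: real assume 0: "ennreal (s ^ m * exp (- s\<^sup>2 / 2)) * indicator {0<..} s = 0"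
    show "s \<notin> {0<..}"
    proof
      assume s: "s \<in> {0<..}"
      hence "0 < s ^ m * exp (- s\<^sup>2 / 2)" by simp
      hence "0 < ennreal (s ^ m * exp (- s\<^sup>2 / 2))" by (simp only: ennreal_less_zero_iff)
      with 0 s show False by (simp only: indicator_simps mult_1_right less_irrefl)
    qed
  qed
  hence "emeasure lborel ({0<..} :: real set) = 0" by (subst (asm) AE_iff_measurable[of "{0<..}"]) auto
  moreover have "emeasure lborel {1..2::real} \<le> emeasure lborel {0::real<..}" by (intro emeasure_mono) auto
  ultimately show False by simp
qed

text \<open>The two homogeneous functions are meant to be the gauge and the support function of a convex body.\<close>

lemma blaschke_santalo_gauge:
  fixes p h :: "'a::euclidean_space \<Rightarrow> real"
  assumes [measurable]: "p \<in> borel_measurable borel" "h \<in> borel_measurable borel"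
    and p0: "\<And>x. 0 \<le> p x" and ph: "\<And>s x. 0 < s \<Longrightarrow> p (s *\<^sub>R x) = s * p x"
    and h0: "\<And>x. 0 \<le> h x" and hh: "\<And>s x. 0 < s \<Longrightarrow> h (s *\<^sub>R x) = s * h x"
    and pair: "\<And>x y. x \<bullet> y \<le> p x * h y"
    and bdd: "bounded {x. p x \<le> 1}"
    and centered: "(\<integral>x. indicator {x. p x \<le> 1} x *\<^sub>R x \<partial>lborel) = 0"
  shows "emeasure lborel {x. p x \<le> 1} * emeasure lborel {y. h y \<le> 1} \<le> (emeasure lborel (cball (0::'a) 1))\<^sup>2"
proof -
  let ?K = "{x. p x \<le> 1}" let ?n = "DIM('a)"
  have K [measurable]: "?K \<in> sets borel" by measurable
  have Kfin: "emeasure lborel ?K < \<infinity>" using emeasure_bounded_finite[OF bdd] .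
  obtain R where R: "\<And>x. x \<in> ?K \<Longrightarrow> norm x \<le> R" using bdd unfolding bounded_iff by auto
  define F where "F x = exp (- (p x)\<^sup>2 / 2)" for x
  have [measurable]: "F \<in> borel_measurable borel" unfolding F_def[abs_def] by measurable
  have FI: "(\<integral>\<^sup>+x. ennreal (F x) \<partial>lborel) = gauss_moment (?n + 1) * emeasure lborel ?K"
    unfolding F_def by (rule nn_integral_gauss_gauge) (use p0 ph in auto)
  have gm: "gauss_moment m < \<infinity>" for m unfolding gauss_moment_def by (rule gauss_moment_finite)
  have Fi: "integrable lborel F"
  proof (rule integrableI_nonneg)
    show "(\<integral>\<^sup>+x. ennreal (F x) \<partial>lborel) < \<infinity>" unfolding FI using gm Kfin by (simp add: ennreal_mult_less_top)
  qed (auto simp: F_def)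
  have Fq: "(\<integral>\<^sup>+x. ennreal (F x * q x) \<partial>lborel) = gauss_moment (?n + 2) * (\<integral>\<^sup>+x. ennreal (q x * indicator ?K x) \<partial>lborel)"
    if [measurable]: "q \<in> borel_measurable borel" and "\<And>x. 0 \<le> q x" "\<And>s x. 0 < s \<Longrightarrow> q (s *\<^sub>R x) = s * q x" for q :: "'a \<Rightarrow> real"
    using nn_integral_gauss_homogeneous[of p "\<lambda>x. ennreal (q x)" 1] p0 ph that
    by (simp add: F_def ennreal_mult ennreal_indicator[symmetric])
  \<comment> \<open>By the homogeneous formula with \<open>k = 1\<close> the first moments of
    \<open>F\<close> are a fixed multiple of those of the body, so \<open>F\<close> is centered
    because the body is.\<close>
  have Fb: "integrable lborel (\<lambda>x. F x * (x \<bullet> b)) \<and> (\<integral>x. F x * (x \<bullet> b) \<partial>lborel) = 0" if b: "b \<in> Basis" for b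
  proof
    have Kb: "integrable lborel (\<lambda>x. indicator ?K x *\<^sub>R x)"
    proof (rule Bochner_Integration.integrable_bound)
      show "integrable lborel (\<lambda>x. R * indicator ?K x)" using Kfin by (intro integrable_mult_right integrable_real_indicator) auto
      show "AE x in lborel. norm (indicator ?K x *\<^sub>R x) \<le> norm (R * indicator ?K x)"
        by (rule AE_I2) (use R in \<open>auto simp: indicator_def intro: order_trans[OF _ abs_ge_self]\<close>)
    qed simp
    have Kbb: "integrable lborel (\<lambda>x. indicator ?K x * (x \<bullet> b))" "(\<integral>x. indicator ?K x * (x \<bullet> b) \<partial>lborel) = 0"
      using integrable_inner_left[of b lborel, OF Kb] integral_inner_left[of b lborel, OF Kb] centered by auto
    have fin: "(\<integral>\<^sup>+x. ennreal (norm (x \<bullet> b) * indicator ?K x) \<partial>lborel) < \<infinity>"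
      using Kbb(1) unfolding integrable_iff_bounded by (simp add: abs_mult mult.commute)
    show int: "integrable lborel (\<lambda>x. F x * (x \<bullet> b))"
    proof (rule integrableI_bounded)
      have "(\<integral>\<^sup>+x. ennreal (norm (F x * (x \<bullet> b))) \<partial>lborel) = (\<integral>\<^sup>+x. ennreal (F x * norm (x \<bullet> b)) \<partial>lborel)"
        by (simp add: F_def abs_mult)
      also have "\<dots> = gauss_moment (?n + 2) * (\<integral>\<^sup>+x. ennreal (norm (x \<bullet> b) * indicator ?K x) \<partial>lborel)"
        by (rule Fq) (auto simp: abs_mult)
      also have "\<dots> < \<infinity>" using fin gm by (simp add: ennreal_mult_less_top)
      finally show "(\<integral>\<^sup>+x. ennreal (norm (F x * (x \<bullet> b))) \<partial>lborel) < \<infinity>" .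
    qed simp
    \<comment> \<open>The homogeneous formula is for nonnegative functions; the two signs of
      \<open>\<sigma>\<close> give the positive and the negative part of
      \<open>x \<bullet> b\<close>.\<close>
    have pos: "(\<integral>\<^sup>+x. ennreal (F x * (\<sigma> * (x \<bullet> b))) \<partial>lborel) = gauss_moment (?n + 2) * (\<integral>\<^sup>+x. ennreal (indicator ?K x * (\<sigma> * (x \<bullet> b))) \<partial>lborel)" for \<sigma> :: real
    proof -
      have eqm: "ennreal (c * t) = ennreal (c * max 0 t)" if "0 \<le> c" for c t :: real
        using that by (cases "0 \<le> t") (auto simp: ennreal_neg mult_nonneg_nonpos)
      have "(\<integral>\<^sup>+x. ennreal (F x * (\<sigma> * (x \<bullet> b))) \<partial>lborel) = (\<integral>\<^sup>+x. ennreal (F x * max 0 (\<sigma> * (x \<bullet> b))) \<partial>lborel)"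
        by (rule nn_integral_cong, rule eqm) (simp add: F_def)
      moreover have "(\<integral>\<^sup>+x. ennreal (indicator ?K x * (\<sigma> * (x \<bullet> b))) \<partial>lborel) = (\<integral>\<^sup>+x. ennreal (max 0 (\<sigma> * (x \<bullet> b)) * indicator ?K x) \<partial>lborel)"
        by (rule nn_integral_cong, subst mult.commute[of "max 0 _"], rule eqm) simp
      moreover have "(\<integral>\<^sup>+x. ennreal (F x * max 0 (\<sigma> * (x \<bullet> b))) \<partial>lborel) = gauss_moment (?n + 2) * (\<integral>\<^sup>+x. ennreal (max 0 (\<sigma> * (x \<bullet> b)) * indicator ?K x) \<partial>lborel)"
        by (rule Fq) (auto simp: max_mult_distrib_left algebra_simps)
      ultimately show ?thesis by simp
    qed
    have "(\<integral>x. F x * (x \<bullet> b) \<partial>lborel) = enn2real (gauss_moment (?n + 2)) * (\<integral>x. indicator ?K x * (x \<bullet> b) \<partial>lborel)"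
      using pos[of 1] pos[of "-1"] unfolding real_lebesgue_integral_def[OF int] real_lebesgue_integral_def[OF Kbb(1)]
      by (simp add: enn2real_mult right_diff_distrib)
    thus "(\<integral>x. F x * (x \<bullet> b) \<partial>lborel) = 0" by (simp add: Kbb(2))
  qed
  have "(\<integral>\<^sup>+x. ennreal (F x) \<partial>lborel) * (\<integral>\<^sup>+y. ennreal (exp (- (h y)\<^sup>2 / 2)) \<partial>lborel) \<le> (4 * half_gauss\<^sup>2) ^ DIM('a)"
  proof (rule functional_santalo)
    show "0 \<le> F x" for x by (simp add: F_def)
    \<comment> \<open>The two Gaussians are coupled by \<open>x \<bullet> y \<le> p x * h y\<close>,
      which is at most half the sum of the squares.\<close>
    show "ennreal (F x) * ennreal (exp (- (h y)\<^sup>2 / 2)) \<le> ennreal (exp (- (x \<bullet> y)))" for x y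
    proof -
      have "2 * (p x * h y) \<le> (p x)\<^sup>2 + (h y)\<^sup>2" using zero_le_power2[of "p x - h y"] by (simp add: power2_eq_square algebra_simps)
      hence "- (p x)\<^sup>2 / 2 + - (h y)\<^sup>2 / 2 \<le> - (x \<bullet> y)" using pair[of x y] by (simp add: field_simps)
      thus ?thesis by (simp add: F_def ennreal_mult[symmetric] ennreal_leI flip: exp_add)
    qed
  qed (use Fi Fb in auto)
  also have "(\<integral>\<^sup>+y. ennreal (exp (- (h y)\<^sup>2 / 2)) \<partial>lborel) = gauss_moment (?n + 1) * emeasure lborel {y. h y \<le> 1}"
    by (rule nn_integral_gauss_gauge) (use h0 hh in auto)
  also have "(4 * half_gauss\<^sup>2) ^ ?n = ((2 * half_gauss) ^ ?n)\<^sup>2"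
  proof -
    have "4 * half_gauss\<^sup>2 = (2 * half_gauss)\<^sup>2" by (simp add: power_mult_distrib)
    thus ?thesis by (simp only: power_mult[symmetric] mult.commute)
  qed
  also have "\<dots> = (gauss_moment (?n + 1) * emeasure lborel (cball (0::'a) 1))\<^sup>2" by (simp only: gauss_moment_ball)
  finally have main: "(gauss_moment (?n + 1))\<^sup>2 * (emeasure lborel ?K * emeasure lborel {y. h y \<le> 1})
      \<le> (gauss_moment (?n + 1))\<^sup>2 * (emeasure lborel (cball (0::'a) 1))\<^sup>2"
    unfolding FI by (simp add: power2_eq_square mult_ac)
  obtain c where c: "gauss_moment (?n + 1) = ennreal c" "0 < c"
    using gm[of "?n + 1"] gauss_moment_nonzero[of "?n + 1"] by (cases "gauss_moment (?n + 1)") (auto simp: less_le)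
  have "ennreal (inverse c ^ 2) * ((gauss_moment (?n + 1))\<^sup>2 * X) = X" for X
  proof -
    have "inverse c ^ 2 * c ^ 2 = 1" using c(2) by (simp add: power_inverse)
    hence "ennreal (inverse c ^ 2) * ennreal (c ^ 2) = 1" using c(2) by (simp only: ennreal_mult[symmetric] zero_le_power2 ennreal_1)
    thus ?thesis unfolding c(1) using c(2) by (simp add: ennreal_power mult.assoc[symmetric])
  qed
  with mult_left_mono[OF main, of "ennreal (inverse c ^ 2)"] show ?thesis by simp
qed

section \<open>Gauge, support function and polar of a convex body\<close>

definition minkowski :: "(real^'n) set \<Rightarrow> real^'n \<Rightarrow> real" where
  "minkowski K x = Inf {t. 0 < t \<and> x /\<^sub>R t \<in> K}"

locale convex_body =
  fixes K :: "(real^'n) set"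
  assumes compact: "compact K" and convex: "convex K" and zero_interior: "0 \<in> interior K"
begin

lemma zero_in: "0 \<in> K" using zero_interior interior_subset by blast

lemma closed: "closed K" using compact by (rule compact_imp_closed)

lemma inner_ball:
  obtains e where "0 < e" "cball 0 e \<subseteq> K"
  using zero_interior mem_interior_cball by blast

lemma outer_ball:
  obtains R where "0 < R" "\<And>x. x \<in> K \<Longrightarrow> norm x \<le> R"
  using compact_imp_bounded[OF compact] unfolding bounded_pos by blast

lemma scale_in: "x \<in> K \<Longrightarrow> 0 \<le> t \<Longrightarrow> t \<le> 1 \<Longrightarrow> t *\<^sub>R x \<in> K"
  using convexD[OF convex zero_in, of x "1 - t" t] by simp

lemma minkowski_set_nonempty: "{t. 0 < t \<and> x /\<^sub>R t \<in> K} \<noteq> {}"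
proof -
  obtain e where e: "0 < e" "cball 0 e \<subseteq> K" by (rule inner_ball)
  have "x /\<^sub>R (norm x / e + 1) \<in> cball 0 e"
  proof -
    have "norm x / (norm x / e + 1) \<le> e"
    proof -
      have "norm x \<le> e * (norm x / e + 1)" using e by (simp add: distrib_left)
      moreover have "0 < norm x / e + 1" using e by (intro add_nonneg_pos) auto
      ultimately show ?thesis by (simp only: pos_divide_le_eq)
    qed
    moreover have "0 < norm x / e + 1" using e by (intro add_nonneg_pos) auto
    ultimately show ?thesis by (simp add: dist_norm divide_inverse mult.commute)
  qed
  moreover have "0 < norm x / e + 1" using e by (intro add_nonneg_pos) auto
  ultimately show ?thesis using e by blast
qed

text \<open>Closedness of \<open>K\<close> makes the infimum attained. Together with
  \<open>minkowski_eqI\<close> this is the working description of the gauge.\<close>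

lemma minkowski_le_iff:
  assumes t: "0 < t"
  shows "minkowski K x \<le> t \<longleftrightarrow> x /\<^sub>R t \<in> K"
proof
  let ?S = "{t. 0 < t \<and> x /\<^sub>R t \<in> K}"
  have bdd: "bdd_below ?S" by (rule bdd_belowI[of _ 0]) auto
  {
    assume "x /\<^sub>R t \<in> K"
    thus "minkowski K x \<le> t" unfolding minkowski_def using t bdd by (intro cInf_lower) auto
  }
  assume le: "minkowski K x \<le> t"
  have above: "x /\<^sub>R s \<in> K" if "t < s" for s
  proof -
    have "Inf ?S < s" using le that unfolding minkowski_def by simp
    then obtain r where r: "0 < r" "x /\<^sub>R r \<in> K" "r < s"
      using cInf_less_iff[OF minkowski_set_nonempty bdd] by auto
    have "(r / s) *\<^sub>R (x /\<^sub>R r) \<in> K" using r by (intro scale_in[OF r(2)]) auto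
    moreover have "r / s * inverse r = inverse s" using r by (simp add: divide_inverse)
    ultimately show ?thesis by simp
  qed
  have "((\<lambda>s. x /\<^sub>R s) \<longlongrightarrow> x /\<^sub>R t) (at_right t)"
    using t by (intro tendsto_intros) auto
  thus "x /\<^sub>R t \<in> K"
    by (rule Lim_in_closed_set[OF closed, rotated 2])
       (auto simp: eventually_at_right_less above intro: eventually_mono[OF eventually_at_right_less])
qed

lemma minkowski_nonneg: "0 \<le> minkowski K x"
  unfolding minkowski_def using minkowski_set_nonempty by (intro cInf_greatest) auto

lemma minkowski_eqI:
  assumes "0 \<le> a" "\<And>t. 0 < t \<Longrightarrow> minkowski K x \<le> t \<longleftrightarrow> a \<le> t"
  shows "minkowski K x = a"
proof (rule antisym)
  show "minkowski K x \<le> a"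
  proof (rule field_le_epsilon)
    fix e :: real assume "0 < e" thus "minkowski K x \<le> a + e" using assms by simp
  qed
  show "a \<le> minkowski K x"
  proof (rule field_le_epsilon)
    fix e :: real assume "0 < e"
    thus "a \<le> minkowski K x + e" using assms(2)[of "minkowski K x + e"] minkowski_nonneg[of x] by simp
  qed
qed

lemma minkowski_scale: "0 < s \<Longrightarrow> minkowski K (s *\<^sub>R x) = s * minkowski K x"
proof (rule minkowski_eqI)
  fix t :: real assume s: "0 < s" and t: "0 < t"
  have e: "(s *\<^sub>R x) /\<^sub>R t = x /\<^sub>R (t / s)" by (simp add: divide_inverse mult.commute)
  hence "minkowski K (s *\<^sub>R x) \<le> t \<longleftrightarrow> minkowski K x \<le> t / s"
    using minkowski_le_iff[OF t, of "s *\<^sub>R x"] minkowski_le_iff[OF divide_pos_pos[OF t s], of x] unfolding e by blast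
  thus "minkowski K (s *\<^sub>R x) \<le> t \<longleftrightarrow> s * minkowski K x \<le> t" using s by (simp add: field_simps)
qed (simp add: minkowski_nonneg)

lemma minkowski_le_1: "minkowski K x \<le> 1 \<longleftrightarrow> x \<in> K"
  using minkowski_le_iff[of 1 x] by simp

lemma minkowski_0: "minkowski K 0 = 0"
  by (rule minkowski_eqI) (auto simp: minkowski_le_iff zero_in)

lemma minkowski_pos: "x \<noteq> 0 \<Longrightarrow> 0 < minkowski K x"
proof (rule ccontr)
  assume x: "x \<noteq> 0" "\<not> 0 < minkowski K x"
  obtain R where R: "0 < R" "\<And>x. x \<in> K \<Longrightarrow> norm x \<le> R" using outer_ball by blast
  define t where "t = norm x / (2 * R)"
  have t: "0 < t" using x R by (simp add: t_def)
  hence "x /\<^sub>R t \<in> K" using x minkowski_le_iff[OF t, of x] by simp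
  hence "norm (x /\<^sub>R t) \<le> R" by (rule R)
  thus False using x R by (simp add: t_def)
qed

lemma minkowski_triangle: "minkowski K (x + y) \<le> minkowski K x + minkowski K y"
proof (rule field_le_epsilon)
  fix e :: real assume e: "0 < e"
  define s where "s = minkowski K x + e / 2" define t where "t = minkowski K y + e / 2"
  have st: "0 < s" "0 < t" using e minkowski_nonneg[of x] minkowski_nonneg[of y] by (auto simp: s_def t_def)
  have "x /\<^sub>R s \<in> K" "y /\<^sub>R t \<in> K" using st e by (simp_all add: minkowski_le_iff[symmetric] s_def t_def)
  hence "(s / (s + t)) *\<^sub>R (x /\<^sub>R s) + (t / (s + t)) *\<^sub>R (y /\<^sub>R t) \<in> K"
    using st by (intro convexD[OF convex]) (auto simp: add_divide_distrib[symmetric])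
  also have "(s / (s + t)) *\<^sub>R (x /\<^sub>R s) + (t / (s + t)) *\<^sub>R (y /\<^sub>R t) = (x + y) /\<^sub>R (s + t)"
  proof -
    have "s / (s + t) * inverse s = inverse (s + t)" "t / (s + t) * inverse t = inverse (s + t)"
      using st by (simp_all add: divide_inverse)
    thus ?thesis by (simp add: scaleR_add_right)
  qed
  finally have "minkowski K (x + y) \<le> s + t" using st by (simp add: minkowski_le_iff)
  thus "minkowski K (x + y) \<le> minkowski K x + minkowski K y + e" by (simp add: s_def t_def)
qed

lemma minkowski_lipschitz:
  obtains C where "0 < C" "\<And>x y. \<bar>minkowski K x - minkowski K y\<bar> \<le> C * norm (x - y)"
proof -
  obtain e where e: "0 < e" "cball 0 e \<subseteq> K" by (rule inner_ball)
  have b: "minkowski K v \<le> norm v / e" for v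
  proof (cases "v = 0")
    case False
    have "v /\<^sub>R (norm v / e) \<in> cball 0 e" using False e by (simp add: dist_norm)
    thus ?thesis using False e minkowski_le_iff[of "norm v / e" v] by auto
  qed (simp add: minkowski_0)
  have "\<bar>minkowski K x - minkowski K y\<bar> \<le> (1 / e) * norm (x - y)" for x y
    using minkowski_triangle[of y "x - y"] minkowski_triangle[of x "y - x"] b[of "x - y"] b[of "y - x"]
    by (simp add: norm_minus_commute abs_le_iff)
  thus thesis using e that[of "1 / e"] by simp
qed

lemma continuous_minkowski: "continuous_on UNIV (minkowski K)"
proof -
  obtain C where C: "0 < C" "\<And>x y. \<bar>minkowski K x - minkowski K y\<bar> \<le> C * norm (x - y)" by (rule minkowski_lipschitz) blast
  have "C-lipschitz_on UNIV (minkowski K)"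
    using C by (intro lipschitz_onI) (auto simp: dist_norm dist_real_def)
  thus ?thesis by (rule lipschitz_on_continuous_on)
qed

lemma minkowski_borel [measurable]: "minkowski K \<in> borel_measurable borel"
  using continuous_minkowski by (rule borel_measurable_continuous_onI)

lemma frontier_iff: "x \<in> frontier K \<longleftrightarrow> minkowski K x = 1"
proof -
  have "x \<in> interior K \<longleftrightarrow> minkowski K x < 1"
  proof
    assume "x \<in> interior K"
    then obtain d where d: "0 < d" "cball x d \<subseteq> K" using mem_interior_cball by blast
    show "minkowski K x < 1"
    proof (cases "x = 0")
      case False
      have "x + (d / norm x) *\<^sub>R x \<in> K" using d False by (intro subsetD[OF d(2)]) (simp add: dist_norm)
      moreover have "x + (d / norm x) *\<^sub>R x = (1 + d / norm x) *\<^sub>R x" by (simp add: algebra_simps)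
      moreover have "0 < d / norm x" using d False by simp
      ultimately have "(1 + d / norm x) * minkowski K x \<le> 1"
        using minkowski_scale[of "1 + d / norm x" x] minkowski_le_1[of "(1 + d / norm x) *\<^sub>R x"] by simp
      moreover have "minkowski K x < (1 + d / norm x) * minkowski K x"
        using minkowski_pos[OF False] \<open>0 < d / norm x\<close> by simp
      ultimately show ?thesis by simp
    qed (simp add: minkowski_0)
  next
    assume "minkowski K x < 1"
    moreover have "open {x. minkowski K x < 1}"
      using continuous_minkowski by (intro open_Collect_less) (auto intro: continuous_on_subset)
    moreover have "{x. minkowski K x < 1} \<subseteq> K" using minkowski_le_1 by force
    ultimately show "x \<in> interior K" by (meson interiorI mem_Collect_eq)
  qed
  thus ?thesis using closed minkowski_le_1[of x] by (auto simp: frontier_def)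
qed

lemma normalize_frontier: "x \<noteq> 0 \<Longrightarrow> x /\<^sub>R minkowski K x \<in> frontier K"
  using minkowski_pos[of x] minkowski_scale[of "inverse (minkowski K x)" x] by (simp add: frontier_iff)

lemma frontier_nonzero: "x \<in> frontier K \<Longrightarrow> x \<noteq> 0"
  by (auto simp: frontier_iff minkowski_0)

lemma frontier_in: "x \<in> frontier K \<Longrightarrow> x \<in> K"
  by (simp add: frontier_iff flip: minkowski_le_1)

lemma bdd_inner: "bdd_above ((\<lambda>x. x \<bullet> u) ` K)"
proof -
  obtain R where R: "0 < R" "\<And>x. x \<in> K \<Longrightarrow> norm x \<le> R" using outer_ball by blast
  show ?thesis
  proof (rule bdd_aboveI2)
    fix x assume "x \<in> K"
    thus "x \<bullet> u \<le> R * norm u" using R(2)[of x] norm_cauchy_schwarz[of x u] mult_right_mono[of "norm x" R "norm u"] by simp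
  qed
qed

lemma inner_le_support: "x \<in> K \<Longrightarrow> x \<bullet> u \<le> support_fun K u"
  unfolding support_fun_def by (rule cSUP_upper[OF _ bdd_inner])

lemma support_least: "(\<And>x. x \<in> K \<Longrightarrow> x \<bullet> u \<le> a) \<Longrightarrow> support_fun K u \<le> a"
  unfolding support_fun_def using zero_in by (intro cSUP_least) auto

lemma support_attained: obtains x where "x \<in> K" "x \<bullet> u = support_fun K u"
proof -
  obtain x where x: "x \<in> K" "\<And>y. y \<in> K \<Longrightarrow> y \<bullet> u \<le> x \<bullet> u"
  proof -
    have "\<exists>x\<in>K. \<forall>y\<in>K. y \<bullet> u \<le> x \<bullet> u"
      by (intro continuous_attains_sup compact continuous_intros) (use zero_in in auto)
    thus thesis using that by blast
  qed
  thus thesis using that[of x] inner_le_support[of x u] support_least[of u "x \<bullet> u"] by force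
qed

lemma support_nonneg: "0 \<le> support_fun K u"
  using inner_le_support[OF zero_in, of u] by simp

lemma support_ball_le: 
  obtains e where "0 < e" "\<And>u. e * norm u \<le> support_fun K u"
proof -
  obtain e where e: "0 < e" "cball 0 e \<subseteq> K" by (rule inner_ball)
  have "e * norm u \<le> support_fun K u" for u
  proof (cases "u = 0")
    case False
    have "(e / norm u) *\<^sub>R u \<in> K" using e False by (intro subsetD[OF e(2)]) (simp add: dist_norm)
    from inner_le_support[OF this, of u] False show ?thesis by (simp add: power2_norm_eq_inner[symmetric] power2_eq_square)
  qed (simp add: support_nonneg)
  thus thesis using e that by blast
qed

lemma support_pos: "u \<noteq> 0 \<Longrightarrow> 0 < support_fun K u"
proof -
  obtain e where e: "0 < e" "\<And>u. e * norm u \<le> support_fun K u" using support_ball_le by blast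
  assume "u \<noteq> 0"
  hence "0 < e * norm u" using e by simp
  thus ?thesis using e(2)[of u] by linarith
qed

lemma support_scale: "0 < s \<Longrightarrow> support_fun K (s *\<^sub>R u) = s * support_fun K u"
proof (rule antisym)
  assume s: "0 < s"
  show "support_fun K (s *\<^sub>R u) \<le> s * support_fun K u"
    using s inner_le_support by (intro support_least) simp
  obtain x where x: "x \<in> K" "x \<bullet> u = support_fun K u" using support_attained by blast
  show "s * support_fun K u \<le> support_fun K (s *\<^sub>R u)"
    using inner_le_support[OF x(1), of "s *\<^sub>R u"] x by simp
qed

lemma continuous_support: "continuous_on UNIV (support_fun K)"
proof -
  obtain R where R: "0 < R" "\<And>x. x \<in> K \<Longrightarrow> norm x \<le> R" using outer_ball by blast
  have le: "support_fun K u \<le> support_fun K v + R * norm (u - v)" for u v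
  proof (rule support_least)
    fix x assume x: "x \<in> K"
    have "x \<bullet> u = x \<bullet> v + x \<bullet> (u - v)" by (simp add: inner_diff_right)
    also have "x \<bullet> (u - v) \<le> norm x * norm (u - v)" by (rule norm_cauchy_schwarz)
    also have "\<dots> \<le> R * norm (u - v)" using R(2)[OF x] by (intro mult_right_mono) auto
    finally show "x \<bullet> u \<le> support_fun K v + R * norm (u - v)" using inner_le_support[OF x, of v] by simp
  qed
  have "R-lipschitz_on UNIV (support_fun K)"
  proof (rule lipschitz_onI)
    fix u v show "dist (support_fun K u) (support_fun K v) \<le> R * dist u v"
      using le[of u v] le[of v u] by (simp add: dist_norm dist_real_def norm_minus_commute abs_le_iff)
  qed (use R in simp)
  thus ?thesis by (rule lipschitz_on_continuous_on)
qed

lemma support_borel [measurable]: "support_fun K \<in> borel_measurable borel"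
  using continuous_support by (rule borel_measurable_continuous_onI)

lemma inner_le_minkowski_support: "x \<bullet> y \<le> minkowski K x * support_fun K y"
proof (cases "x = 0")
  case False
  have "(x /\<^sub>R minkowski K x) \<bullet> y \<le> support_fun K y"
    by (intro inner_le_support frontier_in normalize_frontier False)
  thus ?thesis using minkowski_pos[OF False] by (simp add: field_simps)
qed (simp add: minkowski_0)

lemma polar_body_eq: "polar_body K = {y. support_fun K y \<le> 1}"
  unfolding polar_body_def using inner_le_support support_least by (auto intro: order_trans)

lemma body_eq: "K = {x. minkowski K x \<le> 1}" by (auto simp: minkowski_le_1)

lemma vol_pos: "0 < vol K" and vol_emeasure: "emeasure lborel K = ennreal (vol K)"
proof -
  have f: "emeasure lborel K < \<infinity>" by (rule emeasure_compact_finite[OF compact])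
  thus e: "emeasure lborel K = ennreal (vol K)" unfolding vol_def by (intro emeasure_eq_ennreal_measure) auto
  obtain e' where e': "0 < e'" "cball 0 e' \<subseteq> K" by (rule inner_ball)
  have "0 < emeasure lborel (cball (0::real^'n) e')"
    using e' by (simp add: emeasure_cball unit_ball_vol_pos)
  also have "\<dots> \<le> emeasure lborel K" using closed by (intro emeasure_mono e') auto
  finally show "0 < vol K" unfolding e by simp
qed

lemma polar_compact: "compact (polar_body K)" and polar_interior: "0 \<in> interior (polar_body K)"
proof -
  have c: "closed (polar_body K)" unfolding polar_body_eq
    using continuous_support by (intro closed_Collect_le) (auto intro: continuous_on_subset)
  obtain e where e: "0 < e" "\<And>u. e * norm u \<le> support_fun K u" using support_ball_le by blast
  have "norm u \<le> 1 / e" if "u \<in> polar_body K" for u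
    using that e(2)[of u] e(1) unfolding polar_body_eq by (simp add: field_simps)
  thus "compact (polar_body K)" using c by (auto simp: compact_eq_bounded_closed bounded_iff)
  have "open {y. support_fun K y < 1}"
    using continuous_support by (intro open_Collect_less) (auto intro: continuous_on_subset)
  moreover have "support_fun K 0 < 1"
    using support_least[of 0 0] by simp
  ultimately show "0 \<in> interior (polar_body K)" unfolding polar_body_eq
    by (intro interiorI[of "{y. support_fun K y < 1}"]) auto
qed

lemma polar_convex: "convex (polar_body K)"
proof -
  have "polar_body K = (\<Inter>x\<in>K. {y. x \<bullet> y \<le> 1})" by (auto simp: polar_body_def)
  thus ?thesis by (auto intro!: convex_INT convex_halfspace_le)
qed

lemma polar_convex_body: "convex_body (polar_body K)"
  by unfold_locales (rule polar_compact polar_interior polar_convex)+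

theorem blaschke_santalo:
  assumes c: "centroid K = 0"
  shows "vol K * vol (polar_body K) \<le> (vol (cball (0::real^'n) 1))\<^sup>2"
proof -
  interpret P: convex_body "polar_body K" by (rule polar_convex_body)
  have "(\<integral>x. indicator K x *\<^sub>R x \<partial>lborel) = 0"
    using c vol_pos unfolding centroid_def set_lebesgue_integral_def by simp
  hence "emeasure lborel {x. minkowski K x \<le> 1} * emeasure lborel {y. support_fun K y \<le> 1} \<le> (emeasure lborel (cball (0::real^'n) 1))\<^sup>2"
    by (intro blaschke_santalo_gauge)
       (use compact_imp_bounded[OF compact] in \<open>auto simp: minkowski_nonneg support_nonneg minkowski_scale support_scale inner_le_minkowski_support minkowski_le_1\<close>)
  moreover have "emeasure lborel (cball (0::real^'n) 1) = ennreal (vol (cball (0::real^'n) 1))"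
    unfolding vol_def using emeasure_compact_finite[OF compact_cball, of "0::real^'n" 1] by (intro emeasure_eq_ennreal_measure) auto
  ultimately have "ennreal (vol K) * ennreal (vol (polar_body K)) \<le> (ennreal (vol (cball (0::real^'n) 1)))\<^sup>2"
    unfolding body_eq[symmetric] polar_body_eq[symmetric] vol_emeasure P.vol_emeasure
    by simp
  thus ?thesis using vol_pos P.vol_pos
    by (simp add: ennreal_mult[symmetric] ennreal_power vol_def)
qed

end

section \<open>The Gauss map of a smooth body\<close>

lemma det_matrix_compose:
  fixes f g :: "real^'n \<Rightarrow> real^'n"
  assumes "linear f" "linear g"
  shows "det (matrix (\<lambda>v. f (g v))) = det (matrix f) * det (matrix g)"
  using matrix_compose[OF assms(2,1)] by (simp add: o_def det_mul)

text \<open>An orthogonal map takes \<open>w\<close> to a multiple of a basis vector and preserves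
  both sides. The conjugated matrix differs from the identity in a single column, so
  \<open>cramer_lemma\<close> evaluates its determinant.\<close>

lemma det_rank_one:
  fixes a w :: "real^'n"
  shows "det (matrix (\<lambda>v. v + (v \<bullet> w) *\<^sub>R a)) = 1 + a \<bullet> w"
proof -
  obtain k :: 'n where True by simp
  have "norm w = norm (norm w *\<^sub>R axis k (1::real))" by (simp add: norm_axis_1)
  then obtain f where f: "orthogonal_transformation f" "f w = norm w *\<^sub>R axis k (1::real)"
    using orthogonal_transformation_exists by blast
  have lf: "linear f" using f(1) by (rule orthogonal_transformation_linear)
  obtain g where g: "linear g" "\<And>x. f (g x) = x" "\<And>x. g (f x) = x"
  proof -
    have "bij f" using f(1) by (rule orthogonal_transformation_bij)
    hence "f (inv f x) = x" "inv f (f x) = x" for x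
      by (simp_all add: bij_is_surj surj_f_inv_f bij_is_inj inv_f_f)
    moreover have "linear (inv f)" using f(1) orthogonal_transformation_inv orthogonal_transformation_linear by blast
    ultimately show thesis using that by blast
  qed
  let ?L = "\<lambda>v. v + (v \<bullet> w) *\<^sub>R a"
  have lL: "linear ?L" by (rule linearI) (simp_all add: algebra_simps inner_add_left scaleR_add_left)
  have dfg: "det (matrix f) * det (matrix g) = 1"
    using det_matrix_compose[OF lf g(1)] by (simp add: g(2) matrix_id_mat_1[unfolded id_def])
  define c where "c = axis k 1 + norm w *\<^sub>R f a"
  have conj: "f (?L (g x)) = x + (norm w * x $ k) *\<^sub>R f a" for x
  proof -
    have "g x \<bullet> w = f (g x) \<bullet> f w" using f(1) by (simp add: orthogonal_transformation_def)
    also have "\<dots> = norm w * x $ k" by (simp add: g(2) f(2) inner_axis)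
    finally show ?thesis by (simp add: linear_add[OF lf] linear_scale[OF lf] g(2))
  qed
  have "det (matrix ?L) = det (matrix f) * (det (matrix ?L) * det (matrix g))"
    using dfg by (simp add: mult_ac)
  also have "\<dots> = det (matrix (\<lambda>x. f (?L (g x))))"
    using det_matrix_compose[OF lL g(1)] det_matrix_compose[OF lf, of "\<lambda>x. ?L (g x)"] linear_compose[OF g(1) lL]
    by (simp add: o_def)
  also have "matrix (\<lambda>x. f (?L (g x))) = (\<chi> i j. if j = k then c $ i else (mat 1 :: real^'n^'n) $ i $ j)"
    unfolding conj by (auto simp: matrix_def vec_eq_iff c_def axis_def mat_def)
  also have "det \<dots> = c $ k * det (mat 1 :: real^'n^'n)"
    using cramer_lemma[of k "mat 1" c] unfolding matrix_vector_mul_lid .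
  also have "c $ k = 1 + f a \<bullet> f w" by (simp add: c_def f(2) inner_axis)
  also have "f a \<bullet> f w = a \<bullet> w" using f(1) by (simp add: orthogonal_transformation_def)
  finally show ?thesis by (simp add: det_I)
qed

text \<open>An interface with two kinds of instances: bodies in \<open>C2_plus\<close>, through
  local defining functions, and ellipsoids, through their explicit normals. Conditions on the
  curvature are imposed separately where they enter.\<close>

locale smooth_body = convex_body K for K :: "(real^'n) set" +
  assumes normal_unique: "x \<in> frontier K \<Longrightarrow> \<exists>!u. norm u = 1 \<and> (\<forall>y\<in>K. y \<bullet> u \<le> x \<bullet> u)"
    and normal_differentiable: "x \<in> frontier K \<Longrightarrow> outer_normal K differentiable (at x within frontier K)"
begin

abbreviation \<nu> where "\<nu> \<equiv> outer_normal K"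
abbreviation h where "h \<equiv> support_fun K"
abbreviation p where "p \<equiv> minkowski K"

lemma normal:
  assumes "x \<in> frontier K"
  shows "norm (\<nu> x) = 1" "y \<in> K \<Longrightarrow> y \<bullet> \<nu> x \<le> x \<bullet> \<nu> x"
  using theI'[OF normal_unique[OF assms]] unfolding outer_normal_def by auto

lemma normal_eqI:
  assumes "x \<in> frontier K" "norm u = 1" "\<And>y. y \<in> K \<Longrightarrow> y \<bullet> u \<le> x \<bullet> u"
  shows "\<nu> x = u"
  unfolding outer_normal_def using normal_unique[OF assms(1)] assms by (intro the1_equality) auto

lemma support_normal: "x \<in> frontier K \<Longrightarrow> h (\<nu> x) = x \<bullet> \<nu> x"
  using inner_le_support[OF frontier_in, of x "\<nu> x"] support_least[of "\<nu> x" "x \<bullet> \<nu> x"] normal(2)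
  by (intro antisym) auto

lemma inner_normal_pos: "x \<in> frontier K \<Longrightarrow> 0 < x \<bullet> \<nu> x"
  using support_pos[of "\<nu> x"] normal(1)[of x] support_normal[of x] by fastforce

lemma continuous_normal: "continuous_on (frontier K) \<nu>"
  using normal_differentiable differentiable_imp_continuous_within by (auto simp: continuous_on_eq_continuous_within)

section \<open>The gradient of the gauge and the extended Gauss map\<close>

definition foot :: "real^'n \<Rightarrow> real^'n" where "foot x = x /\<^sub>R p x"

lemma foot_frontier: "x \<noteq> 0 \<Longrightarrow> foot x \<in> frontier K"
  unfolding foot_def by (rule normalize_frontier)

lemma foot_fix: "x \<in> frontier K \<Longrightarrow> foot x = x"
  by (simp add: foot_def frontier_iff)

lemma foot_scale: "0 < s \<Longrightarrow> foot (s *\<^sub>R x) = foot x"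
  by (simp add: foot_def minkowski_scale)

lemma foot_eq: "x \<noteq> 0 \<Longrightarrow> p x *\<^sub>R foot x = x"
  using minkowski_pos[of x] by (simp add: foot_def)

lemma continuous_foot: "continuous_on (- {0}) foot"
  unfolding foot_def using minkowski_pos
  by (intro continuous_intros continuous_on_subset[OF continuous_minkowski]) force+

text \<open>The gradient of the gauge: the outer normal at the boundary point on the ray of
  \<open>x\<close>, scaled so that \<open>x \<bullet> pgrad x = p x\<close>.\<close>

definition pgrad :: "real^'n \<Rightarrow> real^'n" where "pgrad x = \<nu> (foot x) /\<^sub>R (foot x \<bullet> \<nu> (foot x))"

lemma pgrad_lower: "x \<noteq> 0 \<Longrightarrow> y \<bullet> pgrad x \<le> p y"
  using inner_le_minkowski_support[of y "\<nu> (foot x)"] inner_normal_pos[OF foot_frontier, of x] support_normal[OF foot_frontier, of x]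
  by (simp add: pgrad_def field_simps)

lemma pgrad_eq: "x \<noteq> 0 \<Longrightarrow> x \<bullet> pgrad x = p x"
proof -
  assume x: "x \<noteq> 0"
  have "x \<bullet> pgrad x = (p x *\<^sub>R foot x) \<bullet> pgrad x" using foot_eq[OF x] by simp
  also have "\<dots> = p x" using inner_normal_pos[OF foot_frontier[OF x]] by (simp add: pgrad_def)
  finally show ?thesis .
qed

lemma continuous_pgrad: "continuous_on (- {0}) pgrad"
proof -
  have "continuous_on (- {0}) (\<lambda>x. \<nu> (foot x))"
    by (rule continuous_on_compose2[OF continuous_normal continuous_foot]) (use foot_frontier in auto)
  thus ?thesis unfolding pgrad_def
    using inner_normal_pos foot_frontier by (intro continuous_intros continuous_foot) force+
qed

text \<open>Both one-sided estimates come from \<open>y \<bullet> pgrad x \<le> p y\<close>, with equality at \<open>y = x\<close>; continuity of the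
  Gauss map then suffices, and no implicit function theorem is needed.\<close>

lemma minkowski_has_derivative:
  assumes x: "x \<noteq> 0"
  shows "(p has_derivative (\<lambda>v. v \<bullet> pgrad x)) (at x)"
  unfolding has_derivative_at'
proof (intro conjI allI impI)
  show "bounded_linear (\<lambda>v. v \<bullet> pgrad x)" by (rule bounded_linear_inner_left)
  fix e :: real assume e: "0 < e"
  have "continuous (at x) pgrad" using continuous_pgrad x continuous_on_eq_continuous_at[of "- {0}" pgrad] by auto
  then obtain d where d: "0 < d" "\<And>y. dist y x < d \<Longrightarrow> dist (pgrad y) (pgrad x) < e"
    using e unfolding continuous_at_eps_delta by blast
  show "\<exists>d>0. \<forall>y. 0 < norm (y - x) \<and> norm (y - x) < d \<longrightarrow> norm (p y - p x - (y - x) \<bullet> pgrad x) / norm (y - x) < e"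
  proof (intro exI[of _ "min d (norm x)"] conjI allI impI)
    show "0 < min d (norm x)" using d x by simp
    fix y assume y: "0 < norm (y - x) \<and> norm (y - x) < min d (norm x)"
    have y0: "y \<noteq> 0" using y by (auto simp: norm_minus_commute)
    have lo: "0 \<le> p y - p x - (y - x) \<bullet> pgrad x"
      using pgrad_lower[OF x, of y] pgrad_eq[OF x] by (simp add: inner_diff_left)
    have "p y - p x - (y - x) \<bullet> pgrad x \<le> (y - x) \<bullet> (pgrad y - pgrad x)"
      using pgrad_lower[OF y0, of x] pgrad_eq[OF y0] by (simp add: inner_diff_left inner_diff_right)
    also have "\<dots> \<le> norm (y - x) * norm (pgrad y - pgrad x)" by (rule norm_cauchy_schwarz)
    also have "\<dots> < norm (y - x) * e" using y d(2)[of y] by (intro mult_strict_left_mono) (auto simp: dist_norm)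
    finally show "norm (p y - p x - (y - x) \<bullet> pgrad x) / norm (y - x) < e"
      using lo y by (simp add: field_simps)
  qed
qed

text \<open>Degree 1 makes the norm of the image equal to the gauge. An injective Gauss map then
  yields a bijection of \<open>K - {0}\<close> onto the punctured ball, and a surface integral
  becomes a change of variables in the full dimension.\<close>

definition spheremap :: "real^'n \<Rightarrow> real^'n" where "spheremap x = p x *\<^sub>R \<nu> (foot x)"

lemma spheremap_scale: "0 < s \<Longrightarrow> spheremap (s *\<^sub>R x) = s *\<^sub>R spheremap x"
  by (simp add: spheremap_def minkowski_scale foot_scale)

text \<open>\<open>v\<close> is split into a multiple of \<open>x\<close> and a remainder orthogonal
  to \<open>u\<close>. Homogeneity sends the radial direction \<open>x\<close> to \<open>u\<close>;
  the tangential remainder goes through the differential of the Gauss map, which is determined on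
  tangent vectors only.\<close>

definition dspheremap :: "real^'n \<Rightarrow> real^'n \<Rightarrow> real^'n" where
  "dspheremap x v = (let D = frechet_derivative \<nu> (at x within frontier K); u = \<nu> x in
     ((v \<bullet> u) / (x \<bullet> u)) *\<^sub>R u + D (v - ((v \<bullet> u) / (x \<bullet> u)) *\<^sub>R x))"

lemma spheremap_has_derivative:
  assumes x: "x \<in> frontier K"
  shows "(spheremap has_derivative dspheremap x) (at x)"
proof -
  have x0: "x \<noteq> 0" using x by (rule frontier_nonzero)
  let ?D = "frechet_derivative \<nu> (at x within frontier K)"
  have px: "p x = 1" using x by (simp add: frontier_iff)
  have fx: "foot x = x" using x by (rule foot_fix)
  note dp = minkowski_has_derivative[OF x0]
  have dD: "(\<nu> has_derivative ?D) (at x within frontier K)"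
    using normal_differentiable[OF x] by (simp add: frechet_derivative_works)
  have dfoot: "(foot has_derivative (\<lambda>v. v - (v \<bullet> pgrad x) *\<^sub>R x)) (at x within - {0})"
  proof -
    have "((\<lambda>y. inverse (p y) *\<^sub>R y) has_derivative (\<lambda>v. inverse (p x) *\<^sub>R v + (- (inverse (p x) * (v \<bullet> pgrad x) * inverse (p x))) *\<^sub>R x)) (at x within - {0})"
      using px by (intro has_derivative_scaleR Deriv.has_derivative_inverse has_derivative_ident has_derivative_at_withinI[OF dp]) simp
    thus ?thesis by (simp add: px foot_def[abs_def])
  qed
  \<comment> \<open>The Gauss map is differentiable only within \<open>frontier K\<close>;
    composition with \<open>foot\<close>, which maps all nonzero points there, gives a derivative in
    the full space.\<close>
  have "((\<lambda>y. \<nu> (foot y)) has_derivative (\<lambda>v. ?D (v - (v \<bullet> pgrad x) *\<^sub>R x))) (at x within - {0})"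
  proof (rule has_derivative_in_compose[OF dfoot])
    have "foot ` (- {0}) \<subseteq> frontier K" using foot_frontier by auto
    thus "(\<nu> has_derivative ?D) (at (foot x) within foot ` (- {0}))"
      unfolding fx by (rule has_derivative_subset[OF dD])
  qed
  hence "((\<lambda>y. p y *\<^sub>R \<nu> (foot y)) has_derivative
      (\<lambda>v. p x *\<^sub>R ?D (v - (v \<bullet> pgrad x) *\<^sub>R x) + (v \<bullet> pgrad x) *\<^sub>R \<nu> (foot x))) (at x within - {0})"
    by (intro has_derivative_scaleR has_derivative_at_withinI[OF dp])
  moreover have "at x within - {0} = at x" using x0 by (intro at_within_open) auto
  moreover have "(\<lambda>v. p x *\<^sub>R ?D (v - (v \<bullet> pgrad x) *\<^sub>R x) + (v \<bullet> pgrad x) *\<^sub>R \<nu> (foot x)) = dspheremap x"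
    unfolding dspheremap_def Let_def px fx pgrad_def
    by (auto simp: fun_eq_iff divide_inverse mult.commute add.commute)
  ultimately show ?thesis unfolding spheremap_def[abs_def] by simp
qed

text \<open>By homogeneity of degree 1 the derivative is constant along rays.\<close>

lemma spheremap_has_derivative':
  assumes x: "x \<noteq> 0"
  shows "(spheremap has_derivative dspheremap (foot x)) (at x)"
proof -
  let ?s = "p x"
  have s: "0 < ?s" using x by (rule minkowski_pos)
  have sf: "x /\<^sub>R ?s = foot x" by (simp add: foot_def)
  have "((\<lambda>y. y /\<^sub>R ?s) has_derivative (\<lambda>v. v /\<^sub>R ?s)) (at x)" by (auto intro!: derivative_eq_intros)
  moreover have "(spheremap has_derivative dspheremap (foot x)) (at (x /\<^sub>R ?s))"
    unfolding sf by (rule spheremap_has_derivative[OF foot_frontier[OF x]])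
  ultimately have "((\<lambda>y. spheremap (y /\<^sub>R ?s)) has_derivative (\<lambda>v. dspheremap (foot x) (v /\<^sub>R ?s))) (at x)"
    by (rule has_derivative_compose)
  hence "((\<lambda>y. ?s *\<^sub>R spheremap (y /\<^sub>R ?s)) has_derivative (\<lambda>v. ?s *\<^sub>R dspheremap (foot x) (v /\<^sub>R ?s))) (at x)"
    by (rule has_derivative_scaleR_right)
  moreover have "?s *\<^sub>R spheremap (y /\<^sub>R ?s) = spheremap y" for y
    using spheremap_scale[of "inverse ?s" y] s by simp
  moreover have "?s *\<^sub>R dspheremap (foot x) (v /\<^sub>R ?s) = dspheremap (foot x) v" for v
    using s linear_scale[OF has_derivative_linear[OF spheremap_has_derivative[OF foot_frontier[OF x]]], of "inverse ?s" v] by simp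
  ultimately show ?thesis by simp
qed

text \<open>\<open>dspheremap x\<close> is the endomorphism \<open>N\<close> that defines the
  curvature, preceded by the rank-one perturbation of the identity that fixes the tangent space and
  takes \<open>x\<close> to \<open>u\<close>. The determinant of the latter is
  \<open>1 / (x \<bullet> u)\<close>.\<close>

lemma det_dspheremap:
  assumes x: "x \<in> frontier K"
  shows "det (matrix (dspheremap x)) = gauss_curvature K x / (x \<bullet> \<nu> x)"
proof -
  define u where "u = \<nu> x" define D where "D = frechet_derivative \<nu> (at x within frontier K)"
  define c where "c = x \<bullet> u"
  have c: "0 < c" unfolding c_def u_def by (rule inner_normal_pos[OF x])
  have uu: "u \<bullet> u = 1" using normal(1)[OF x] by (simp add: u_def power2_norm_eq_inner[symmetric])
  have "(\<nu> has_derivative D) (at x within frontier K)"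
    using normal_differentiable[OF x] unfolding D_def by (simp add: frechet_derivative_works)
  hence lD: "linear D" by (rule has_derivative_linear)
  define N where "N v = D (v - (v \<bullet> u) *\<^sub>R u) + (v \<bullet> u) *\<^sub>R u" for v
  have lN: "linear N"
    by (rule linearI) (simp_all add: N_def inner_add_left linear_add[OF lD, symmetric] linear_scale[OF lD, symmetric] algebra_simps scaleR_add_left)
  define a where "a = (u - x) /\<^sub>R c"
  have lR: "linear (\<lambda>v. v + (v \<bullet> u) *\<^sub>R a)" by (rule linearI) (simp_all add: algebra_simps inner_add_left scaleR_add_left)
  have au: "a \<bullet> u = (1 - c) / c" by (simp add: a_def inner_diff_left uu c_def divide_inverse mult.commute)
  have "dspheremap x v = N (v + (v \<bullet> u) *\<^sub>R a)" for v
  proof -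
    have 1: "(v + (v \<bullet> u) *\<^sub>R a) \<bullet> u = (v \<bullet> u) / c"
      using c by (simp add: inner_add_left au field_simps)
    have 2: "v + (v \<bullet> u) *\<^sub>R a - ((v \<bullet> u) / c) *\<^sub>R u = v - ((v \<bullet> u) / c) *\<^sub>R x"
      by (simp add: a_def algebra_simps divide_inverse)
    show ?thesis unfolding N_def 1 2 by (simp add: dspheremap_def Let_def u_def D_def c_def add.commute)
  qed
  hence "dspheremap x = (\<lambda>v. N (v + (v \<bullet> u) *\<^sub>R a))" by blast
  hence "det (matrix (dspheremap x)) = det (matrix N) * (1 + (1 - c) / c)"
    by (simp add: det_matrix_compose[OF lN lR] det_rank_one au)
  also have "1 + (1 - c) / c = 1 / c" using c by (simp add: field_simps)
  also have "det (matrix N) = gauss_curvature K x"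
    by (simp add: gauss_curvature_def Let_def N_def[abs_def] u_def D_def)
  finally show ?thesis by (simp add: c_def u_def)
qed

end

section \<open>Change of variables over an arbitrary finite index type\<close>

text \<open>The change of variables theorem of the library requires a wellordered index type. The type
  \<open>'n idx\<close> is a wellordered copy of an arbitrary finite type \<open>'n\<close>.\<close>

typedef (overloaded) 'n idx = "{..<CARD('n::finite)}"
  by (rule exI[of _ 0]) (simp add: finite_UNIV_card_ge_0)

instance idx :: (finite) finite
proof
  have "UNIV = (Abs_idx :: nat \<Rightarrow> 'a idx) ` {..<CARD('a)}"
    by (rule type_definition.Abs_image[OF type_definition_idx, symmetric])
  thus "finite (UNIV :: 'a idx set)" by (rule ssubst) simp
qed

instantiation idx :: (finite) wellorder
begin

definition less_eq_idx :: "'a idx \<Rightarrow> 'a idx \<Rightarrow> bool" where "less_eq_idx x y \<longleftrightarrow> Rep_idx x \<le> Rep_idx y"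
definition less_idx :: "'a idx \<Rightarrow> 'a idx \<Rightarrow> bool" where "less_idx x y \<longleftrightarrow> Rep_idx x < Rep_idx y"

instance
proof
  fix P :: "'a idx \<Rightarrow> bool" and a
  assume step: "\<And>x. (\<And>y. y < x \<Longrightarrow> P y) \<Longrightarrow> P x"
  show "P a"
    by (induction "Rep_idx a" arbitrary: a rule: less_induct) (rule step, auto simp: less_idx_def)
qed (auto simp: less_eq_idx_def less_idx_def Rep_idx_inject)

end

lemma idx_bij_exists: "\<exists>e :: 'n::finite idx \<Rightarrow> 'n. bij e"
proof -
  have "bij_betw (Abs_idx :: nat \<Rightarrow> 'n idx) {..<CARD('n)} UNIV"
    by (rule bij_betw_byWitness[where f'=Rep_idx]) (use Rep_idx in \<open>auto simp: Abs_idx_inverse Rep_idx_inverse\<close>)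
  hence "card (UNIV :: 'n idx set) = CARD('n)" using bij_betw_same_card by fastforce
  thus ?thesis using finite_same_card_bij[of "UNIV :: 'n idx set" "UNIV :: 'n set"] by auto
qed

text \<open>Conjugation by \<open>e\<close> is a sign-preserving bijection between the permutations
  of the two index types, and it only reorders the factors of each term.\<close>

lemma det_reindex:
  fixes A :: "'a::comm_ring_1^'n^'n" and e :: "'m::finite \<Rightarrow> 'n"
  assumes e: "bij e"
  shows "det (\<chi> i j. A $ e i $ e j) = det A"
proof -
  let ?M = "map_permutation (UNIV :: 'm set) e"
  have b: "bij_betw e UNIV UNIV" and b': "bij_betw (inv e) UNIV UNIV" using e bij_imp_bij_inv by auto
  have bM: "bij_betw ?M {p. p permutes UNIV} {p. p permutes UNIV}"
  proof (rule bij_betw_byWitness[where f'="map_permutation UNIV (inv e)"])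
    show "\<forall>p\<in>{p. p permutes UNIV}. map_permutation UNIV (inv e) (?M p) = p"
      using map_permutation_compose_inv[OF b] e by (simp add: bij_is_inj)
    show "\<forall>p\<in>{p. p permutes UNIV}. ?M (map_permutation UNIV (inv e) p) = p"
      using map_permutation_compose_inv[OF b'] e by (simp add: bij_is_surj surj_f_inv_f)
    show "?M ` {p. p permutes UNIV} \<subseteq> {p. p permutes UNIV}"
      using map_permutation_permutes[OF b] by auto
    show "map_permutation UNIV (inv e) ` {p. p permutes UNIV} \<subseteq> {p. p permutes UNIV}"
      using map_permutation_permutes[OF b'] by auto
  qed
  have "det A = (\<Sum>p | p permutes (UNIV :: 'm set). of_int (sign (?M p)) * (\<Prod>i\<in>UNIV. A $ i $ ?M p i))"
    unfolding det_def by (rule sum.reindex_bij_betw[OF bM, symmetric])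
  also have "\<dots> = (\<Sum>p | p permutes (UNIV :: 'm set). of_int (sign p) * (\<Prod>i\<in>UNIV. A $ e i $ e (p i)))"
  proof (intro sum.cong refl)
    fix p assume "p \<in> {p. p permutes (UNIV :: 'm set)}"
    hence p: "p permutes UNIV" by simp
    have s: "sign (?M p) = sign p" using p e by (intro sign_map_permutation) (auto simp: bij_is_inj)
    have "(\<Prod>i\<in>UNIV. A $ i $ ?M p i) = (\<Prod>i\<in>UNIV. A $ e i $ ?M p (e i))"
      by (rule prod.reindex_bij_betw[OF b, symmetric])
    also have "\<dots> = (\<Prod>i\<in>UNIV. A $ e i $ e (p i))"
      using map_permutation_apply[of e UNIV] e by (intro prod.cong) (auto simp: bij_is_inj)
    finally show "of_int (sign (?M p)) * (\<Prod>i\<in>UNIV. A $ i $ ?M p i) = of_int (sign p) * (\<Prod>i\<in>UNIV. A $ e i $ e (p i))"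
      by (simp add: s)
  qed
  also have "\<dots> = det (\<chi> i j. A $ e i $ e j)" by (simp add: det_def)
  finally show ?thesis by simp
qed

section \<open>Relabelling of coordinates\<close>

definition reindex :: "('m::finite \<Rightarrow> 'n::finite) \<Rightarrow> real^'n \<Rightarrow> real^'m" where
  "reindex e x = (\<chi> i. x $ e i)"

lemma reindex_nth [simp]: "reindex e x $ i = x $ e i" by (simp add: reindex_def)

lemma linear_reindex: "linear (reindex e)"
  by (rule linearI) (simp_all add: vec_eq_iff)

lemma reindex_inv: "bij e \<Longrightarrow> reindex (inv e) (reindex e x) = x" "bij e \<Longrightarrow> reindex e (reindex (inv e) y) = y"
  by (simp_all add: vec_eq_iff bij_is_surj surj_f_inv_f bij_is_inj inv_f_f)

lemma reindex_cbox:
  assumes e: "bij e"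
  shows "reindex e ` cbox a b = cbox (reindex e a) (reindex e b)"
proof -
  have "y \<in> reindex e ` cbox a b" if "y \<in> cbox (reindex e a) (reindex e b)" for y
  proof (rule image_eqI)
    show "y = reindex e (reindex (inv e) y)" using reindex_inv(2)[OF e] by simp
    have "a $ e (inv e i) \<le> y $ inv e i \<and> y $ inv e i \<le> b $ e (inv e i)" for i
      using that by (auto simp: mem_box_cart)
    thus "reindex (inv e) y \<in> cbox a b" using e by (simp add: mem_box_cart bij_is_surj surj_f_inv_f)
  qed
  thus ?thesis by (auto simp: mem_box_cart)
qed

lemma content_reindex:
  fixes e :: "'m::finite \<Rightarrow> 'n::finite"
  assumes e: "bij e"
  shows "measure lborel (reindex e ` cbox a b) = measure lborel (cbox a b)"
proof -
  have b: "bij_betw e UNIV UNIV" using e .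
  have ne: "cbox a b = {} \<longleftrightarrow> cbox (reindex e a) (reindex e b) = {}"
    using reindex_cbox[OF e, of a b] by auto
  show ?thesis
    unfolding reindex_cbox[OF e] content_cbox_if_cart using ne prod.reindex_bij_betw[OF b, of "\<lambda>k. b $ k - a $ k"] by simp
qed

text \<open>Relabelling maps boxes to boxes of the same content, so the factor in
  \<open>has_integral_twiddle\<close> is 1. Boundedness of \<open>S\<close> supplies a box that
  contains it.\<close>

lemma has_integral_reindex:
  fixes f :: "real^'n \<Rightarrow> real" and e :: "'m::finite \<Rightarrow> 'n::finite"
  assumes e: "bij e" and S: "bounded S" and f: "(f has_integral i) S"
  shows "((\<lambda>y. f (reindex (inv e) y)) has_integral i) (reindex e ` S)"
proof -
  obtain a where a: "S \<subseteq> cbox (-a) a" using bounded_subset_cbox_symmetric[OF S] by blast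
  have e': "bij (inv e)" using e by (rule bij_imp_bij_inv)
  let ?F = "\<lambda>x. if x \<in> S then f x else 0"
  have "(?F has_integral i) (cbox (-a) a)" using f a by (simp add: has_integral_restrict)
  hence "((\<lambda>y. ?F (reindex (inv e) y)) has_integral (1 / 1) *\<^sub>R i) (reindex e ` cbox (-a) a)"
    using content_reindex[OF e'] reindex_cbox[OF e] reindex_cbox[OF e'] reindex_inv[OF e]
    by (intro has_integral_twiddle linear_continuous_at linear_conv_bounded_linear[THEN iffD1] linear_reindex) auto
  moreover have "?F (reindex (inv e) y) = (if y \<in> reindex e ` S then f (reindex (inv e) y) else 0)" for y
    using reindex_inv[OF e] by (metis (mono_tags, lifting) image_iff)
  ultimately have "((\<lambda>y. if y \<in> reindex e ` S then f (reindex (inv e) y) else 0) has_integral i) (reindex e ` cbox (-a) a)" by simp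
  thus ?thesis using a by (subst (asm) has_integral_restrict) auto
qed

lemma change_of_variables_wellorder:
  fixes f :: "real^'m::{finite,wellorder} \<Rightarrow> real" and g :: "real^'m::_ \<Rightarrow> real^'m::_"
  assumes S: "S \<in> sets lebesgue"
    and der: "\<And>x. x \<in> S \<Longrightarrow> (g has_derivative g' x) (at x within S)"
    and inj: "inj_on g S" and f0: "\<And>x. 0 \<le> f x"
    and int: "((\<lambda>x. \<bar>det (matrix (g' x))\<bar> * f (g x)) has_integral b) S"
  shows "(f has_integral b) (g ` S)"
proof -
  \<comment> \<open>The theorem applied here has vector-valued integrands, so \<open>f\<close> is
    read as a function into \<open>real^1\<close>; nonnegativity turns integrability into absolute
    integrability.\<close>
  let ?l = "vec :: real \<Rightarrow> real^1"
  have 1: "(\<lambda>x. \<bar>det (matrix (g' x))\<bar> * f (g x)) absolutely_integrable_on S"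
    using int f0 by (intro nonnegative_absolutely_integrable_1) (auto simp: has_integral_integrable)
  have e: "(\<lambda>x. \<bar>det (matrix (g' x))\<bar> *\<^sub>R ?l (f (g x))) = (\<lambda>x. ?l (\<bar>det (matrix (g' x))\<bar> * f (g x)))"
    by (auto simp: vec_eq_iff fun_eq_iff)
  have "(\<lambda>x. \<bar>det (matrix (g' x))\<bar> *\<^sub>R ?l (f (g x))) absolutely_integrable_on S \<and>
       integral S (\<lambda>x. \<bar>det (matrix (g' x))\<bar> *\<^sub>R ?l (f (g x))) = ?l b"
    unfolding e using 1 int by (simp add: absolutely_integrable_on_1_iff integral_on_1_eq integral_unique o_def)
  hence "(\<lambda>x. ?l (f x)) absolutely_integrable_on (g ` S) \<and> integral (g ` S) (\<lambda>x. ?l (f x)) = ?l b"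
    using has_absolute_integral_change_of_variables[OF S der inj, of "\<lambda>x. ?l (f x)" "?l b"] by blast
  hence "f absolutely_integrable_on (g ` S)" "integral (g ` S) f = b"
    by (simp_all add: absolutely_integrable_on_1_iff integral_on_1_eq vec_eq_iff)
  thus ?thesis using absolutely_integrable_on_def has_integral_integral by blast
qed

text \<open>Conjugation of \<open>g\<close> by a relabelling onto the wellordered index type. By
  \<open>det_reindex\<close> the Jacobian does not change, and boundedness of \<open>S\<close> and
  of its image permits \<open>has_integral_reindex\<close> in both directions.\<close>

lemma change_of_variables_finite:
  fixes f :: "real^'n \<Rightarrow> real" and g :: "real^'n \<Rightarrow> real^'n"
  assumes S: "S \<in> sets borel" "bounded S" "bounded (g ` S)"
    and der: "\<And>x. x \<in> S \<Longrightarrow> (g has_derivative g' x) (at x within S)"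
    and inj: "inj_on g S" and f0: "\<And>x. 0 \<le> f x"
    and int: "((\<lambda>x. \<bar>det (matrix (g' x))\<bar> * f (g x)) has_integral b) S"
  shows "(f has_integral b) (g ` S)"
proof -
  obtain e :: "'n idx \<Rightarrow> 'n" where e: "bij e" using idx_bij_exists by blast
  have e': "bij (inv e)" using e by (rule bij_imp_bij_inv)
  let ?P = "reindex e" let ?Q = "reindex (inv e)"
  note PQ = reindex_inv[OF e]
  let ?g = "\<lambda>y. ?P (g (?Q y))" let ?g' = "\<lambda>y v. ?P (g' (?Q y) (?Q v))"
  have PS: "?P ` S = ?Q -` S" 
  proof (intro set_eqI iffI)
    fix y assume "y \<in> ?Q -` S"
    thus "y \<in> ?P ` S" using PQ(2)[of y] by (intro image_eqI[of _ _ "?Q y"]) auto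
  qed (auto simp: PQ)
  have cont: "continuous_on UNIV (reindex r)" for r :: "'c::finite \<Rightarrow> 'd::finite"
    by (intro linear_continuous_on linear_conv_bounded_linear[THEN iffD1] linear_reindex)
  have PSm: "?P ` S \<in> sets lebesgue"
  proof -
    have "?Q -` S \<in> sets borel"
      using measurable_sets_borel[OF borel_measurable_continuous_onI[OF cont] S(1)] .
    thus ?thesis unfolding PS by (simp add: sets_completionI_sets)
  qed
  have im: "?g ` (?P ` S) = ?P ` (g ` S)" by (auto simp: image_image PQ)
  have "((\<lambda>y. f (?Q y)) has_integral b) (?g ` (?P ` S))"
  proof (rule change_of_variables_wellorder[OF PSm, where g'="?g'"])
    fix y assume "y \<in> ?P ` S"
    hence y: "?Q y \<in> S" by (auto simp: PQ)
    have Qd: "(?Q has_derivative ?Q) (at y within ?P ` S)"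
      by (intro bounded_linear_imp_has_derivative linear_conv_bounded_linear[THEN iffD1] linear_reindex)
    have gd: "(g has_derivative g' (?Q y)) (at (?Q y) within ?Q ` (?P ` S))"
      using der[OF y] by (simp add: image_image PQ)
    have "((\<lambda>y. g (?Q y)) has_derivative (\<lambda>v. g' (?Q y) (?Q v))) (at y within ?P ` S)"
      by (rule has_derivative_in_compose[OF Qd gd])
    thus "(?g has_derivative ?g' y) (at y within ?P ` S)"
      by (intro bounded_linear.has_derivative[of ?P] linear_conv_bounded_linear[THEN iffD1] linear_reindex)
  next
    show "inj_on ?g (?P ` S)"
    proof (rule inj_onI)
      fix x y assume xy: "x \<in> ?P ` S" "y \<in> ?P ` S" "?g x = ?g y"
      have "g (?Q x) = g (?Q y)" using arg_cong[OF xy(3), of ?Q] by (simp only: PQ)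
      moreover have "?Q x \<in> S" "?Q y \<in> S" using xy by (auto simp: PQ)
      ultimately have "?Q x = ?Q y" using inj by (auto dest: inj_onD)
      from arg_cong[OF this, of ?P] show "x = y" by (simp only: PQ)
    qed
  next
    have d: "det (matrix (?g' y)) = det (matrix (g' (?Q y)))" for y
    proof -
      have Qax: "?Q (axis j 1) = axis (e j) 1" for j
        using e by (auto simp: vec_eq_iff axis_def bij_is_surj surj_f_inv_f bij_is_inj inv_f_f)
      have "matrix (?g' y) = (\<chi> i j. matrix (g' (?Q y)) $ e i $ e j)"
        unfolding matrix_def Qax by (simp add: vec_eq_iff)
      thus ?thesis using det_reindex[OF e] by simp
    qed
    show "((\<lambda>y. \<bar>det (matrix (?g' y))\<bar> * f (?Q (?g y))) has_integral b) (?P ` S)"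
      using has_integral_reindex[OF e S(2) int] by (simp add: d PQ)
  qed (rule f0)
  hence "((\<lambda>y. f (?Q y)) has_integral b) (?P ` (g ` S))" by (simp only: im)
  moreover have "bounded (?P ` (g ` S))"
    by (intro bounded_linear_image S(3) linear_conv_bounded_linear[THEN iffD1] linear_reindex)
  ultimately have "((\<lambda>x. f (?Q (reindex (inv (inv e)) x))) has_integral b) (?Q ` (?P ` (g ` S)))"
    by (intro has_integral_reindex[OF e'])
  thus ?thesis using e by (simp add: inv_inv_eq PQ image_image)
qed

section \<open>Smooth bodies of positive curvature\<close>

text \<open>Otherwise \<open>g\<close> would take both signs near \<open>x\<close> in the open half space \<open>{y. y \<bullet> u > x \<bullet> u}\<close>, which contains no
  point of \<open>K\<close>.\<close>

lemma support_normal_parallel_gradient: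
  fixes K :: "(real^'n) set"
  assumes U: "open U" "x \<in> U" and G: "\<And>y. y \<in> U \<Longrightarrow> (g has_derivative (\<lambda>v. G y \<bullet> v)) (at y)" "G x \<noteq> 0"
    and M: "frontier K \<inter> U = {y \<in> U. g y = 0}" and K: "closed K" and x: "x \<in> frontier K"
    and u: "norm u = 1" "\<And>y. y \<in> K \<Longrightarrow> y \<bullet> u \<le> x \<bullet> u"
  shows "u = G x /\<^sub>R norm (G x) \<or> u = - (G x /\<^sub>R norm (G x))"
proof (rule ccontr)
  assume neg: "\<not> ?thesis"
  define a where "a = G x /\<^sub>R norm (G x)"
  have a1: "norm a = 1" using G(2) by (simp add: a_def)
  have Ga: "G x = norm (G x) *\<^sub>R a" using G(2) by (simp add: a_def)
  have uu: "u \<bullet> u = 1" "a \<bullet> a = 1" using u(1) a1 by (simp_all add: power2_norm_eq_inner[symmetric])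
  have "0 < (u - a) \<bullet> (u - a)" "0 < (u + a) \<bullet> (u + a)"
    using neg unfolding a_def[symmetric] by (auto simp: add_eq_0_iff2)
  hence ua: "u \<bullet> a < 1" "-1 < u \<bullet> a"
    by (simp_all add: inner_diff_left inner_diff_right inner_add_left inner_add_right uu inner_commute[of a u])
  \<comment> \<open>Both directions have positive inner product with \<open>u\<close>, but
    \<open>g\<close> increases along \<open>w1\<close> and decreases along
    \<open>w2\<close>.\<close>
  define w1 where "w1 = u + a" define w2 where "w2 = u - a"
  have w: "0 < w1 \<bullet> u" "0 < w2 \<bullet> u" "0 < G x \<bullet> w1" "G x \<bullet> w2 < 0"
  proof -
    show "0 < w1 \<bullet> u" "0 < w2 \<bullet> u" using ua by (simp_all add: w1_def w2_def inner_add_left inner_diff_left uu inner_commute[of a u])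
    have "a \<bullet> w1 > 0" "a \<bullet> w2 < 0" using ua by (simp_all add: w1_def w2_def inner_add_right inner_diff_right uu inner_commute[of a u])
    moreover have "G x \<bullet> w = norm (G x) * (a \<bullet> w)" for w by (subst Ga) simp
    ultimately show "0 < G x \<bullet> w1" "G x \<bullet> w2 < 0" using G(2) by (simp_all add: mult_pos_neg)
  qed
  have gx: "g x = 0" using M x U by auto
  have dir: "((\<lambda>t. g (x + t *\<^sub>R w)) has_real_derivative (G x \<bullet> w)) (at 0)" for w
  proof -
    have "((\<lambda>t. x + t *\<^sub>R w) has_derivative (\<lambda>t. t *\<^sub>R w)) (at 0)" by (auto intro!: derivative_eq_intros)
    moreover have "(g has_derivative (\<lambda>v. G x \<bullet> v)) (at (x + 0 *\<^sub>R w))" using G(1) U by simp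
    ultimately have "((\<lambda>t. g (x + t *\<^sub>R w)) has_derivative (\<lambda>t. G x \<bullet> (t *\<^sub>R w))) (at 0)"
      by (rule has_derivative_compose)
    moreover have "(\<lambda>t. G x \<bullet> (t *\<^sub>R w)) = (*) (G x \<bullet> w)" by (auto simp: fun_eq_iff)
    ultimately show ?thesis by (simp only: has_field_derivative_def)
  qed
  obtain d1 where d1: "0 < d1" "\<And>t. 0 < t \<Longrightarrow> t < d1 \<Longrightarrow> 0 < g (x + t *\<^sub>R w1)"
    using DERIV_pos_inc_right[OF dir w(3)] gx by auto
  obtain d2 where d2: "0 < d2" "\<And>t. 0 < t \<Longrightarrow> t < d2 \<Longrightarrow> g (x + t *\<^sub>R w2) < 0"
    using DERIV_neg_dec_right[OF dir w(4)] gx by auto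
  obtain e where e: "0 < e" "ball x e \<subseteq> U" using U openE by blast
  \<comment> \<open>All directions on the segment from \<open>w2\<close> to \<open>w1\<close> have
    norm at most 2, so \<open>2 * t < e\<close> keeps the whole segment \<open>c\<close> inside
    \<open>U\<close>.\<close>
  define t where "t = min (min (d1 / 2) (d2 / 2)) (e / 3)"
  have t: "0 < t" "t < d1" "t < d2" "2 * t < e" using d1 d2 e by (auto simp: t_def min_def)
  define c where "c l = x + t *\<^sub>R (w2 + l *\<^sub>R (w1 - w2))" for l :: real
  have cU: "c l \<in> U" if l: "0 \<le> l" "l \<le> 1" for l
  proof -
    have "w2 + l *\<^sub>R (w1 - w2) = u + (2 * l - 1) *\<^sub>R a"
    proof -
      have "w1 - w2 = 2 *\<^sub>R a" by (simp add: w1_def w2_def scaleR_2)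
      thus ?thesis by (simp add: w2_def scaleR_diff_left mult.commute)
    qed
    hence "norm (w2 + l *\<^sub>R (w1 - w2)) \<le> norm u + norm ((2 * l - 1) *\<^sub>R a)" by (metis norm_triangle_ineq)
    also have "\<dots> \<le> 2" using l u(1) a1 by simp
    finally have "t * norm (w2 + l *\<^sub>R (w1 - w2)) \<le> t * 2" using t by (intro mult_left_mono) auto
    hence "t * norm (w2 + l *\<^sub>R (w1 - w2)) < e" using t by linarith
    hence "c l \<in> ball x e" using t by (simp add: c_def dist_norm)
    thus ?thesis using e by blast
  qed
  have "continuous_on {0..1} (\<lambda>l. g (c l))"
  proof (rule continuous_on_compose2[of U g])
    show "continuous_on U g" using G(1) has_derivative_continuous by (blast intro: continuous_at_imp_continuous_on)
    show "continuous_on {0..1} c" unfolding c_def by (intro continuous_intros)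
  qed (use cU in auto)
  moreover have "g (c 0) \<le> 0" "0 \<le> g (c 1)"
    using d1(2)[of t] d2(2)[of t] t by (auto simp: c_def)
  ultimately obtain l where l: "0 \<le> l" "l \<le> 1" "g (c l) = 0" using IVT'[of "\<lambda>l. g (c l)" 0 0 1] by auto
  hence "c l \<in> frontier K" using M cU by blast
  hence "c l \<in> K" using K frontier_subset_closed by blast
  hence "c l \<bullet> u \<le> x \<bullet> u" by (rule u(2))
  moreover have "(w2 + l *\<^sub>R (w1 - w2)) \<bullet> u > 0"
  proof -
    have "(w2 + l *\<^sub>R (w1 - w2)) \<bullet> u = (1 - l) * (w2 \<bullet> u) + l * (w1 \<bullet> u)"
      by (simp add: inner_add_left inner_diff_left algebra_simps)
    thus ?thesis using l w by (cases "l = 0") (auto intro!: add_nonneg_pos mult_nonneg_nonneg mult_pos_pos)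
  qed
  ultimately show False using t by (simp add: c_def inner_add_left mult_le_0_iff)
qed

context convex_body
begin

lemma support_normal_exists:
  assumes x: "x \<in> frontier K"
  shows "\<exists>u. norm u = 1 \<and> (\<forall>y\<in>K. y \<bullet> u \<le> x \<bullet> u)"
proof -
  have xK: "x \<in> K" "x \<notin> interior K" using x frontier_in by (auto simp: frontier_def)
  have "x \<notin> rel_interior K" using xK zero_interior rel_interior_nonempty_interior by blast
  then obtain a where a: "a \<noteq> 0" "\<And>y. y \<in> K \<Longrightarrow> a \<bullet> x \<le> a \<bullet> y"
    using supporting_hyperplane_rel_boundary[OF convex xK(1)] by metis
  have "y \<bullet> (- a /\<^sub>R norm a) \<le> x \<bullet> (- a /\<^sub>R norm a)" if "y \<in> K" for y
    using a(2)[OF that] a(1) by (simp add: inner_commute divide_right_mono inverse_eq_divide)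
  moreover have "norm (- a /\<^sub>R norm a) = 1" using a(1) by simp
  ultimately show ?thesis by blast
qed

lemma inner_support_normal_pos:
  assumes u: "norm u = 1" "\<And>y. y \<in> K \<Longrightarrow> y \<bullet> u \<le> x \<bullet> u"
  shows "0 < x \<bullet> u"
proof -
  have "support_fun K u \<le> x \<bullet> u" by (rule support_least) (rule u(2))
  moreover have "u \<noteq> 0" using u(1) by auto
  ultimately show ?thesis using support_pos[of u] by simp
qed

end

text \<open>Every outer unit normal is plus or minus the normalised gradient of a local defining
  function, and the sign is selected by \<open>0 < x \<bullet> u\<close>, which holds because the
  origin is interior. The sign of \<open>y \<bullet> G y\<close> is constant near \<open>x\<close>,
  so there the Gauss map agrees with a differentiable function.\<close>

lemma C2_plus_smooth_body:
  assumes "C2_plus K"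
  shows "smooth_body K"
proof -
  interpret convex_body K using assms by unfold_locales (auto simp: C2_plus_def)
  have chart: "\<exists>U g G. open U \<and> x \<in> U \<and> C2_on U g G \<and> (\<forall>y\<in>U. G y \<noteq> 0) \<and> frontier K \<inter> U = {y\<in>U. g y = 0}"
    if "x \<in> frontier K" for x
    using assms that unfolding C2_plus_def C2_hypersurface_def by blast
  have uniq: "\<exists>!u. norm u = 1 \<and> (\<forall>y\<in>K. y \<bullet> u \<le> x \<bullet> u)" if x: "x \<in> frontier K" for x
  proof (rule ex_ex1I[OF support_normal_exists[OF x]])
    fix u v assume u: "norm u = 1 \<and> (\<forall>y\<in>K. y \<bullet> u \<le> x \<bullet> u)" and v: "norm v = 1 \<and> (\<forall>y\<in>K. y \<bullet> v \<le> x \<bullet> v)"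
    obtain U g G where U: "open U" "x \<in> U" "C2_on U g G" "\<forall>y\<in>U. G y \<noteq> 0" "frontier K \<inter> U = {y\<in>U. g y = 0}"
      using chart[OF x] by blast
    have "w = G x /\<^sub>R norm (G x) \<or> w = - (G x /\<^sub>R norm (G x))" if "norm w = 1 \<and> (\<forall>y\<in>K. y \<bullet> w \<le> x \<bullet> w)" for w
      using U that by (intro support_normal_parallel_gradient[OF U(1,2) _ _ U(5) closed x]) (auto simp: C2_on_def)
    from this[OF u] this[OF v] have "u = v \<or> u = - v" by auto
    moreover have "0 < x \<bullet> u" "0 < x \<bullet> v" using u v inner_support_normal_pos by blast+
    ultimately show "u = v" by auto
  qed
  have diff: "outer_normal K differentiable (at x within frontier K)" if x: "x \<in> frontier K" for x
  proof -
    obtain U g G where U: "open U" "x \<in> U" "C2_on U g G" "\<forall>y\<in>U. G y \<noteq> 0" "frontier K \<inter> U = {y\<in>U. g y = 0}"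
      using chart[OF x] by blast
    obtain H where H: "\<And>y. y \<in> U \<Longrightarrow> (g has_derivative (\<lambda>v. G y \<bullet> v)) (at y)" "\<And>y. y \<in> U \<Longrightarrow> (G has_derivative (\<lambda>v. H y *v v)) (at y)"
      using U(3) unfolding C2_on_def by blast
    have par: "outer_normal K y = sgn (y \<bullet> G y) *\<^sub>R (G y /\<^sub>R norm (G y))" "y \<bullet> G y \<noteq> 0" if y: "y \<in> frontier K" "y \<in> U" for y
    proof -
      define u where "u = outer_normal K y"
      have u: "norm u = 1" "\<And>z. z \<in> K \<Longrightarrow> z \<bullet> u \<le> y \<bullet> u"
        using theI'[OF uniq[OF y(1)]] unfolding u_def outer_normal_def by auto
      have pos: "0 < y \<bullet> u" by (rule inner_support_normal_pos[OF u])
      have Gy: "G y \<noteq> 0" using U(4) y by blast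
      have "u = G y /\<^sub>R norm (G y) \<or> u = - (G y /\<^sub>R norm (G y))"
        by (rule support_normal_parallel_gradient[OF U(1) y(2) H(1) Gy U(5) closed y(1) u])
      thus "outer_normal K y = sgn (y \<bullet> G y) *\<^sub>R (G y /\<^sub>R norm (G y))" "y \<bullet> G y \<noteq> 0"
        using pos Gy unfolding u_def[symmetric] by (auto simp: zero_less_mult_iff mult_less_0_iff)
    qed
    define s where "s = sgn (x \<bullet> G x)"
    have "isCont (\<lambda>y. y \<bullet> G y) x" using has_derivative_continuous[OF H(2)[OF U(2)]] by (intro continuous_intros)
    hence "eventually (\<lambda>y. sgn (y \<bullet> G y) = s) (at x)"
    proof -
      assume "isCont (\<lambda>y. y \<bullet> G y) x"
      hence l: "((\<lambda>y. y \<bullet> G y) \<longlongrightarrow> x \<bullet> G x) (at x)" by (simp add: isCont_def)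
      show ?thesis
      proof (cases "0 < x \<bullet> G x")
        case True
        show ?thesis using order_tendstoD(1)[OF l True] True by (auto elim!: eventually_mono simp: s_def)
      next
        case False
        hence n: "x \<bullet> G x < 0" using par(2)[OF x U(2)] by simp
        show ?thesis using order_tendstoD(2)[OF l n] n by (auto elim!: eventually_mono simp: s_def)
      qed
    qed
    moreover have "eventually (\<lambda>y. y \<in> U) (at x)" using eventually_nhds_in_open[OF U(1,2)] by (simp add: eventually_at_filter eventually_mono)
    ultimately have "eventually (\<lambda>y. sgn (y \<bullet> G y) = s \<and> y \<in> U) (at x)" by (rule eventually_conj)
    hence ev: "eventually (\<lambda>y. s *\<^sub>R (G y /\<^sub>R norm (G y)) = outer_normal K y) (at x within frontier K)"
      unfolding eventually_at_filter by eventually_elim (use par(1) in auto)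
    have Gx: "G x \<noteq> 0" using U by blast
    have Gd: "G differentiable (at x)" using H(2)[OF U(2)] by (rule differentiableI)
    have nGd: "(\<lambda>y. norm (G y)) differentiable (at x)"
      using differentiable_chain_at[OF Gd differentiable_norm_at[OF Gx]] by (simp add: o_def)
    have "(\<lambda>y. s *\<^sub>R (inverse (norm (G y)) *\<^sub>R G y)) differentiable (at x within frontier K)"
      by (rule differentiable_at_withinI, intro differentiable_scaleR differentiable_const differentiable_inverse Gd nGd) (use Gx in simp)
    then obtain D where "((\<lambda>y. s *\<^sub>R (G y /\<^sub>R norm (G y))) has_derivative D) (at x within frontier K)"
      by (auto simp: differentiable_def)
    hence "(outer_normal K has_derivative D) (at x within frontier K)"
      by (rule has_derivative_transform_eventually[OF _ ev]) (use par(1)[OF x U(2)] x in \<open>auto simp: s_def\<close>)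
    thus ?thesis by (auto simp: differentiable_def)
  qed
  show ?thesis by unfold_locales (rule uniq diff; assumption)+
qed

text \<open>Along a segment joining two points with the same normal the Gauss map is constant, so the curvature
  vanishes there.\<close>

lemma (in smooth_body) normal_inj:
  assumes curv: "\<And>x. x \<in> frontier K \<Longrightarrow> gauss_curvature K x \<noteq> 0"
  shows "inj_on \<nu> (frontier K)"
proof (rule inj_onI, rule ccontr)
  fix x y assume x: "x \<in> frontier K" and y: "y \<in> frontier K" and eq: "\<nu> x = \<nu> y" and ne: "x \<noteq> y"
  define u where "u = \<nu> x" define w where "w = y - x"
  have hx: "h u = x \<bullet> u" "h u = y \<bullet> u" using support_normal[OF x] support_normal[OF y] eq by (simp_all add: u_def)
  have seg: "spheremap (x + t *\<^sub>R w) = u" if t: "0 \<le> t" "t \<le> 1" for t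
  proof -
    have "x + t *\<^sub>R w = (1 - t) *\<^sub>R x + t *\<^sub>R y" by (simp add: w_def algebra_simps)
    hence inK: "x + t *\<^sub>R w \<in> K" using convexD[OF convex frontier_in[OF x] frontier_in[OF y], of "1 - t" t] t by simp
    have val: "(x + t *\<^sub>R w) \<bullet> u = h u" using hx by (simp add: w_def inner_add_left inner_diff_left)
    have "u \<noteq> 0" using normal(1)[OF x] by (auto simp: u_def)
    hence "1 \<le> p (x + t *\<^sub>R w)" using inner_le_minkowski_support[of "x + t *\<^sub>R w" u] val support_pos[of u] by simp
    hence p1: "p (x + t *\<^sub>R w) = 1" using inK minkowski_le_1[of "x + t *\<^sub>R w"] by simp
    hence fr: "x + t *\<^sub>R w \<in> frontier K" by (simp add: frontier_iff)
    have "\<nu> (x + t *\<^sub>R w) = u"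
      by (rule normal_eqI[OF fr]) (use normal(1)[OF x] inner_le_support val in \<open>auto simp: u_def\<close>)
    thus ?thesis by (simp add: spheremap_def p1 foot_fix[OF fr])
  qed
  \<comment> \<open>The derivative at \<open>x\<close> in the direction \<open>w\<close> is computed
    twice, by the chain rule and from the constancy on the segment. Both are one-sided at the
    endpoint \<open>t = 0\<close>, where derivatives within an interval are still unique.\<close>
  have "((\<lambda>t. x + t *\<^sub>R w) has_derivative (\<lambda>t. t *\<^sub>R w)) (at 0 within cbox 0 1)" by (auto intro!: derivative_eq_intros)
  moreover have "(spheremap has_derivative dspheremap x) (at (x + 0 *\<^sub>R w))" using spheremap_has_derivative[OF x] by simp
  ultimately have "((\<lambda>t. spheremap (x + t *\<^sub>R w)) has_derivative (\<lambda>t. dspheremap x (t *\<^sub>R w))) (at 0 within cbox 0 1)"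
    by (rule has_derivative_compose)
  moreover have lin: "linear (dspheremap x)" using spheremap_has_derivative[OF x] by (rule has_derivative_linear)
  ultimately have 1: "((\<lambda>t. spheremap (x + t *\<^sub>R w)) has_vector_derivative dspheremap x w) (at 0 within cbox 0 1)"
    by (simp add: has_vector_derivative_def linear_scale)
  have "((\<lambda>t. u) has_vector_derivative 0) (at (0::real) within cbox 0 1)" by simp
  hence 2: "((\<lambda>t. spheremap (x + t *\<^sub>R w)) has_vector_derivative 0) (at 0 within cbox 0 1)"
    by (rule has_vector_derivative_transform[rotated 2]) (use seg in auto)
  have "dspheremap x w = 0"
    by (rule vector_derivative_unique_within_closed_interval[OF _ _ 1 2]) auto
  hence 0: "matrix (dspheremap x) *v w = 0"
    using matrix_works[of "dspheremap x" w] lin by (simp add: linear_matrix_vector_mul_eq)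
  have "det (matrix (dspheremap x)) \<noteq> 0" using det_dspheremap[OF x] curv[OF x] inner_normal_pos[OF x] by simp
  then obtain B where "B ** matrix (dspheremap x) = mat 1" using invertible_det_nz invertible_def by metis
  hence "w = B *v (matrix (dspheremap x) *v w)" by (simp add: matrix_vector_mul_assoc)
  thus False using 0 ne by (simp add: w_def)
qed

lemma (in smooth_body) curvature_fun_normal:
  assumes inj: "inj_on \<nu> (frontier K)" and x: "x \<in> frontier K"
  shows "curvature_fun K (\<nu> x) = 1 / gauss_curvature K x"
proof -
  have "(THE y. y \<in> frontier K \<and> \<nu> y = \<nu> x) = x"
    using inj x by (intro the_equality) (auto dest: inj_onD)
  thus ?thesis by (simp add: curvature_fun_def)
qed

lemma (in smooth_body) normal_surj:
  assumes u: "norm u = 1"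
  obtains x where "x \<in> frontier K" "\<nu> x = u"
proof -
  have u0: "u \<noteq> 0" using u by auto
  obtain x where x: "x \<in> K" "x \<bullet> u = h u" using support_attained by blast
  have "1 \<le> p x" using inner_le_minkowski_support[of x u] x support_pos[OF u0] by simp
  hence fr: "x \<in> frontier K" using x(1) minkowski_le_1[of x] by (simp add: frontier_iff)
  have "\<nu> x = u" by (rule normal_eqI[OF fr u]) (use inner_le_support x in auto)
  thus thesis using fr that by blast
qed

text \<open>The integrand is the reciprocal of the Jacobian of \<open>spheremap\<close>, so its
  integral over the image is the volume of the domain \<open>K - {0}\<close>. With the factor n of
  \<open>sphere_measure\<close> this says that \<open>f h\<close> has integral \<open>n |K|\<close>
  over the sphere.\<close>

lemma (in smooth_body) has_integral_curvature_support:
  assumes curv: "\<And>x. x \<in> frontier K \<Longrightarrow> 0 < gauss_curvature K x"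
  shows "((\<lambda>z. curvature_fun K (sgn z) * h (sgn z)) has_integral vol K) (cball 0 1 - {0})"
    and "norm u = 1 \<Longrightarrow> 0 < curvature_fun K u"
proof -
  have inj: "inj_on \<nu> (frontier K)" by (rule normal_inj) (use curv in force)
  note cn = curvature_fun_normal[OF inj]
  have pos: "0 < curvature_fun K u" if "norm u = 1" for u
    using normal_surj[OF that] cn curv by force
  thus "norm u = 1 \<Longrightarrow> 0 < curvature_fun K u" .
  let ?F = "\<lambda>z. curvature_fun K (sgn z) * h (sgn z)"
  have nS: "norm (spheremap x) = p x" if "x \<noteq> 0" for x
    using normal(1)[OF foot_frontier[OF that]] minkowski_pos[OF that] by (simp add: spheremap_def)
  have sS: "sgn (spheremap x) = \<nu> (foot x)" if "x \<noteq> 0" for x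
    using nS[OF that] minkowski_pos[OF that] by (simp add: sgn_div_norm spheremap_def)
  have S0: "spheremap x \<noteq> 0" if "x \<noteq> 0" for x using nS[OF that] minkowski_pos[OF that] by auto
  have img: "spheremap ` (K - {0}) = cball 0 1 - {0}"
  proof (intro set_eqI iffI)
    fix z assume "z \<in> spheremap ` (K - {0})"
    then obtain x where x: "x \<in> K" "x \<noteq> 0" "z = spheremap x" by blast
    thus "z \<in> cball 0 1 - {0}" using nS[OF x(2)] S0[OF x(2)] minkowski_le_1[of x] by (simp add: dist_norm)
  next
    fix z :: "real^'n" assume z: "z \<in> cball 0 1 - {0}"
    hence "norm (sgn z) = 1" by (simp add: norm_sgn)
    then obtain x where x: "x \<in> frontier K" "\<nu> x = sgn z" by (rule normal_surj)
    have "spheremap (norm z *\<^sub>R x) = norm z *\<^sub>R sgn z"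
      using z x spheremap_scale[of "norm z" x] by (simp add: spheremap_def foot_fix frontier_iff)
    also have "\<dots> = z" using z by (simp add: sgn_div_norm)
    finally have "z = spheremap (norm z *\<^sub>R x)" by simp
    moreover have "norm z *\<^sub>R x \<in> K - {0}"
      using z x frontier_nonzero[OF x(1)] by (auto intro: scale_in frontier_in simp: dist_norm)
    ultimately show "z \<in> spheremap ` (K - {0})" by blast
  qed
  have "(?F has_integral vol K) (spheremap ` (K - {0}))"
  proof (rule change_of_variables_finite)
    show "K - {0} \<in> sets borel" using closed by auto
    show "bounded (K - {0})" using compact_imp_bounded[OF compact] by (rule bounded_subset) auto
    show "bounded (spheremap ` (K - {0}))" unfolding img by (rule bounded_subset[OF bounded_cball[of 0 1]]) auto
    show "(spheremap has_derivative dspheremap (foot x)) (at x within K - {0})" if "x \<in> K - {0}" for x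
      using spheremap_has_derivative'[of x] that by (auto intro: has_derivative_at_withinI)
    show "inj_on spheremap (K - {0})"
    proof (rule inj_onI)
      fix x y assume xy: "x \<in> K - {0}" "y \<in> K - {0}" "spheremap x = spheremap y"
      have "p x = p y" using nS[of x] nS[of y] xy by auto
      moreover have "\<nu> (foot x) = \<nu> (foot y)" using sS[of x] sS[of y] xy by auto
      hence "foot x = foot y" using inj foot_frontier xy by (auto dest: inj_onD)
      moreover have "p x *\<^sub>R foot x = x" "p y *\<^sub>R foot y = y" using xy by (auto intro: foot_eq)
      ultimately show "x = y" by metis
    qed
    show "0 \<le> ?F z" for z
    proof (cases "z = 0")
      case True
      have "h 0 = 0" using support_least[of 0 0] support_nonneg[of 0] by auto
      thus ?thesis using True by simp
    next
      case False
      hence "norm (sgn z) = 1" by (simp add: norm_sgn)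
      thus ?thesis using pos support_nonneg by (intro mult_nonneg_nonneg) (auto intro: less_imp_le)
    qed
    have one: "((\<lambda>x. 1 :: real) has_integral vol K) (K - {0})"
    proof -
      have "((\<lambda>x. 1 :: real) has_integral vol K) K"
        using has_integral_measure_lborel[of K] closed emeasure_compact_finite[OF compact] by (simp add: vol_def)
      moreover have "negligible {x \<in> K - (K - {0}). (1::real) \<noteq> 0}" "negligible {x \<in> K - {0} - K. (1::real) \<noteq> 0}"
        by (rule negligible_subset[of "{0}"]; auto)+
      ultimately show ?thesis using has_integral_spike_set_eq[of K "K - {0}" "\<lambda>x. 1 :: real" "vol K"] by simp
    qed
    have "\<bar>det (matrix (dspheremap (foot x)))\<bar> * ?F (spheremap x) = 1" if x: "x \<in> K - {0}" for x
    proof -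
      have f: "foot x \<in> frontier K" using x by (intro foot_frontier) auto
      have "sgn (spheremap x) = \<nu> (foot x)" using sS x by auto
      hence "?F (spheremap x) = (1 / gauss_curvature K (foot x)) * (foot x \<bullet> \<nu> (foot x))"
        using cn[OF f] support_normal[OF f] by simp
      thus ?thesis using det_dspheremap[OF f] curv[OF f] inner_normal_pos[OF f] by simp
    qed
    thus "((\<lambda>x. \<bar>det (matrix (dspheremap (foot x)))\<bar> * ?F (spheremap x)) has_integral vol K) (K - {0})"
      using one by (subst has_integral_cong[where g="\<lambda>x. 1"]) auto
  qed
  thus "(?F has_integral vol K) (cball 0 1 - {0})" by (simp only: img)
qed

text \<open>By Fubini, after writing \<open>q\<^sup>-\<^sup>n\<close> as the integral of \<open>n s\<^sup>-\<^sup>n\<^sup>-\<^sup>1\<close> over \<open>s \<ge> q\<close> and substituting \<open>y = s z\<close>.\<close>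

lemma nn_integral_radial:
  fixes q :: "'a::euclidean_space \<Rightarrow> real"
  assumes [measurable]: "q \<in> borel_measurable borel"
    and q0: "\<And>x. x \<noteq> 0 \<Longrightarrow> 0 < q x" and qh: "\<And>s x. 0 < s \<Longrightarrow> q (s *\<^sub>R x) = s * q x"
  shows "(\<integral>\<^sup>+y. ennreal (1 / q (sgn y) ^ DIM('a)) * indicator (cball 0 1 - {0}) y \<partial>lborel) = emeasure lborel {y. q y \<le> 1}"
proof -
  let ?n = "DIM('a)"
  have n: "0 < ?n" by simp
  define k where "k s = real ?n * inverse s ^ (?n + 1)" for s :: real
  \<comment> \<open>By homogeneity the integrand is \<open>norm y ^ n\<close> over
    \<open>q y ^ n\<close>, and the density \<open>k\<close> represents the second factor. The
    substitution \<open>y = s z\<close> leads to \<open>?b\<close>, whose integral over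
    \<open>0 < s \<le> 1 / norm z\<close> is \<open>1 / norm z ^ n\<close> times the first factor,
    that is, 1.\<close>
  let ?a = "\<lambda>y s. if norm y \<le> 1 \<and> y \<noteq> 0 \<and> q y \<le> s \<and> 0 < s then ennreal (norm y ^ ?n) * ennreal (k s) else 0"
  let ?b = "\<lambda>(z::'a) s. if s * norm z \<le> 1 \<and> z \<noteq> 0 \<and> q z \<le> 1 \<and> 0 < s then ennreal (norm z ^ ?n) * ennreal (real ?n * s ^ (?n - 1)) else 0"
  have tail: "ennreal (inverse r ^ ?n) = (\<integral>\<^sup>+s. ennreal (k s) * indicator {r..} s \<partial>lborel)" if r: "0 < r" for r :: real
  proof -
    have "(\<integral>\<^sup>+s. ennreal (k s) * indicator {r..} s \<partial>lborel) = ennreal (0 - (- (inverse r ^ ?n)))"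
    proof (rule nn_integral_FTC_atLeast[where F="\<lambda>s. - (inverse s ^ ?n)"])
      show "((\<lambda>s::real. - (inverse s ^ ?n)) \<longlongrightarrow> 0) at_top"
        using tendsto_minus[OF tendsto_power[OF tendsto_inverse_0_at_top[OF filterlim_ident], of ?n]] n by (simp add: power_0_left)
      fix s assume s: "r \<le> s"
      show "((\<lambda>s. - (inverse s ^ ?n)) has_real_derivative k s) (at s)"
      proof -
        have "((\<lambda>s. - (inverse s ^ ?n)) has_real_derivative - (real ?n * inverse s ^ (?n - 1) * (- (inverse s * 1 * inverse s)))) (at s)"
          using s r by (auto intro!: derivative_eq_intros simp: mult_ac power2_eq_square)
        also have "- (real ?n * inverse s ^ (?n - 1) * (- (inverse s * 1 * inverse s))) = real ?n * (inverse s ^ (?n - 1) * (inverse s * inverse s))" by simp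
        also have "inverse s ^ (?n - 1) * (inverse s * inverse s) = inverse s ^ (?n + 1)"
        proof -
          have "?n + 1 = (?n - 1) + 2" using n by simp
          thus ?thesis by (simp only: power_add power2_eq_square)
        qed
        finally show ?thesis by (simp only: k_def)
      qed
      show "0 \<le> k s" using s r by (simp add: k_def)
    qed (simp add: k_def[abs_def])
    thus ?thesis by simp
  qed
  have head: "(\<integral>\<^sup>+s. ennreal (real ?n * s ^ (?n - 1)) * indicator {0..r} s \<partial>lborel) = ennreal (r ^ ?n)" if r: "0 < r" for r :: real
  proof -
    have "(\<integral>\<^sup>+s. ennreal (real ?n * s ^ (?n - 1)) * indicator {0..r} s \<partial>lborel) = ennreal (r ^ ?n - 0 ^ ?n)"
      by (rule nn_integral_FTC_Icc) (use r in \<open>auto intro!: derivative_eq_intros\<close>)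
    thus ?thesis using n by (simp add: power_0_left)
  qed
  have sg: "1 / q (sgn y) ^ ?n = norm y ^ ?n * inverse (q y) ^ ?n" if "y \<noteq> 0" for y
  proof -
    have "q (sgn y) = q y / norm y" using qh[of "inverse (norm y)" y] that by (simp add: sgn_div_norm field_simps)
    thus ?thesis using q0[OF that] by (simp add: power_divide power_inverse field_simps)
  qed
  have "(\<integral>\<^sup>+y. ennreal (1 / q (sgn y) ^ ?n) * indicator (cball 0 1 - {0}) y \<partial>lborel)
    = (\<integral>\<^sup>+y. (\<integral>\<^sup>+s. ?a y s \<partial>lborel) \<partial>lborel)"
  proof (rule nn_integral_cong)
    fix y :: 'a
    show "ennreal (1 / q (sgn y) ^ ?n) * indicator (cball 0 1 - {0}) y =
      (\<integral>\<^sup>+s. ?a y s \<partial>lborel)"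
    proof (cases "norm y \<le> 1 \<and> y \<noteq> 0")
      case True
      have "ennreal (1 / q (sgn y) ^ ?n) = ennreal (norm y ^ ?n) * ennreal (inverse (q y) ^ ?n)"
        using True q0[of y] by (simp add: sg ennreal_mult)
      also have "\<dots> = (\<integral>\<^sup>+s. ennreal (norm y ^ ?n) * (ennreal (k s) * indicator {q y..} s) \<partial>lborel)"
        using True by (subst tail, simp add: q0, subst nn_integral_cmult) (auto simp: k_def[abs_def])
      also have "\<dots> = (\<integral>\<^sup>+s. ?a y s \<partial>lborel)"
        using True q0[of y] by (intro nn_integral_cong) (auto simp: indicator_def)
      finally show ?thesis using True by (simp add: dist_norm)
    next
      case False
      hence "?a y = (\<lambda>s. 0)" by auto
      thus ?thesis using False by (auto simp: indicator_def dist_norm)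
    qed
  qed
  also have "\<dots> = (\<integral>\<^sup>+s. (\<integral>\<^sup>+y. ?a y s \<partial>lborel) \<partial>lborel)"
    unfolding k_def by (rule lborel_pair.Fubini') measurable
  also have "\<dots> = (\<integral>\<^sup>+s. (\<integral>\<^sup>+z. ?b z s \<partial>lborel) \<partial>lborel)"
  proof (rule nn_integral_cong)
    fix s :: real
    show "(\<integral>\<^sup>+y. ?a y s \<partial>lborel)
      = (\<integral>\<^sup>+z. ?b z s \<partial>lborel)"
    proof (cases "0 < s")
      case s: True
      have ks: "s ^ ?n * (s ^ ?n * k s) = real ?n * s ^ (?n - 1)"
      proof -
        have "s ^ ?n * s ^ ?n * inverse s ^ (?n + 1) = s ^ (?n - 1)"
        proof -
          have "?n = Suc (?n - 1)" using n by simp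
          then obtain m where m: "?n = Suc m" by blast
          show ?thesis unfolding m using s by (simp add: power_inverse field_simps)
        qed
        thus ?thesis by (simp add: k_def mult_ac)
      qed
      have "(\<integral>\<^sup>+y. ?a y s \<partial>lborel)
        = ennreal (s ^ ?n) * (\<integral>\<^sup>+z. ?a (s *\<^sub>R z) s \<partial>lborel)"
        by (rule nn_integral_lborel_scaleR[OF _ s]) measurable
      also have "\<dots> = (\<integral>\<^sup>+z. ennreal (s ^ ?n) * ?a (s *\<^sub>R z) s \<partial>lborel)"
        by (rule nn_integral_cmult[symmetric]) measurable
      also have "\<dots> = (\<integral>\<^sup>+z. ?b z s \<partial>lborel)"
      proof (rule nn_integral_cong)
        fix z :: 'a
        have "s ^ ?n * ((s * norm z) ^ ?n * k s) = norm z ^ ?n * (real ?n * s ^ (?n - 1))"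
          unfolding ks[symmetric] by (simp add: power_mult_distrib mult_ac)
        hence "ennreal (s ^ ?n) * (ennreal ((s * norm z) ^ ?n) * ennreal (k s)) = ennreal (norm z ^ ?n) * ennreal (real ?n * s ^ (?n - 1))"
          using s by (simp add: ennreal_mult[symmetric] k_def)
        thus "ennreal (s ^ ?n) * ?a (s *\<^sub>R z) s
          = ?b z s"
          using s by (simp add: qh)
      qed
      finally show ?thesis .
    qed simp
  qed
  also have "\<dots> = (\<integral>\<^sup>+z. (\<integral>\<^sup>+s. ?b z s \<partial>lborel) \<partial>lborel)"
    by (rule lborel_pair.Fubini') measurable
  also have "\<dots> = (\<integral>\<^sup>+z. indicator {z. q z \<le> 1} z \<partial>lborel)"
  proof (rule nn_integral_cong_AE)
    show "AE z in lborel. (\<integral>\<^sup>+s. ?b z s \<partial>lborel) = indicator {z. q z \<le> 1} z"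
      using AE_lborel_singleton[of "0::'a"]
    proof eventually_elim
      fix z :: 'a assume z: "z \<noteq> 0"
      show "(\<integral>\<^sup>+s. ?b z s \<partial>lborel) = indicator {z. q z \<le> 1} z"
      proof (cases "q z \<le> 1")
        case True
        have "(\<integral>\<^sup>+s. ?b z s \<partial>lborel)
          = (\<integral>\<^sup>+s. ennreal (norm z ^ ?n) * (ennreal (real ?n * s ^ (?n - 1)) * indicator {0..inverse (norm z)} s) \<partial>lborel)"
        proof (rule nn_integral_cong_AE)
          show "AE s in lborel. ?b z s
             = ennreal (norm z ^ ?n) * (ennreal (real ?n * s ^ (?n - 1)) * indicator {0..inverse (norm z)} s)"
            using AE_lborel_singleton[of "0::real"]
            by eventually_elim (use z True in \<open>auto simp: indicator_def field_simps\<close>)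
        qed
        also have "\<dots> = ennreal (norm z ^ ?n) * ennreal (inverse (norm z) ^ ?n)"
          using z by (subst nn_integral_cmult, measurable, subst head) simp_all
        also have "\<dots> = 1" using z by (simp add: ennreal_mult[symmetric] power_mult_distrib[symmetric])
        finally show ?thesis using True by simp
      qed simp
    qed
  qed
  also have "\<dots> = emeasure lborel {y. q y \<le> 1}" by (rule nn_integral_indicator) measurable
  finally show ?thesis .
qed

lemma (in convex_body) nn_integral_support_polar:
  "(\<integral>\<^sup>+y. ennreal (1 / support_fun K (sgn y) ^ CARD('n)) * indicator (cball 0 1 - {0}) y \<partial>lborel) = ennreal (vol (polar_body K))"
proof -
  interpret P: convex_body "polar_body K" by (rule polar_convex_body)
  show ?thesis using nn_integral_radial[of "support_fun K"] support_pos support_scale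
    by (simp add: P.vol_emeasure[symmetric, unfolded polar_body_eq] polar_body_eq)
qed

section \<open>Integrals over the sphere as integrals over the punctured ball\<close>

lemma sgn_measurable_sphere:
  "(\<lambda>x::real^'n. x /\<^sub>R norm x) \<in> measurable (restrict_space lborel (cball 0 1 - {0})) (restrict_space borel (sphere 0 1))"
  by (rule measurable_restrict_space2) (auto simp: space_restrict_space intro!: measurable_restrict_space1)

lemma nn_integral_sphere:
  fixes F :: "real^'n \<Rightarrow> real"
  assumes F: "F \<in> borel_measurable (restrict_space borel (sphere 0 1))"
  shows "(\<integral>\<^sup>+u. ennreal (F u) \<partial>sphere_measure) =
    of_nat CARD('n) * (\<integral>\<^sup>+y. ennreal (F (sgn y)) * indicator (cball 0 1 - {0}) y \<partial>lborel)"
proof -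
  have [measurable]: "F \<in> borel_measurable (restrict_space borel (sphere 0 1))" by fact
  have "(\<integral>\<^sup>+u. ennreal (F u) \<partial>sphere_measure) = of_nat CARD('n) *
     (\<integral>\<^sup>+u. ennreal (F u) \<partial>distr (restrict_space lborel (cball 0 1 - {0})) (restrict_space borel (sphere 0 1)) (\<lambda>x::real^'n. x /\<^sub>R norm x))"
    unfolding sphere_measure_def by (rule nn_integral_scale_measure) simp
  also have "(\<integral>\<^sup>+u. ennreal (F u) \<partial>distr (restrict_space lborel (cball 0 1 - {0})) (restrict_space borel (sphere 0 1)) (\<lambda>x::real^'n. x /\<^sub>R norm x))
    = (\<integral>\<^sup>+y. ennreal (F (y /\<^sub>R norm y)) \<partial>restrict_space lborel (cball 0 1 - {0}))"
    by (rule nn_integral_distr[OF sgn_measurable_sphere]) measurable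
  also have "\<dots> = (\<integral>\<^sup>+y. ennreal (F (sgn y)) * indicator (cball 0 1 - {0}) y \<partial>lborel)"
    by (subst nn_integral_restrict_space) (auto simp: sgn_div_norm)
  finally show ?thesis .
qed

lemma sphere_measure_space: "space sphere_measure = sphere 0 1" "sets sphere_measure = sets (restrict_space borel (sphere 0 1))"
  by (simp_all add: sphere_measure_def space_scale_measure space_restrict_space)

lemma integral_sphere_eq:
  fixes F :: "real^'n \<Rightarrow> real"
  assumes F: "F \<in> borel_measurable borel" and F0: "\<And>u. norm u = 1 \<Longrightarrow> 0 \<le> F u" and b: "0 \<le> b"
    and eq: "(\<integral>\<^sup>+y. ennreal (F (sgn y)) * indicator (cball 0 1 - {0}) y \<partial>lborel) = ennreal b"
  shows "(LINT u|sphere_measure. F u) = real CARD('n) * b"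
proof -
  have F': "F \<in> borel_measurable (restrict_space borel (sphere 0 1))" using F by (rule measurable_restrict_space1)
  have Fs: "F \<in> borel_measurable sphere_measure"
    using F' measurable_cong_sets[OF sphere_measure_space(2) refl] by blast
  have "(LINT u|sphere_measure. F u) = enn2real (\<integral>\<^sup>+u. ennreal (F u) \<partial>sphere_measure)"
    by (rule integral_eq_nn_integral[OF Fs]) (rule AE_I2, simp add: sphere_measure_space F0)
  thus ?thesis using b by (simp add: nn_integral_sphere[OF F'] eq enn2real_mult)
qed

text \<open>\<open>F\<close> need not be measurable: the Bochner integral of a function that is not integrable is \<open>0\<close>.\<close>

lemma integral_sphere_le:
  fixes F b :: "real^'n \<Rightarrow> real"
  assumes F0: "\<And>u. norm u = 1 \<Longrightarrow> 0 \<le> F u"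
    and le: "\<And>u. norm u = 1 \<Longrightarrow> F u \<le> b u"
    and b: "(\<integral>\<^sup>+y. ennreal (b (sgn y)) * indicator (cball 0 1 - {0}) y \<partial>lborel) \<le> ennreal B" and B: "0 \<le> B"
  shows "(LINT u|sphere_measure. F u) \<le> real CARD('n) * B"
proof (cases "integrable sphere_measure F")
  case True
  have eq: "measurable sphere_measure borel = measurable (restrict_space borel (sphere (0::real^'n) 1)) (borel :: real measure)"
    by (rule measurable_cong_sets[OF sphere_measure_space(2) refl])
  have F: "F \<in> borel_measurable (restrict_space borel (sphere 0 1))"
    using borel_measurable_integrable[OF True] unfolding eq .
  have "ennreal (LINT u|sphere_measure. F u) = (\<integral>\<^sup>+u. ennreal (F u) \<partial>sphere_measure)"
    by (rule nn_integral_eq_integral[OF True, symmetric]) (rule AE_I2, simp add: sphere_measure_space F0)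
  also have "\<dots> = of_nat CARD('n) * (\<integral>\<^sup>+y. ennreal (F (sgn y)) * indicator (cball 0 1 - {0}) y \<partial>lborel)"
    by (rule nn_integral_sphere[OF F])
  also have "\<dots> \<le> of_nat CARD('n) * ennreal B"
  proof (rule mult_left_mono[OF order_trans[OF nn_integral_mono b]])
    fix y :: "real^'n"
    show "ennreal (F (sgn y)) * indicator (cball 0 1 - {0}) y \<le> ennreal (b (sgn y)) * indicator (cball 0 1 - {0}) y"
      using le[of "sgn y"] by (cases "y = 0") (auto simp: indicator_def norm_sgn ennreal_leI)
  qed simp
  also have "\<dots> = ennreal (real CARD('n) * B)" using B by (simp add: ennreal_mult ennreal_of_nat_eq_real_of_nat)
  finally show ?thesis using B by simp
qed (use B in \<open>simp add: not_integrable_integral_eq\<close>)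

section \<open>Ellipsoids\<close>

lemma inner_normalized: "w \<noteq> 0 \<Longrightarrow> w \<bullet> (w /\<^sub>R norm w) = norm w"
  by (simp add: power2_norm_eq_inner[symmetric] power2_eq_square)

lemma image_cball_eq:
  fixes P Q :: "real^'n^'n"
  assumes "P ** Q = mat 1" "Q ** P = mat 1"
  shows "(\<lambda>x. P *v x) ` cball 0 1 = {x. norm (Q *v x) \<le> 1}"
proof (intro set_eqI iffI)
  fix x assume "x \<in> {x. norm (Q *v x) \<le> 1}"
  moreover have "x = P *v (Q *v x)" using assms by (simp add: matrix_vector_mul_assoc)
  ultimately show "x \<in> (\<lambda>x. P *v x) ` cball 0 1" by (intro image_eqI) auto
qed (use assms in \<open>auto simp: matrix_vector_mul_assoc\<close>)

lemma vol_image_cball: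
  fixes P Q :: "real^'n^'n"
  assumes PQ: "P ** Q = mat 1" "Q ** P = mat 1"
  shows "vol ((\<lambda>x. P *v x) ` cball 0 1) = \<bar>det P\<bar> * vol (cball (0::real^'n) 1)"
proof -
  let ?E = "(\<lambda>x. P *v x) ` cball 0 1"
  have lin: "linear (\<lambda>x. P *v x)" by (rule matrix_vector_mul_linear)
  have cE: "compact ?E" by (intro compact_continuous_image linear_continuous_on linear_conv_bounded_linear[THEN iffD1] lin compact_cball)
  have fin: "emeasure lborel (cball (0::real^'n) 1) < \<infinity>" "emeasure lborel ?E < \<infinity>"
    using emeasure_compact_finite[OF compact_cball] emeasure_compact_finite[OF cE] .
  have one: "((\<lambda>x. 1::real) has_integral vol (cball (0::real^'n) 1)) (cball (0::real^'n) 1)"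
    using has_integral_measure_lborel[of "cball (0::real^'n) 1"] fin by (simp add: vol_def)
  have "((\<lambda>x. 1::real) has_integral (\<bar>det P\<bar> * vol (cball (0::real^'n) 1))) ?E"
  proof (rule change_of_variables_finite[where g'="\<lambda>_ x. P *v x"])
    show "inj_on (\<lambda>x. P *v x) (cball 0 1)"
      by (rule inj_on_inverseI[where g="\<lambda>x. Q *v x"]) (simp add: matrix_vector_mul_assoc PQ)
    show "bounded ?E" using cE by (rule compact_imp_bounded)
    show "((\<lambda>x. P *v x) has_derivative (\<lambda>x. P *v x)) (at x within cball 0 1)" for x
      by (intro bounded_linear_imp_has_derivative linear_conv_bounded_linear[THEN iffD1] lin)
    show "((\<lambda>x. \<bar>det (matrix (\<lambda>x. P *v x))\<bar> * 1) has_integral (\<bar>det P\<bar> * vol (cball (0::real^'n) 1))) (cball (0::real^'n) 1)"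
      using has_integral_mult_right[OF one, of "\<bar>det P\<bar>"] by (simp add: matrix_of_matrix_vector_mul)
  qed auto
  moreover have "((\<lambda>x. 1::real) has_integral vol ?E) ?E"
    using has_integral_measure_lborel[of ?E] compact_imp_closed[OF cE] fin by (simp add: vol_def)
  ultimately show ?thesis by (rule has_integral_unique[symmetric])
qed

text \<open>Both the matrix and its inverse are parameters, so that \<open>B\<close> appears in
  formulas without a choice.\<close>

locale centered_ellipsoid =
  fixes A B :: "real^'n^'n"
  assumes AB: "A ** B = mat 1" and BA: "B ** A = mat 1"
begin

definition E :: "(real^'n) set" where "E = (\<lambda>x. A *v x) ` cball 0 1"

text \<open>The symmetric map of the quadratic form with unit ball \<open>E\<close>:
  \<open>M x\<close> is half the gradient of the squared norm of \<open>B *v x\<close>, hence normal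
  to \<open>E\<close> at a boundary point \<open>x\<close>.\<close>

definition M :: "real^'n \<Rightarrow> real^'n" where "M x = transpose B *v (B *v x)"

lemma A_B [simp]: "A *v (B *v x) = x" and B_A [simp]: "B *v (A *v x) = x"
  using AB BA by (simp_all add: matrix_vector_mul_assoc)

lemma E_eq: "E = {x. norm (B *v x) \<le> 1}"
  unfolding E_def by (rule image_cball_eq[OF AB BA])

lemma linear_M: "linear M"
  unfolding M_def matrix_vector_mul_assoc by (rule matrix_vector_mul_linear)

lemma M_inner: "M x \<bullet> y = (B *v x) \<bullet> (B *v y)"
  unfolding M_def by (simp add: transpose_matrix_vector dot_lmul_matrix)

lemma M_sym: "M x \<bullet> y = M y \<bullet> x"
  unfolding M_inner by (rule inner_commute)

lemma M_self: "M x \<bullet> x = (norm (B *v x))\<^sup>2"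
  by (simp add: M_inner power2_norm_eq_inner)

lemma B_nonzero: "x \<noteq> 0 \<Longrightarrow> B *v x \<noteq> 0"
  using A_B[of x] by (metis matrix_vector_mult_0_right)

lemma M_nonzero: "x \<noteq> 0 \<Longrightarrow> M x \<noteq> 0"
  using M_self[of x] B_nonzero[of x] by auto

lemma convex_body_E: "convex_body E"
proof
  have lin: "linear (\<lambda>x. A *v x)" by (rule matrix_vector_mul_linear)
  show "compact E" unfolding E_def by (intro compact_continuous_image linear_continuous_on linear_conv_bounded_linear[THEN iffD1] lin compact_cball)
  show "convex E" unfolding E_def by (intro convex_linear_image[OF lin] convex_cball)
  have "open {x. norm (B *v x) < 1}"
    by (intro open_Collect_less continuous_intros linear_continuous_on linear_conv_bounded_linear[THEN iffD1] matrix_vector_mul_linear)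
  thus "0 \<in> interior E" unfolding E_eq by (intro interiorI[of "{x. norm (B *v x) < 1}"]) auto
qed

sublocale convex_body E by (rule convex_body_E)

lemma minkowski_E: "minkowski E x = norm (B *v x)"
proof (rule minkowski_eqI)
  fix t :: real assume t: "0 < t"
  have "B *v (x /\<^sub>R t) = (B *v x) /\<^sub>R t" by (rule linear_scale[OF matrix_vector_mul_linear])
  hence "x /\<^sub>R t \<in> E \<longleftrightarrow> norm (B *v x) / t \<le> 1"
    unfolding E_eq mem_Collect_eq using t by (simp add: divide_inverse mult.commute)
  thus "minkowski E x \<le> t \<longleftrightarrow> norm (B *v x) \<le> t"
    unfolding minkowski_le_iff[OF t] using t by (simp add: pos_divide_le_eq)
qed simp

lemma frontier_E: "x \<in> frontier E \<longleftrightarrow> norm (B *v x) = 1"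
  by (simp add: frontier_iff minkowski_E)

text \<open>Pulled back by \<open>A\<close>, an outer normal at \<open>x\<close> is a linear
  functional maximal over the unit ball at the unit vector \<open>B *v x\<close>; the equality case
  of Cauchy-Schwarz determines it. Existence and uniqueness of the normal come out together.\<close>

lemma support_normal_E:
  assumes x: "x \<in> frontier E"
  shows "norm u = 1 \<and> (\<forall>y\<in>E. y \<bullet> u \<le> x \<bullet> u) \<longleftrightarrow> u = M x /\<^sub>R norm (M x)"
proof
  have Bx: "norm (B *v x) = 1" using x by (simp add: frontier_E)
  have x0: "x \<noteq> 0" using x by (rule frontier_nonzero)
  {
    assume u: "u = M x /\<^sub>R norm (M x)"
    have "y \<bullet> M x \<le> x \<bullet> M x" if "y \<in> E" for y
    proof -
      have "y \<bullet> M x = (B *v x) \<bullet> (B *v y)" by (simp add: inner_commute[of y] M_inner)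
      also have "\<dots> \<le> norm (B *v x) * norm (B *v y)" by (rule norm_cauchy_schwarz)
      also have "\<dots> \<le> 1" using that Bx by (simp add: E_eq)
      also have "1 = x \<bullet> M x" using M_self[of x] Bx by (simp add: inner_commute)
      finally show ?thesis .
    qed
    thus "norm u = 1 \<and> (\<forall>y\<in>E. y \<bullet> u \<le> x \<bullet> u)" using M_nonzero[OF x0] u by (simp add: divide_right_mono)
  }
  assume u: "norm u = 1 \<and> (\<forall>y\<in>E. y \<bullet> u \<le> x \<bullet> u)"
  define w where "w = transpose A *v u"
  have w: "w \<bullet> b = u \<bullet> (A *v b)" for b by (simp add: w_def transpose_matrix_vector dot_lmul_matrix)
  have w0: "w \<noteq> 0" using w[of "B *v u"] u by (auto simp: power2_norm_eq_inner[symmetric])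
  have "(A *v (w /\<^sub>R norm w)) \<bullet> u \<le> x \<bullet> u" using u w0 by (auto simp: E_def)
  moreover have "(A *v (w /\<^sub>R norm w)) \<bullet> u = norm w"
    unfolding inner_commute[of _ u] w[symmetric] by (rule inner_normalized[OF w0])
  moreover have "x \<bullet> u = w \<bullet> (B *v x)" using w[of "B *v x"] by (simp add: inner_commute)
  moreover have "w \<bullet> (B *v x) \<le> norm w * norm (B *v x)" by (rule norm_cauchy_schwarz)
  ultimately have "w \<bullet> (B *v x) = norm w * norm (B *v x)" using Bx by simp
  hence "norm w *\<^sub>R (B *v x) = norm (B *v x) *\<^sub>R w" by (simp only: norm_cauchy_schwarz_eq)
  hence eq: "norm w *\<^sub>R (B *v x) = w" using Bx by simp
  have "u = norm w *\<^sub>R M x"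
  proof (rule vector_eq_rdot[THEN iffD1], rule allI)
    fix z
    have "u \<bullet> z = w \<bullet> (B *v z)" using w[of "B *v z"] by simp
    also have "\<dots> = (norm w *\<^sub>R (B *v x)) \<bullet> (B *v z)" by (simp only: eq)
    also have "\<dots> = (norm w *\<^sub>R M x) \<bullet> z" by (simp add: M_inner)
    finally show "u \<bullet> z = (norm w *\<^sub>R M x) \<bullet> z" .
  qed
  moreover from this have "norm w * norm (M x) = 1" using u w0 by simp
  ultimately show "u = M x /\<^sub>R norm (M x)" using M_nonzero[OF x0] by (simp add: field_simps)
qed

lemma outer_normal_E: "x \<in> frontier E \<Longrightarrow> outer_normal E x = M x /\<^sub>R norm (M x)"
  unfolding outer_normal_def support_normal_E by simp

lemma M_normalized_derivative:
  assumes x: "x \<noteq> 0"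
  shows "((\<lambda>y. inverse (norm (M y)) *\<^sub>R M y) has_derivative
    (\<lambda>v. inverse (norm (M x)) *\<^sub>R M v + (- (inverse (norm (M x)) * (M v \<bullet> sgn (M x)) * inverse (norm (M x)))) *\<^sub>R M x)) (at x)"
proof -
  have dM: "(M has_derivative M) (at x)"
    by (intro bounded_linear_imp_has_derivative linear_conv_bounded_linear[THEN iffD1] linear_M)
  have "((\<lambda>y. norm (M y)) has_derivative (\<lambda>v. M v \<bullet> sgn (M x))) (at x)"
    by (rule has_derivative_compose[OF dM has_derivative_norm[OF M_nonzero[OF x]]])
  thus ?thesis using M_nonzero[OF x] by (intro has_derivative_scaleR Deriv.has_derivative_inverse dM) auto
qed

lemma smooth_body_E: "smooth_body E"
proof
  fix x assume x: "x \<in> frontier E"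
  show "\<exists>!u. norm u = 1 \<and> (\<forall>y\<in>E. y \<bullet> u \<le> x \<bullet> u)" unfolding support_normal_E[OF x] by blast
  have "((\<lambda>y. inverse (norm (M y)) *\<^sub>R M y) has_derivative
    (\<lambda>v. inverse (norm (M x)) *\<^sub>R M v + (- (inverse (norm (M x)) * (M v \<bullet> sgn (M x)) * inverse (norm (M x)))) *\<^sub>R M x)) (at x within frontier E)"
    by (rule has_derivative_at_withinI[OF M_normalized_derivative[OF frontier_nonzero[OF x]]])
  hence "(outer_normal E has_derivative
    (\<lambda>v. inverse (norm (M x)) *\<^sub>R M v + (- (inverse (norm (M x)) * (M v \<bullet> sgn (M x)) * inverse (norm (M x)))) *\<^sub>R M x)) (at x within frontier E)"
    by (rule has_derivative_transform_within[OF _ zero_less_one x]) (simp add: outer_normal_E)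
  thus "outer_normal E differentiable (at x within frontier E)" by (rule differentiableI)
qed

sublocale smooth_body E by (rule smooth_body_E)

text \<open>Equal normals mean proportional values of the injective linear map \<open>M\<close>,
  hence proportional points, and both have gauge 1. The argument is independent of the curvature,
  because \<open>curvature_E\<close> rests on this injectivity.\<close>

lemma normal_inj_E: "inj_on \<nu> (frontier E)"
proof (rule inj_onI)
  fix x y assume x: "x \<in> frontier E" and y: "y \<in> frontier E" and eq: "\<nu> x = \<nu> y"
  define c where "c = norm (M x) / norm (M y)"
  have nz: "norm (M x) \<noteq> 0" "norm (M y) \<noteq> 0" using M_nonzero frontier_nonzero x y by auto
  hence c: "0 < c" by (simp add: c_def)
  have "M x = norm (M x) *\<^sub>R (M x /\<^sub>R norm (M x))" using nz by simp
  also have "\<dots> = norm (M x) *\<^sub>R (M y /\<^sub>R norm (M y))" using eq x y by (simp add: outer_normal_E)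
  also have "\<dots> = M (c *\<^sub>R y)" by (simp add: linear_scale[OF linear_M] c_def divide_inverse)
  finally have "M (x - c *\<^sub>R y) = 0" by (simp add: linear_diff[OF linear_M])
  hence "x = c *\<^sub>R y" using M_nonzero[of "x - c *\<^sub>R y"] by auto
  moreover have "p x = 1" "p y = 1" using x y by (simp_all add: frontier_iff)
  ultimately show "x = y" using minkowski_scale[OF c, of y] by simp
qed

text \<open>The curvature is read off from \<open>det_dspheremap\<close> after computing the
  derivative of \<open>spheremap\<close> a second time, from its explicit form: \<open>M y\<close>
  times the quotient of the norms of \<open>B *v y\<close> and \<open>M y\<close>. It equals
  \<open>c ^ (n + 1) * (det B)\<^sup>2\<close>, where \<open>c\<close> is the support value at
  \<open>u\<close>, so the product does not depend on the point.\<close>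

lemma curvature_E:
  assumes u: "norm u = 1"
  shows "curvature_fun E u * support_fun E u ^ (CARD('n) + 1) = (det A)\<^sup>2"
proof -
  obtain x where x: "x \<in> frontier E" "\<nu> x = u" using normal_surj[OF u] by blast
  have x0: "x \<noteq> 0" using x(1) by (rule frontier_nonzero)
  have Bx: "norm (B *v x) = 1" using x(1) by (simp add: frontier_E)
  have Mx: "norm (M x) \<noteq> 0" using M_nonzero[OF x0] by simp
  define c where "c = inverse (norm (M x))"
  have c: "0 < c" using Mx by (simp add: c_def)
  have uM: "u = c *\<^sub>R M x" using x outer_normal_E[OF x(1)] by (simp add: c_def)
  have Mu: "M x = inverse c *\<^sub>R u" using c by (simp add: uM)
  have uu: "u \<bullet> u = 1" using u by (simp add: power2_norm_eq_inner[symmetric])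
  have xu: "x \<bullet> u = c" using M_self[of x] Bx by (simp add: uM inner_commute[of x])
  have sg: "sgn (M x) = u" by (simp add: sgn_div_norm uM c_def)
  \<comment> \<open>\<open>k\<close> collects the derivatives of the norm of \<open>B *v y\<close>
    and of the inverse norm of \<open>M y\<close>; both enter as multiples of
    \<open>M x\<close>.\<close>
  define k where "k = inverse c *\<^sub>R u - c *\<^sub>R M u"
  have "dspheremap x = (\<lambda>v. c *\<^sub>R M (v + (v \<bullet> k) *\<^sub>R x))"
  proof (rule has_derivative_unique[OF spheremap_has_derivative[OF x(1)]])
    have dB: "((\<lambda>y. B *v y) has_derivative (\<lambda>y. B *v y)) (at x)"
      by (intro bounded_linear_imp_has_derivative linear_conv_bounded_linear[THEN iffD1] matrix_vector_mul_linear)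
    have nB: "((\<lambda>y. norm (B *v y)) has_derivative (\<lambda>v. (B *v v) \<bullet> sgn (B *v x))) (at x)"
      by (rule has_derivative_compose[OF dB has_derivative_norm[OF B_nonzero[OF x0]]])
    have "((\<lambda>y. norm (B *v y) *\<^sub>R (inverse (norm (M y)) *\<^sub>R M y)) has_derivative
        (\<lambda>v. norm (B *v x) *\<^sub>R (c *\<^sub>R M v + (- (c * (M v \<bullet> u) * c)) *\<^sub>R M x) + ((B *v v) \<bullet> sgn (B *v x)) *\<^sub>R (c *\<^sub>R M x))) (at x)"
      using has_derivative_scaleR[OF nB M_normalized_derivative[OF x0]] by (simp only: c_def sg)
    moreover have "(\<lambda>v. norm (B *v x) *\<^sub>R (c *\<^sub>R M v + (- (c * (M v \<bullet> u) * c)) *\<^sub>R M x) + ((B *v v) \<bullet> sgn (B *v x)) *\<^sub>R (c *\<^sub>R M x))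
       = (\<lambda>v. c *\<^sub>R M (v + (v \<bullet> k) *\<^sub>R x))"
    proof
      fix v
      have "(B *v v) \<bullet> sgn (B *v x) = M x \<bullet> v" by (simp add: sgn_div_norm Bx M_inner inner_commute[of "B *v v"])
      moreover have "M x \<bullet> v = inverse c * (v \<bullet> u)" by (simp add: Mu inner_commute)
      moreover have "M v \<bullet> u = v \<bullet> M u" using M_sym[of v u] by (simp add: inner_commute)
      note facts = calculation this
      show "norm (B *v x) *\<^sub>R (c *\<^sub>R M v + (- (c * (M v \<bullet> u) * c)) *\<^sub>R M x) + ((B *v v) \<bullet> sgn (B *v x)) *\<^sub>R (c *\<^sub>R M x)
         = c *\<^sub>R M (v + (v \<bullet> k) *\<^sub>R x)"
      proof -
        have Mk: "M (v + (v \<bullet> k) *\<^sub>R x) = M v + (inverse c * (v \<bullet> u) - c * (v \<bullet> M u)) *\<^sub>R M x"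
          by (simp only: linear_add[OF linear_M] linear_scale[OF linear_M]) (simp add: k_def inner_diff_right)
        show ?thesis unfolding Mk using facts by (simp add: Bx scaleR_add_right scaleR_diff_left algebra_simps)
      qed
    qed
    ultimately have d: "((\<lambda>y. norm (B *v y) *\<^sub>R (inverse (norm (M y)) *\<^sub>R M y)) has_derivative (\<lambda>v. c *\<^sub>R M (v + (v \<bullet> k) *\<^sub>R x))) (at x)" by simp
    have S: "norm (B *v y) *\<^sub>R (inverse (norm (M y)) *\<^sub>R M y) = spheremap y" if "y \<noteq> 0" for y
    proof -
      have By: "norm (B *v y) \<noteq> 0" using B_nonzero[OF that] by simp
      have "M (foot y) = inverse (norm (B *v y)) *\<^sub>R M y" by (simp add: foot_def minkowski_E linear_scale[OF linear_M])
      thus ?thesis using By by (simp add: spheremap_def outer_normal_E[OF foot_frontier[OF that]] minkowski_E)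
    qed
    show "(spheremap has_derivative (\<lambda>v. c *\<^sub>R M (v + (v \<bullet> k) *\<^sub>R x))) (at x)"
      by (rule has_derivative_transform_within_open[OF d, of "- {0}"]) (use S x0 in auto)
  qed
  moreover have l1: "linear (\<lambda>v. v + (v \<bullet> k) *\<^sub>R x)" by (rule linearI) (simp_all add: algebra_simps inner_add_left scaleR_add_left)
  moreover have l2: "linear (\<lambda>v. c *\<^sub>R M v)" by (rule linear_compose_scale_right[OF linear_M])
  ultimately have "det (matrix (dspheremap x)) = det (matrix (\<lambda>v. c *\<^sub>R M v)) * (1 + x \<bullet> k)"
    by (simp add: det_matrix_compose[OF l2 l1] det_rank_one)
  \<comment> \<open>The quotient of the norms of \<open>B *v y\<close> and \<open>M y\<close> is
    homogeneous of degree 0, so its derivative along \<open>x\<close> vanishes.\<close>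
  also have "x \<bullet> k = 0"
  proof -
    have "x \<bullet> M u = M x \<bullet> u" using M_sym[of u x] by (simp add: inner_commute)
    also have "\<dots> = inverse c" by (simp add: Mu uu)
    finally show ?thesis using c by (simp add: k_def inner_diff_right xu)
  qed
  also have "det (matrix (\<lambda>v. c *\<^sub>R M v)) = c ^ CARD('n) * (det B)\<^sup>2"
  proof -
    have "det (matrix (\<lambda>v. c *\<^sub>R M v)) = det (matrix (\<lambda>v::real^'n. c *\<^sub>R v)) * det (matrix M)"
      by (rule det_matrix_compose[OF _ linear_M]) (rule linear_scale_self)
    moreover have "matrix M = transpose B ** B"
      unfolding M_def matrix_vector_mul_assoc by (simp add: matrix_of_matrix_vector_mul)
    moreover have "det (matrix (\<lambda>v::real^'n. c *\<^sub>R v)) = c ^ CARD('n)"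
      by (subst det_diagonal) (auto simp: matrix_def axis_def)
    ultimately show ?thesis by (simp add: det_mul power2_eq_square)
  qed
  finally have "gauss_curvature E x / c = c ^ CARD('n) * (det B)\<^sup>2"
    using det_dspheremap[OF x(1)] by (simp add: x(2) xu)
  hence gc: "gauss_curvature E x = c ^ (CARD('n) + 1) * (det B)\<^sup>2" using c by (simp add: field_simps)
  have dAB: "det A * det B = 1" using AB by (metis det_I det_mul)
  hence B0: "det B \<noteq> 0" by auto
  have "support_fun E u = c" using support_normal[OF x(1)] by (simp add: x(2) xu)
  hence "curvature_fun E u * support_fun E u ^ (CARD('n) + 1) = 1 / (det B)\<^sup>2"
    using curvature_fun_normal[OF normal_inj_E x(1)] c by (simp add: x(2) gc)
  also have "\<dots> = (det A)\<^sup>2"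
  proof -
    have "(det A)\<^sup>2 * (det B)\<^sup>2 = 1" using dAB by (simp add: power_mult_distrib[symmetric])
    thus ?thesis using B0 by (simp add: field_simps)
  qed
  finally show ?thesis .
qed

lemma vol_E: "vol E = \<bar>det A\<bar> * vol (cball (0::real^'n) 1)"
  unfolding E_def by (rule vol_image_cball[OF AB BA])

text \<open>The polar of the image of the unit ball under \<open>A\<close> is its image under the
  inverse transpose, \<open>transpose B\<close>.\<close>

lemma vol_polar_E: "\<bar>det A\<bar> * vol (polar_body E) = vol (cball (0::real^'n) 1)"
proof -
  have inv: "transpose B ** transpose A = mat 1" "transpose A ** transpose B = mat 1"
    using AB BA by (metis matrix_transpose_mul transpose_mat)+
  have "polar_body E = {y. norm (transpose A *v y) \<le> 1}"
  proof (intro set_eqI iffI)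
    fix y assume y: "y \<in> polar_body E"
    define w where "w = transpose A *v y"
    have w: "w \<bullet> b = (A *v b) \<bullet> y" for b
      by (simp add: w_def transpose_matrix_vector dot_lmul_matrix inner_commute[of y])
    show "y \<in> {y. norm (transpose A *v y) \<le> 1}"
    proof (cases "w = 0")
      case False
      have "(A *v (w /\<^sub>R norm w)) \<bullet> y \<le> 1" using y False by (auto simp: polar_body_def E_def)
      hence "norm w \<le> 1" using w[of "w /\<^sub>R norm w"] inner_normalized[OF False] by (simp only:)
      thus ?thesis unfolding mem_Collect_eq w_def[symmetric] .
    qed (simp add: w_def)
  next
    fix y assume y: "y \<in> {y. norm (transpose A *v y) \<le> 1}"
    have "(A *v b) \<bullet> y \<le> 1" if "norm b \<le> 1" for b
    proof -
      have "(A *v b) \<bullet> y = (transpose A *v y) \<bullet> b" by (simp add: transpose_matrix_vector dot_lmul_matrix inner_commute[of y])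
      also have "\<dots> \<le> norm (transpose A *v y) * norm b" by (rule norm_cauchy_schwarz)
      also have "\<dots> \<le> 1 * 1" using y that by (intro mult_mono) auto
      finally show ?thesis by simp
    qed
    thus "y \<in> polar_body E" by (auto simp: polar_body_def E_def)
  qed
  also have "\<dots> = (\<lambda>x. transpose B *v x) ` cball 0 1" by (rule image_cball_eq[OF inv, symmetric])
  finally have "vol (polar_body E) = \<bar>det B\<bar> * vol (cball (0::real^'n) 1)"
    using vol_image_cball[OF inv] by simp
  moreover have "\<bar>det A\<bar> * \<bar>det B\<bar> = 1" using AB by (metis abs_mult abs_one det_I det_mul)
  ultimately show ?thesis by (simp add: mult.assoc[symmetric])
qed

end

section \<open>Bounds for the mixed affine surface area\<close>

lemma Conc_pos: "\<phi> \<in> Conc \<Longrightarrow> 0 < t \<Longrightarrow> 0 < \<phi> t"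
  by (auto simp: Conc_def)

text \<open>The line lies above a positive function on the whole half line. Far out this excludes a
  negative slope, and near 0 a negative intercept.\<close>

lemma Conc_tangent:
  assumes \<phi>: "\<phi> \<in> Conc" and \<tau>: "0 < \<tau>"
  obtains s where "0 \<le> s" "0 \<le> \<phi> \<tau> - s * \<tau>" "\<And>t. 0 < t \<Longrightarrow> \<phi> t \<le> \<phi> \<tau> + s * (t - \<tau>)"
proof (cases "\<exists>c. c \<noteq> 0 \<and> (\<forall>t>0. \<phi> t = c)")
  case True
  thus ?thesis using that[of 0] Conc_pos[OF \<phi> \<tau>] \<tau> by auto
next
  case False
  hence conv: "convex_on {0<..} (\<lambda>x. - \<phi> x)" using \<phi> by (auto simp: Conc_def concave_on_def)
  define m where "m = Inf ((\<lambda>t. (- \<phi> \<tau> - - \<phi> t) / (\<tau> - t)) ` ({\<tau><..} \<inter> {0<..}))"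
  have m: "- \<phi> t \<ge> - \<phi> \<tau> + m * (t - \<tau>)" if "0 < t" for t
    unfolding m_def using \<tau> that by (intro convex_le_Inf_differential[OF conv]) (auto simp: interior_open)
  define s where "s = - m"
  have tang: "\<phi> t \<le> \<phi> \<tau> + s * (t - \<tau>)" if "0 < t" for t using m[OF that] by (simp add: s_def)
  hence pos: "0 < \<phi> \<tau> - s * \<tau> + s * t" if "0 < t" for t
    using Conc_pos[OF \<phi> that] tang[OF that] by (simp add: algebra_simps)
  have s: "0 \<le> s"
  proof (rule ccontr)
    assume "\<not> 0 \<le> s"
    hence s: "s < 0" by simp
    \<comment> \<open>This argument is the zero of the line, where the line would have to be
      positive; the same device serves for the intercept.\<close>
    have "0 < (\<phi> \<tau> - s * \<tau>) / (- s)"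
      using Conc_pos[OF \<phi> \<tau>] s mult_neg_pos[OF s \<tau>] by (intro divide_pos_pos) auto
    from pos[OF this] s show False by simp
  qed
  moreover have "0 \<le> \<phi> \<tau> - s * \<tau>"
  proof (rule ccontr)
    assume neg: "\<not> 0 \<le> \<phi> \<tau> - s * \<tau>"
    hence s0: "0 < s" using s Conc_pos[OF \<phi> \<tau>] by (cases "s = 0") auto
    hence "0 < (s * \<tau> - \<phi> \<tau>) / s" using neg by (intro divide_pos_pos) auto
    from pos[OF this] s0 show False by simp
  qed
  ultimately show ?thesis using tang that by blast
qed

lemma Conc_mono:
  assumes \<phi>: "\<phi> \<in> Conc" and t: "0 < t" "t \<le> t'"
  shows "\<phi> t \<le> \<phi> t'"
proof -
  obtain s where "0 \<le> s" "\<And>t. 0 < t \<Longrightarrow> \<phi> t \<le> \<phi> t' + s * (t - t')"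
    using Conc_tangent[OF \<phi>, of t'] t by (metis less_le_trans)
  thus ?thesis using t mult_nonneg_nonpos[of s "t - t'"] by force
qed

lemma (in convex_body) has_integral_support_polar:
  "((\<lambda>y. 1 / support_fun K (sgn y) ^ CARD('n)) has_integral vol (polar_body K)) (cball 0 1 - {0})"
proof -
  interpret P: convex_body "polar_body K" by (rule polar_convex_body)
  let ?f = "\<lambda>y. if y \<in> cball 0 1 - {0} then 1 / support_fun K (sgn y) ^ CARD('n) else 0"
  have [measurable]: "(\<lambda>y::real^'n. sgn y) \<in> borel_measurable borel" unfolding sgn_div_norm by measurable
  have "(?f has_integral vol (polar_body K)) UNIV"
  proof (rule nn_integral_has_integral)
    have "cball 0 1 - {0::real^'n} \<in> sets borel" by auto
    thus "?f \<in> borel_measurable borel" by measurable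
    have "(\<integral>\<^sup>+y. ennreal (?f y) \<partial>lborel) = (\<integral>\<^sup>+y. ennreal (1 / support_fun K (sgn y) ^ CARD('n)) * indicator (cball 0 1 - {0}) y \<partial>lborel)"
      by (intro nn_integral_cong) (simp add: indicator_def)
    thus "(\<integral>\<^sup>+y. ennreal (?f y) \<partial>lborel) = ennreal (vol (polar_body K))" by (simp only: nn_integral_support_polar)
  qed (use support_nonneg P.vol_pos in auto)
  thus ?thesis by (simp only: has_integral_restrict_UNIV)
qed

lemma mixed_asa_nonneg: "0 \<le> mixed_asa \<phi> K"
  unfolding mixed_asa_def by (intro integral_nonneg_AE AE_I2 prod_nonneg) simp

lemma mixed_asa_le:
  fixes K :: "nat \<Rightarrow> (real^'n) set"
  assumes K: "\<And>i. i \<in> {1..CARD('n)} \<Longrightarrow> C2_plus (K i)"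
    and \<phi>: "\<And>i. i \<in> {1..CARD('n)} \<Longrightarrow> \<phi> i \<in> Conc"
  shows "mixed_asa \<phi> K \<le> real CARD('n) *
     (\<Prod>i=1..CARD('n). (vol (polar_body (K i)) * \<phi> i (vol (K i) / vol (polar_body (K i)))) powr (1 / real CARD('n)))"
proof -
  let ?n = "CARD('n)" let ?I = "{1..CARD('n)}" let ?r = "1 / real CARD('n)"
  let ?S = "cball (0::real^'n) 1 - {0}"
  define V where "V i = vol (K i)" for i
  define W where "W i = vol (polar_body (K i))" for i
  define h where "h i = support_fun (K i)" for i
  define f where "f i = curvature_fun (K i)" for i
  \<comment> \<open>The integral of the tangent bound over the punctured ball. The slope enters with
    the coefficient \<open>V i - W i * (V i / W i) = 0\<close>, which is why the supporting line is
    taken at \<open>V i / W i\<close>.\<close>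
  define c where "c i = W i * \<phi> i (V i / W i)" for i
  have body: "smooth_body (K i)" if "i \<in> ?I" for i using C2_plus_smooth_body[OF K[OF that]] .
  hence cb: "convex_body (K i)" if "i \<in> ?I" for i using that smooth_body.axioms(1) by blast
  have VW: "0 < V i" "0 < W i" if "i \<in> ?I" for i
    unfolding V_def W_def using convex_body.vol_pos[OF cb[OF that]] convex_body.vol_pos[OF convex_body.polar_convex_body[OF cb[OF that]]] .
  have c: "0 < c i" if "i \<in> ?I" for i
    unfolding c_def using VW[OF that] Conc_pos[OF \<phi>[OF that]] by (intro mult_pos_pos) auto
  have hpos: "0 < h i u" if "i \<in> ?I" "norm u = 1" for i u
    unfolding h_def using that by (intro convex_body.support_pos[OF cb]) auto
  have curv: "\<And>x. x \<in> frontier (K i) \<Longrightarrow> 0 < gauss_curvature (K i) x" if "i \<in> ?I" for i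
    using K[OF that] by (simp add: C2_plus_def)
  have fpos: "0 < f i u" if "i \<in> ?I" "norm u = 1" for i u
    unfolding f_def using smooth_body.has_integral_curvature_support(2)[OF body[OF that(1)] curv[OF that(1)] that(2)] .
  have "\<forall>i\<in>?I. \<exists>s. 0 \<le> s \<and> 0 \<le> \<phi> i (V i / W i) - s * (V i / W i) \<and> (\<forall>t>0. \<phi> i t \<le> \<phi> i (V i / W i) + s * (t - V i / W i))"
  proof
    fix i assume i: "i \<in> ?I"
    have "0 < V i / W i" using VW[OF i] by simp
    from Conc_tangent[OF \<phi>[OF i] this] show "\<exists>s. 0 \<le> s \<and> 0 \<le> \<phi> i (V i / W i) - s * (V i / W i) \<and> (\<forall>t>0. \<phi> i t \<le> \<phi> i (V i / W i) + s * (t - V i / W i))"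
      by metis
  qed
  then obtain s where s: "\<And>i. i \<in> ?I \<Longrightarrow> 0 \<le> s i" "\<And>i. i \<in> ?I \<Longrightarrow> 0 \<le> \<phi> i (V i / W i) - s i * (V i / W i)"
     "\<And>i t. i \<in> ?I \<Longrightarrow> 0 < t \<Longrightarrow> \<phi> i t \<le> \<phi> i (V i / W i) + s i * (t - V i / W i)"
    by metis
  define a where "a i u = (\<phi> i (V i / W i) - s i * (V i / W i)) * (1 / h i u ^ ?n) + s i * (f i u * h i u)" for i u
  define F where "F i u = \<phi> i (f i u * h i u ^ (?n + 1)) / h i u ^ ?n" for i u
  have F0: "0 \<le> F i u" if "i \<in> ?I" "norm u = 1" for i u
    unfolding F_def using that hpos fpos by (intro divide_nonneg_nonneg less_imp_le[OF Conc_pos[OF \<phi>]] mult_pos_pos) (auto intro: less_imp_le)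
  have Fa: "F i u \<le> a i u" if i: "i \<in> ?I" and u: "norm u = 1" for i u
  proof -
    have hp: "0 < h i u ^ ?n" using hpos[OF i u] by simp
    have "0 < f i u * h i u ^ (?n + 1)" using hpos[OF i u] fpos[OF i u] by simp
    from divide_right_mono[OF s(3)[OF i this] less_imp_le[OF hp]]
    have "F i u \<le> (\<phi> i (V i / W i) + s i * (f i u * h i u ^ (?n + 1) - V i / W i)) / h i u ^ ?n"
      by (simp only: F_def)
    also have "\<dots> = a i u"
    proof -
      have "(p + r * (k * l ^ (?n + 1) - t)) / l ^ ?n = (p - r * t) * (1 / l ^ ?n) + r * (k * l)"
        if "0 < l ^ ?n" for p r k l t :: real
        using that by (simp add: add_divide_distrib diff_divide_distrib right_diff_distrib)
      thus ?thesis unfolding a_def using hp .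
    qed
    finally show ?thesis .
  qed
  have aint: "((\<lambda>y. a i (sgn y)) has_integral c i) ?S" if i: "i \<in> ?I" for i
  proof -
    have "((\<lambda>y. a i (sgn y)) has_integral ((\<phi> i (V i / W i) - s i * (V i / W i)) * W i + s i * V i)) ?S"
      unfolding a_def f_def h_def V_def W_def
      by (intro has_integral_add has_integral_mult_right convex_body.has_integral_support_polar[OF cb[OF i]]
          smooth_body.has_integral_curvature_support(1)[OF body[OF i] curv[OF i]])
    moreover have "(\<phi> i (V i / W i) - s i * (V i / W i)) * W i + s i * V i = c i"
      using VW[OF i] by (simp add: c_def field_simps)
    ultimately show ?thesis by simp
  qed
  define C where "C = (\<Prod>i\<in>?I. c i powr ?r)"
  have C0: "0 \<le> C" unfolding C_def by (intro prod_nonneg) simp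
  \<comment> \<open>Each \<open>a i / c i\<close> has integral 1, hence so has their arithmetic
    mean, which bounds the geometric mean; thus \<open>C\<close> is exactly the integral of
    \<open>b\<close>.\<close>
  define b where "b u = C * (\<Sum>i\<in>?I. (1 / (c i * real ?n)) * a i u)" for u
  have bint: "((\<lambda>y. b (sgn y)) has_integral C) ?S"
  proof -
    have "((\<lambda>y. b (sgn y)) has_integral (C * (\<Sum>i\<in>?I. (1 / (c i * real ?n)) * c i))) ?S"
      unfolding b_def by (intro has_integral_mult_right has_integral_sum aint) auto
    moreover have "(\<Sum>i\<in>?I. (1 / (c i * real ?n)) * c i) = (\<Sum>i\<in>?I. 1 / real ?n)"
      by (intro sum.cong refl) (use c in force)
    ultimately show ?thesis by simp
  qed
  have Fb: "(\<Prod>i\<in>?I. F i u powr ?r) \<le> b u" if u: "norm u = 1" for u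
  proof -
    have a0: "0 \<le> a i u" if "i \<in> ?I" for i using F0[OF that u] Fa[OF that u] by simp
    have "(\<Prod>i\<in>?I. F i u powr ?r) \<le> (\<Prod>i\<in>?I. a i u powr ?r)"
      using F0 Fa u by (intro prod_mono conjI powr_mono2) auto
    also have "\<dots> = (\<Prod>i\<in>?I. c i powr ?r * (a i u / c i) powr ?r)"
    proof (intro prod.cong refl)
      fix i assume i: "i \<in> ?I"
      have "a i u = c i * (a i u / c i)" using c[OF i] by simp
      thus "a i u powr ?r = c i powr ?r * (a i u / c i) powr ?r"
        using powr_mult[of "c i" "a i u / c i" ?r] by (simp only:)
    qed
    also have "\<dots> = C * (\<Prod>i\<in>?I. a i u / c i) powr ?r"
      unfolding prod.distrib C_def by (simp only: prod_powr_distrib)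
    also have "(\<Prod>i\<in>?I. a i u / c i) powr ?r \<le> (\<Sum>i\<in>?I. (a i u / c i) / real ?n)"
    proof -
      have "0 \<le> a i u / c i" if "i \<in> ?I" for i using a0[OF that] c[OF that] by simp
      thus ?thesis using arith_geom_mean[of ?I "\<lambda>i. a i u / c i"] by simp
    qed
    also have "(\<Sum>i\<in>?I. (a i u / c i) / real ?n) = (\<Sum>i\<in>?I. (1 / (c i * real ?n)) * a i u)"
      by (intro sum.cong refl) simp
    finally show ?thesis unfolding b_def using C0 by (simp add: mult_left_mono)
  qed
  have "mixed_asa \<phi> K = (LINT u|sphere_measure. (\<Prod>i\<in>?I. F i u powr ?r))"
    unfolding mixed_asa_def F_def f_def h_def ..
  also have "\<dots> \<le> real ?n * C"
  proof (rule integral_sphere_le[where b=b, OF _ Fb _ C0])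
    show "0 \<le> (\<Prod>i\<in>?I. F i u powr ?r)" for u by (intro prod_nonneg) simp
    have "(\<integral>\<^sup>+y. ennreal (b (sgn y)) * indicator ?S y \<partial>lborel) = ennreal C"
    proof (rule nn_integral_has_integral_lebesgue'[OF _ bint])
      fix y :: "real^'n" assume "y \<in> ?S"
      hence "norm (sgn y) = 1" by (simp add: norm_sgn)
      from Fb[OF this] show "0 \<le> b (sgn y)"
        using prod_nonneg[of ?I "\<lambda>i. F i (sgn y) powr ?r"] by (simp add: order_trans)
    qed
    thus "(\<integral>\<^sup>+y. ennreal (b (sgn y)) * indicator ?S y \<partial>lborel) \<le> ennreal C" by simp
  qed
  finally show ?thesis by (simp only: C_def c_def V_def W_def)
qed

lemma support_fun_dilate:
  assumes "convex_body L" and c: "0 < c"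
  shows "support_fun ((\<lambda>x. c *\<^sub>R x) ` L) u = c * support_fun L u"
proof -
  interpret convex_body L by fact
  have "support_fun ((\<lambda>x. c *\<^sub>R x) ` L) u = (SUP x\<in>L. x \<bullet> (c *\<^sub>R u))"
    by (simp add: support_fun_def image_image)
  also have "\<dots> = support_fun L (c *\<^sub>R u)" by (simp add: support_fun_def)
  finally show ?thesis using support_scale[OF c] by simp
qed

text \<open>Dilation makes all support functions multiples of the first one, \<open>h\<close>. The
  product of the n-th roots is then a constant times \<open>1 / h ^ n\<close>, whose integral is
  known from the polar volume of \<open>K 1\<close>.\<close>

lemma mixed_asa_ellipsoids:
  fixes K :: "nat \<Rightarrow> (real^'n) set"
  assumes ell: "\<And>i. i \<in> {1..CARD('n)} \<Longrightarrow> centered_ellipsoid (A i) (B i) \<and> K i = centered_ellipsoid.E (A i)"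
    and dil: "\<And>i. i \<in> {1..CARD('n)} \<Longrightarrow> dilates (K i) (K 1)"
    and \<phi>: "\<And>i. i \<in> {1..CARD('n)} \<Longrightarrow> \<phi> i \<in> Conc"
  shows "mixed_asa \<phi> K = real CARD('n) *
     (\<Prod>i=1..CARD('n). (vol (polar_body (K i)) * \<phi> i (vol (K i) / vol (polar_body (K i)))) powr (1 / real CARD('n)))"
proof -
  let ?n = "CARD('n)" let ?I = "{1..CARD('n)}" let ?r = "1 / real CARD('n)"
  have n: "0 < ?n" by simp
  hence I1: "1 \<in> ?I" by simp
  define W where "W i = vol (polar_body (K i))" for i
  define \<tau> where "\<tau> i = vol (K i) / W i" for i
  have ce: "centered_ellipsoid (A i) (B i)" and KE: "K i = centered_ellipsoid.E (A i)" if "i \<in> ?I" for i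
    using ell[OF that] by auto
  have cb: "convex_body (K i)" if "i \<in> ?I" for i
    unfolding KE[OF that] by (rule centered_ellipsoid.convex_body_E[OF ce[OF that]])
  have W: "0 < W i" and \<tau>: "0 < \<tau> i" if "i \<in> ?I" for i
    unfolding W_def \<tau>_def using convex_body.vol_pos[OF cb[OF that]] convex_body.vol_pos[OF convex_body.polar_convex_body[OF cb[OF that]]] by simp_all
  \<comment> \<open>The volumes of an ellipsoid and its polar identify
    \<open>(det A)\<^sup>2\<close> with \<open>\<tau> i\<close>: the curvature term sits exactly at
    the point where the supporting line touches.\<close>
  have fh: "curvature_fun (K i) u * support_fun (K i) u ^ (?n + 1) = \<tau> i" if i: "i \<in> ?I" and u: "norm u = 1" for i u
  proof -
    interpret centered_ellipsoid "A i" "B i" by (rule ce[OF i])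
    have dA: "\<bar>det (A i)\<bar> * W i = vol (cball (0::real^'n) 1)" unfolding W_def KE[OF i] by (rule vol_polar_E)
    have "vol (K i) = (det (A i))\<^sup>2 * W i"
      unfolding KE[OF i] vol_E dA[symmetric] by (simp add: W_def power2_eq_square mult.assoc[symmetric])
    hence "\<tau> i = (det (A i))\<^sup>2" using W[OF i] by (simp add: \<tau>_def)
    thus ?thesis using curvature_E[OF u] unfolding KE[OF i] by simp
  qed
  have "\<forall>i\<in>?I. \<exists>c>0. K i = (\<lambda>x. c *\<^sub>R x) ` K 1" using dil by (simp add: dilates_def)
  then obtain d where d: "\<And>i. i \<in> ?I \<Longrightarrow> 0 < d i" "\<And>i. i \<in> ?I \<Longrightarrow> K i = (\<lambda>x. d i *\<^sub>R x) ` K 1" by metis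
  define h where "h = support_fun (K 1)"
  have hpos: "0 < h u" if "norm u = 1" for u
    unfolding h_def using that by (intro convex_body.support_pos[OF cb[OF I1]]) auto
  have hi: "support_fun (K i) u = d i * h u" if "i \<in> ?I" for i u
    unfolding h_def using d(2)[OF that] support_fun_dilate[OF cb[OF I1] d(1)[OF that]] by simp
  \<comment> \<open>Dilation by \<open>d i\<close> scales the support function by
    \<open>d i\<close>, and the radial formula for the polar volume is of degree \<open>-n\<close>
    in it.\<close>
  have Wi: "W i = W 1 / d i ^ ?n" if i: "i \<in> ?I" for i
  proof -
    have "((\<lambda>y. 1 / support_fun (K i) (sgn y) ^ ?n) has_integral (1 / d i ^ ?n * W 1)) (cball 0 1 - {0})"
      using has_integral_mult_right[OF convex_body.has_integral_support_polar[OF cb[OF I1]], of "1 / d i ^ ?n"]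
      by (simp add: hi[OF i] h_def W_def power_mult_distrib)
    hence "W i = 1 / d i ^ ?n * W 1"
      unfolding W_def using convex_body.has_integral_support_polar[OF cb[OF i]] has_integral_unique by blast
    thus ?thesis by simp
  qed
  define P where "P = (\<Prod>i\<in>?I. (\<phi> i (\<tau> i) / d i ^ ?n) powr ?r)"
  have P0: "0 \<le> P" unfolding P_def by (intro prod_nonneg) simp
  have "(LINT u|sphere_measure. (\<Prod>i\<in>?I. (\<phi> i (curvature_fun (K i) u * support_fun (K i) u ^ (?n + 1)) / support_fun (K i) u ^ ?n) powr ?r))
     = (LINT u|sphere_measure. P * (1 / h u ^ ?n))"
  proof (rule Bochner_Integration.integral_cong[OF refl])
    fix u :: "real^'n" assume "u \<in> space sphere_measure"
    hence u: "norm u = 1" by (simp add: sphere_measure_space)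
    have "(\<Prod>i\<in>?I. (\<phi> i (curvature_fun (K i) u * support_fun (K i) u ^ (?n + 1)) / support_fun (K i) u ^ ?n) powr ?r)
      = (\<Prod>i\<in>?I. (\<phi> i (\<tau> i) / d i ^ ?n) powr ?r * (1 / h u))"
    proof (intro prod.cong refl)
      fix i assume i: "i \<in> ?I"
      have "(\<phi> i (\<tau> i) / (d i * h u) ^ ?n) powr ?r = (\<phi> i (\<tau> i) / d i ^ ?n * (1 / h u) ^ ?n) powr ?r"
        by (simp add: power_mult_distrib power_divide)
      also have "\<dots> = (\<phi> i (\<tau> i) / d i ^ ?n) powr ?r * ((1 / h u) ^ ?n) powr ?r"
        by (rule powr_mult)
      also have "((1 / h u) ^ ?n) powr ?r = 1 / h u"
        using hpos[OF u] n by (simp add: powr_realpow[symmetric] powr_powr del: power_one_over)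
      finally show "(\<phi> i (curvature_fun (K i) u * support_fun (K i) u ^ (?n + 1)) / support_fun (K i) u ^ ?n) powr ?r
        = (\<phi> i (\<tau> i) / d i ^ ?n) powr ?r * (1 / h u)" unfolding fh[OF i u] unfolding hi[OF i] .
    qed
    also have "\<dots> = P * (1 / h u ^ ?n)" unfolding P_def prod.distrib by (simp add: power_one_over)
    finally show "(\<Prod>i\<in>?I. (\<phi> i (curvature_fun (K i) u * support_fun (K i) u ^ (?n + 1)) / support_fun (K i) u ^ ?n) powr ?r) = P * (1 / h u ^ ?n)" .
  qed
  also have "\<dots> = real ?n * (P * W 1)"
  proof (rule integral_sphere_eq)
    have [measurable]: "h \<in> borel_measurable borel" unfolding h_def by (rule convex_body.support_borel[OF cb[OF I1]])
    show "(\<lambda>u. P * (1 / h u ^ ?n)) \<in> borel_measurable borel" by measurable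
    show "0 \<le> P * (1 / h u ^ ?n)" if "norm u = 1" for u using P0 hpos[OF that] by simp
    show "0 \<le> P * W 1" using P0 W[OF I1] by simp
    have "(\<integral>\<^sup>+y. ennreal (P * (1 / h (sgn y) ^ ?n)) * indicator (cball 0 1 - {0}) y \<partial>lborel) = ennreal (P * W 1)"
    proof (rule nn_integral_has_integral_lebesgue')
      show "((\<lambda>y. P * (1 / h (sgn y) ^ ?n)) has_integral P * W 1) (cball 0 1 - {0})"
        unfolding h_def W_def by (intro has_integral_mult_right convex_body.has_integral_support_polar[OF cb[OF I1]])
      fix y :: "real^'n" assume "y \<in> cball 0 1 - {0}"
      hence "norm (sgn y) = 1" by (simp add: norm_sgn)
      thus "0 \<le> P * (1 / h (sgn y) ^ ?n)" using P0 hpos[of "sgn y"] by simp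
    qed
    thus "(\<integral>\<^sup>+y. ennreal (P * (1 / h (sgn y) ^ ?n)) * indicator (cball 0 1 - {0}) y \<partial>lborel) = ennreal (P * W 1)" .
  qed
  also have "P * W 1 = (\<Prod>i\<in>?I. (W i * \<phi> i (\<tau> i)) powr ?r)"
  proof -
    have "(\<Prod>i\<in>?I. (W i * \<phi> i (\<tau> i)) powr ?r) = (\<Prod>i\<in>?I. (\<phi> i (\<tau> i) / d i ^ ?n) powr ?r * W 1 powr ?r)"
    proof (intro prod.cong refl)
      fix i assume i: "i \<in> ?I"
      have "W i * \<phi> i (\<tau> i) = (\<phi> i (\<tau> i) / d i ^ ?n) * W 1" by (simp add: Wi[OF i])
      thus "(W i * \<phi> i (\<tau> i)) powr ?r = (\<phi> i (\<tau> i) / d i ^ ?n) powr ?r * W 1 powr ?r"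
        by (simp only: powr_mult)
    qed
    also have "\<dots> = P * (W 1 powr ?r) ^ ?n" unfolding P_def prod.distrib by simp
    also have "(W 1 powr ?r) ^ ?n = W 1" using W[OF I1] n by (simp add: powr_realpow[symmetric] powr_powr)
    finally show ?thesis by simp
  qed
  finally show ?thesis unfolding mixed_asa_def W_def \<tau>_def .
qed

section \<open>Balls, and ellipsoids with centroid at the origin\<close>

lemma polar_body_cball:
  assumes r: "0 < r"
  shows "polar_body (cball (0::real^'n) r) = cball 0 (1 / r)"
proof (intro set_eqI iffI)
  fix y :: "real^'n" assume y: "y \<in> polar_body (cball 0 r)"
  show "y \<in> cball 0 (1 / r)"
  proof (cases "y = 0")
    case False
    have "(r / norm y) *\<^sub>R y \<in> cball 0 r" using False r by (simp add: dist_norm)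
    hence "((r / norm y) *\<^sub>R y) \<bullet> y \<le> 1" using y unfolding polar_body_def by blast
    hence "r * norm y \<le> 1" using False by (simp add: power2_norm_eq_inner[symmetric] power2_eq_square)
    thus ?thesis using r by (simp add: dist_norm field_simps)
  qed (use r in simp)
next
  fix y :: "real^'n" assume y: "y \<in> cball 0 (1 / r)"
  have "x \<bullet> y \<le> 1" if "x \<in> cball 0 r" for x
  proof -
    have "x \<bullet> y \<le> norm x * norm y" by (rule norm_cauchy_schwarz)
    also have "\<dots> \<le> r * (1 / r)" using that y r by (intro mult_mono) (auto simp: dist_norm)
    finally show ?thesis using r by simp
  qed
  thus "y \<in> polar_body (cball 0 r)" by (simp add: polar_body_def)
qed

lemma mat_mult_vector: "(mat r :: real^'n^'n) *v x = r *\<^sub>R x"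
  by (simp add: vec_eq_iff matrix_vector_mult_def mat_def if_distrib[where f="\<lambda>c. c * _"] cong: if_cong)

lemma ball_centered_ellipsoid:
  assumes r: "0 < r"
  shows "centered_ellipsoid (mat r :: real^'n^'n) (mat (1 / r))"
    and "centered_ellipsoid.E (mat r :: real^'n^'n) = cball 0 r"
proof -
  have "(mat r :: real^'n^'n) ** mat (1 / r) = mat 1" "(mat (1 / r) :: real^'n^'n) ** mat r = mat 1"
    using r by (simp_all add: matrix_eq matrix_vector_mul_assoc[symmetric] mat_mult_vector)
  thus c: "centered_ellipsoid (mat r :: real^'n^'n) (mat (1 / r))" by (rule centered_ellipsoid.intro)
  show "centered_ellipsoid.E (mat r :: real^'n^'n) = cball 0 r"
    unfolding centered_ellipsoid.E_eq[OF c] using r by (auto simp: mat_mult_vector dist_norm field_simps)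
qed

lemma vol_cball:
  assumes r: "0 < r"
  shows "vol (cball (0::real^'n) r) = r ^ CARD('n) * vol (cball (0::real^'n) 1)"
proof -
  have "det (mat r :: real^'n^'n) = r ^ CARD('n)" by (subst det_diagonal) (auto simp: mat_def)
  thus ?thesis
    using centered_ellipsoid.vol_E[OF ball_centered_ellipsoid(1)[OF r, where 'n='n]] r
    by (simp add: ball_centered_ellipsoid(2)[OF r])
qed

lemma vol_unit_ball_pos: "0 < vol (cball (0::real^'n) 1)"
proof -
  interpret centered_ellipsoid "mat 1 :: real^'n^'n" "mat (1 / 1)" by (rule ball_centered_ellipsoid) simp
  show ?thesis using vol_pos by (simp add: ball_centered_ellipsoid(2))
qed

lemma volume_ball_eq:
  fixes L :: "(real^'n) set"
  assumes L: "0 < vol L"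
  defines "r \<equiv> root CARD('n) (vol L / vol (cball (0::real^'n) 1))"
  shows "volume_ball L = cball 0 r" "0 < r" "r ^ CARD('n) * vol (cball (0::real^'n) 1) = vol L"
proof -
  let ?b = "vol (cball (0::real^'n) 1)"
  have b: "0 < ?b" by (rule vol_unit_ball_pos)
  show r: "0 < r" unfolding r_def using L b by simp
  show rn: "r ^ CARD('n) * ?b = vol L" unfolding r_def using L b by simp
  show "volume_ball L = cball 0 r"
    unfolding volume_ball_def
  proof (rule the_equality)
    show "(\<exists>s\<ge>0. cball 0 r = cball (0::real^'n) s) \<and> vol (cball (0::real^'n) r) = vol L"
      using rn less_imp_le[OF r] unfolding vol_cball[OF r] by blast
    fix C :: "(real^'n) set" assume "(\<exists>s\<ge>0. C = cball 0 s) \<and> vol C = vol L"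
    then obtain s where s: "0 \<le> s" "C = cball 0 s" "vol C = vol L" by blast
    \<comment> \<open>Radius 0 is allowed in \<open>volume_ball\<close>; it gives a point, of volume
      0, and is excluded before \<open>vol_cball\<close> is applied.\<close>
    have "s \<noteq> 0" using s L by (auto simp: vol_def)
    hence "s ^ CARD('n) * ?b = r ^ CARD('n) * ?b" using s rn vol_cball[of s, where 'n='n] by simp
    hence "s ^ CARD('n) = r ^ CARD('n)" using b by simp
    hence "s = r" using s(1) r by (simp add: power_eq_iff_eq_base)
    thus "C = cball 0 r" using s by simp
  qed
qed

text \<open>Reflection in the centre \<open>a\<close> preserves both the ellipsoid and Lebesgue
  measure, so the first moment satisfies \<open>J = vol K *\<^sub>R (2 *\<^sub>R a) - J\<close>.
  With \<open>J = 0\<close> the centre is the origin.\<close>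

lemma ellipsoid_centered:
  fixes K :: "(real^'n) set"
  assumes ell: "ellipsoid K" and cen: "centroid K = 0" and K: "convex_body K"
  obtains A B where "centered_ellipsoid A B" "K = centered_ellipsoid.E A"
proof -
  interpret convex_body K by (rule K)
  obtain A :: "real^'n^'n" and a where A: "invertible A" "K = (\<lambda>x. a + A *v x) ` cball 0 1"
    using ell unfolding ellipsoid_def by blast
  obtain B where AB: "A ** B = mat 1" "B ** A = mat 1" using A(1) unfolding invertible_def by blast
  define J where "J = (\<integral>x. indicator K x *\<^sub>R x \<partial>lborel)"
  have J: "J = 0" using cen vol_pos unfolding centroid_def set_lebesgue_integral_def J_def by simp
  have sym: "(2 *\<^sub>R a - x \<in> K) = (x \<in> K)" for x
  proof -
    have reflect: "2 *\<^sub>R a - y \<in> K" if y: "y \<in> K" for y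
    proof -
      obtain z where z: "z \<in> cball 0 1" "y = a + A *v z" using y unfolding A(2) by blast
      have "2 *\<^sub>R a - y = a + A *v (- z)"
        using linear_neg[OF matrix_vector_mul_linear, of A z] by (simp add: z(2) scaleR_2)
      thus ?thesis unfolding A(2) using z(1) by (intro image_eqI[of _ _ "- z"]) auto
    qed
    from reflect[of x] reflect[of "2 *\<^sub>R a - x"] show ?thesis by auto
  qed
  have Km [measurable]: "K \<in> sets borel" using closed by simp
  have Kfin: "emeasure lborel K < \<infinity>" by (rule emeasure_compact_finite[OF compact])
  have i1: "integrable lborel (\<lambda>x. indicator K x *\<^sub>R x)"
    using borel_integrable_compact[OF compact, of "\<lambda>x. x"] continuous_on_id by (simp add: indicator_scaleR_eq_if)
  have i2: "integrable lborel (\<lambda>x. indicator K x *\<^sub>R (2 *\<^sub>R a))"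
    using Kfin by (intro integrable_scaleR_left integrable_real_indicator) auto
  have d: "distr lborel borel (\<lambda>x. 2 *\<^sub>R a - x) = (lborel :: (real^'n) measure)"
    using lborel_affine[of "-1" "2 *\<^sub>R a :: real^'n"] by (simp add: density_1)
  have "J = (\<integral>x. indicator K x *\<^sub>R x \<partial>distr lborel borel (\<lambda>x. 2 *\<^sub>R a - x))" by (simp add: d J_def)
  also have "\<dots> = (\<integral>x. indicator K (2 *\<^sub>R a - x) *\<^sub>R (2 *\<^sub>R a - x) \<partial>lborel)" by (rule integral_distr) auto
  also have "\<dots> = (\<integral>x. indicator K x *\<^sub>R (2 *\<^sub>R a) - indicator K x *\<^sub>R x \<partial>lborel)"
    by (intro Bochner_Integration.integral_cong) (auto simp: indicator_def sym)
  also have "\<dots> = (\<integral>x. indicator K x *\<^sub>R (2 *\<^sub>R a) \<partial>lborel) - J"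
    unfolding J_def by (rule Bochner_Integration.integral_diff[OF i2 i1])
  also have "(\<integral>x. indicator K x *\<^sub>R (2 *\<^sub>R a) \<partial>lborel) = vol K *\<^sub>R (2 *\<^sub>R a)"
    using Kfin by (simp add: vol_def)
  finally have "a = 0" using J vol_pos by simp
  hence "K = (\<lambda>x. A *v x) ` cball 0 1" using A(2) by simp
  moreover have ce: "centered_ellipsoid A B" using AB by (rule centered_ellipsoid.intro)
  ultimately show thesis using that centered_ellipsoid.E_def[OF ce] by simp
qed

lemma mixed_asa_balls:
  assumes R: "\<And>i. i \<in> {1..CARD('n)} \<Longrightarrow> 0 < R i" and \<phi>: "\<And>i. i \<in> {1..CARD('n)} \<Longrightarrow> \<phi> i \<in> Conc"
    and L: "\<And>i. i \<in> {1..CARD('n)} \<Longrightarrow> L i = cball (0::real^'n) (R i)"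
  shows "mixed_asa \<phi> L = real CARD('n) *
     (\<Prod>i=1..CARD('n). (vol (cball (0::real^'n) (1 / R i)) * \<phi> i (vol (cball (0::real^'n) (R i)) / vol (cball (0::real^'n) (1 / R i)))) powr (1 / real CARD('n)))"
proof -
  have "mixed_asa \<phi> L = real CARD('n) *
     (\<Prod>i=1..CARD('n). (vol (polar_body (L i)) * \<phi> i (vol (L i) / vol (polar_body (L i)))) powr (1 / real CARD('n)))"
  proof (rule mixed_asa_ellipsoids[where A="\<lambda>i. mat (R i)" and B="\<lambda>i. mat (1 / R i)"])
    fix i assume i: "i \<in> {1..CARD('n)}"
    show "centered_ellipsoid (mat (R i) :: real^'n^'n) (mat (1 / R i)) \<and> L i = centered_ellipsoid.E (mat (R i))"
      using ball_centered_ellipsoid[OF R[OF i], where 'n='n] L[OF i] by simp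
    have 1: "1 \<in> {1..CARD('n)}" by simp
    have "cball (0::real^'n) (R i) = (\<lambda>x. (R i / R 1) *\<^sub>R x) ` cball 0 (R 1)"
      using R[OF i] R[OF 1] cball_scale[of "R i / R 1" "0::real^'n" "R 1"] by simp
    thus "dilates (L i) (L 1)" unfolding dilates_def L[OF i] L[OF 1] using R[OF i] R[OF 1] by (intro exI[of _ "R i / R 1"]) simp
  qed (rule \<phi>)
  thus ?thesis using L R by (simp add: polar_body_cball)
qed

theorem theorem3p3:
  fixes K :: "nat \<Rightarrow> (real^'n) set"
  assumes "CARD('n) \<ge> 2"
    and "\<And>i. i \<in> {1..CARD('n)} \<Longrightarrow> C2_plus (K i)"
    and "\<And>i. i \<in> {1..CARD('n)} \<Longrightarrow> centroid (K i) = 0"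
  shows
    "(\<forall>\<phi>. (\<forall>i\<in>{1..CARD('n)}. \<phi> i \<in> Conc) \<longrightarrow>
        mixed_asa \<phi> K \<le> mixed_asa \<phi> (\<lambda>i. polar_body (volume_ball (polar_body (K i)))) \<and>
        ((\<forall>i\<in>{1..CARD('n)}. ellipsoid (K i)) \<and>
         (\<forall>i\<in>{1..CARD('n)}. \<forall>j\<in>{1..CARD('n)}. dilates (K i) (K j)) \<longrightarrow>
         mixed_asa \<phi> K = mixed_asa \<phi> (\<lambda>i. polar_body (volume_ball (polar_body (K i))))))
     \<and>
     (\<forall>\<phi> r. (\<forall>i\<in>{1..CARD('n)}. \<phi> i \<in> Conc \<and> 0 \<le> r i \<and> r i < 1 \<and> homogeneous (r i) (\<phi> i)) \<longrightarrow>
        (mixed_asa \<phi> K / mixed_asa \<phi> (\<lambda>i. cball (0 :: real^'n) 1)) ^ CARD('n)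
          \<le> (\<Prod>i=1..CARD('n). (vol (K i) / vol (cball (0 :: real^'n) 1)) powr (2 * r i - 1)) \<and>
        ((\<forall>i\<in>{1..CARD('n)}. ellipsoid (K i)) \<and>
         (\<forall>i\<in>{1..CARD('n)}. \<forall>j\<in>{1..CARD('n)}. dilates (K i) (K j)) \<longrightarrow>
         (mixed_asa \<phi> K / mixed_asa \<phi> (\<lambda>i. cball (0 :: real^'n) 1)) ^ CARD('n)
          = (\<Prod>i=1..CARD('n). (vol (K i) / vol (cball (0 :: real^'n) 1)) powr (2 * r i - 1))))"
proof -
  let ?n = "CARD('n)" let ?I = "{1..CARD('n)}" let ?r = "1 / real CARD('n)"
  let ?L = "\<lambda>i. polar_body (volume_ball (polar_body (K i)))"
  define b where "b = vol (cball (0::real^'n) 1)"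
  define V where "V i = vol (K i)" for i
  define W where "W i = vol (polar_body (K i))" for i
  have n: "0 < ?n" by simp
  have b: "0 < b" unfolding b_def by (rule vol_unit_ball_pos)
  have cb: "convex_body (K i)" if "i \<in> ?I" for i
    using smooth_body.axioms(1)[OF C2_plus_smooth_body[OF assms(2)[OF that]]] .
  have V: "0 < V i" and W: "0 < W i" if "i \<in> ?I" for i
    unfolding V_def W_def using convex_body.vol_pos[OF cb[OF that]] convex_body.vol_pos[OF convex_body.polar_convex_body[OF cb[OF that]]] by simp_all
  have bs: "V i * W i \<le> b\<^sup>2" if "i \<in> ?I" for i
    unfolding V_def W_def b_def by (rule convex_body.blaschke_santalo[OF cb[OF that] assms(3)[OF that]])
  have bound: "mixed_asa \<phi> K \<le> real ?n * (\<Prod>i\<in>?I. (W i * \<phi> i (V i / W i)) powr ?r)"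
    if "\<And>i. i \<in> ?I \<Longrightarrow> \<phi> i \<in> Conc" for \<phi>
    unfolding V_def W_def by (rule mixed_asa_le[OF assms(2) that])
  have ellipsoids: "(\<forall>i\<in>?I. V i * W i = b\<^sup>2) \<and>
      mixed_asa \<phi> K = real ?n * (\<Prod>i\<in>?I. (W i * \<phi> i (V i / W i)) powr ?r)"
    if \<phi>: "\<And>i. i \<in> ?I \<Longrightarrow> \<phi> i \<in> Conc"
      and ell: "(\<forall>i\<in>?I. ellipsoid (K i)) \<and> (\<forall>i\<in>?I. \<forall>j\<in>?I. dilates (K i) (K j))" for \<phi>
  proof -
    have "\<forall>i\<in>?I. \<exists>A B. centered_ellipsoid A B \<and> K i = centered_ellipsoid.E A"
      using ell ellipsoid_centered[OF _ assms(3) cb] by metis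
    then obtain A B where AB: "\<And>i. i \<in> ?I \<Longrightarrow> centered_ellipsoid (A i) (B i) \<and> K i = centered_ellipsoid.E (A i)" by metis
    have "V i * W i = b\<^sup>2" if i: "i \<in> ?I" for i
    proof -
      have ce: "centered_ellipsoid (A i) (B i)" and KE: "K i = centered_ellipsoid.E (A i)" using AB[OF i] by auto
      have "V i * W i = (\<bar>det (A i)\<bar> * W i) * b"
        unfolding V_def b_def KE centered_ellipsoid.vol_E[OF ce] by simp
      also have "\<bar>det (A i)\<bar> * W i = b"
        unfolding W_def b_def KE by (rule centered_ellipsoid.vol_polar_E[OF ce])
      finally show ?thesis by (simp add: power2_eq_square)
    qed
    moreover have "mixed_asa \<phi> K = real ?n * (\<Prod>i\<in>?I. (W i * \<phi> i (V i / W i)) powr ?r)"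
      unfolding V_def W_def by (rule mixed_asa_ellipsoids[OF AB _ \<phi>]) (use ell n in auto)
    ultimately show ?thesis by blast
  qed
  \<comment> \<open>The comparison body is the ball of radius \<open>1 / R i\<close>. Its polar has
    volume \<open>W i\<close> and it has volume \<open>b\<^sup>2 / W i\<close> itself, so it attains
    equality in the Santalo inequality with the same polar volume as \<open>K i\<close>.\<close>
  have balls: "mixed_asa \<phi> ?L = real ?n * (\<Prod>i\<in>?I. (W i * \<phi> i (b\<^sup>2 / W i / W i)) powr ?r)"
    if \<phi>: "\<And>i. i \<in> ?I \<Longrightarrow> \<phi> i \<in> Conc" for \<phi>
  proof -
    define R where "R i = root ?n (W i / b)" for i
    have vb: "volume_ball (polar_body (K i)) = cball 0 (R i)" "0 < R i" "R i ^ ?n * b = W i" if "i \<in> ?I" for i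
      using volume_ball_eq[of "polar_body (K i)"] W[OF that] unfolding R_def W_def b_def by auto
    have "mixed_asa \<phi> ?L = real ?n * (\<Prod>i\<in>?I. (vol (cball (0::real^'n) (1 / (1 / R i))) *
        \<phi> i (vol (cball (0::real^'n) (1 / R i)) / vol (cball (0::real^'n) (1 / (1 / R i))))) powr ?r)"
    proof (rule mixed_asa_balls)
      fix i assume i: "i \<in> ?I"
      show "0 < 1 / R i" using vb(2)[OF i] by simp
      show "\<phi> i \<in> Conc" by (rule \<phi>[OF i])
      show "?L i = cball 0 (1 / R i)" unfolding vb(1)[OF i] by (rule polar_body_cball[OF vb(2)[OF i]])
    qed
    also have "(\<Prod>i\<in>?I. (vol (cball (0::real^'n) (1 / (1 / R i))) *
        \<phi> i (vol (cball (0::real^'n) (1 / R i)) / vol (cball (0::real^'n) (1 / (1 / R i))))) powr ?r)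
      = (\<Prod>i\<in>?I. (W i * \<phi> i (b\<^sup>2 / W i / W i)) powr ?r)"
    proof (intro prod.cong refl)
      fix i assume i: "i \<in> ?I"
      have w: "vol (cball (0::real^'n) (1 / (1 / R i))) = W i"
        using vb(3)[OF i] vol_cball[OF vb(2)[OF i], where 'n='n] by (simp add: b_def)
      have "vol (cball (0::real^'n) (1 / R i)) = b / R i ^ ?n"
        using vb(2)[OF i] vol_cball[of "1 / R i", where 'n='n] by (simp add: b_def power_one_over)
      also have "\<dots> = b\<^sup>2 / W i" using vb(2)[OF i] b by (simp add: vb(3)[OF i, symmetric] power2_eq_square)
      finally show "(vol (cball (0::real^'n) (1 / (1 / R i))) *
        \<phi> i (vol (cball (0::real^'n) (1 / R i)) / vol (cball (0::real^'n) (1 / (1 / R i))))) powr ?r = (W i * \<phi> i (b\<^sup>2 / W i / W i)) powr ?r"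
        by (simp only: w)
    qed
    finally show ?thesis .
  qed
  have one: "mixed_asa \<phi> (\<lambda>i. cball (0::real^'n) 1) = real ?n * (\<Prod>i\<in>?I. (b * \<phi> i 1) powr ?r)"
    if "\<And>i. i \<in> ?I \<Longrightarrow> \<phi> i \<in> Conc" for \<phi>
    using mixed_asa_balls[of "\<lambda>_. 1" \<phi> "\<lambda>_. cball (0::real^'n) 1"] that b by (simp add: b_def)
  show ?thesis
  proof (intro conjI allI impI)
    fix \<phi> :: "nat \<Rightarrow> real \<Rightarrow> real" assume "\<forall>i\<in>?I. \<phi> i \<in> Conc"
    hence \<phi>: "\<And>i. i \<in> ?I \<Longrightarrow> \<phi> i \<in> Conc" by blast
    have "(\<Prod>i\<in>?I. (W i * \<phi> i (V i / W i)) powr ?r) \<le> (\<Prod>i\<in>?I. (W i * \<phi> i (b\<^sup>2 / W i / W i)) powr ?r)"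
    proof (intro prod_mono conjI powr_mono2)
      fix i assume i: "i \<in> ?I"
      \<comment> \<open>With \<open>W i\<close> held fixed the bound increases with
        \<open>V i\<close>, and Santalo gives the largest admissible value.\<close>
      have "V i \<le> b\<^sup>2 / W i" using bs[OF i] W[OF i] by (simp add: field_simps)
      hence "V i / W i \<le> b\<^sup>2 / W i / W i" by (rule divide_right_mono[OF _ less_imp_le[OF W[OF i]]])
      thus "W i * \<phi> i (V i / W i) \<le> W i * \<phi> i (b\<^sup>2 / W i / W i)"
        using V[OF i] W[OF i] by (intro mult_left_mono Conc_mono[OF \<phi>[OF i]]) auto
      show "0 \<le> W i * \<phi> i (V i / W i)" using V[OF i] W[OF i] Conc_pos[OF \<phi>[OF i], of "V i / W i"] by simp
    qed auto
    hence "real ?n * (\<Prod>i\<in>?I. (W i * \<phi> i (V i / W i)) powr ?r) \<le> mixed_asa \<phi> ?L"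
      by (subst balls[of \<phi>, OF \<phi>]) (auto intro: mult_left_mono)
    with bound[of \<phi>, OF \<phi>] show "mixed_asa \<phi> K \<le> mixed_asa \<phi> ?L" by (rule order_trans)
  next
    fix \<phi> :: "nat \<Rightarrow> real \<Rightarrow> real" assume "\<forall>i\<in>?I. \<phi> i \<in> Conc"
      and ell: "(\<forall>i\<in>?I. ellipsoid (K i)) \<and> (\<forall>i\<in>?I. \<forall>j\<in>?I. dilates (K i) (K j))"
    hence \<phi>: "\<And>i. i \<in> ?I \<Longrightarrow> \<phi> i \<in> Conc" by blast
    have "V i / W i = b\<^sup>2 / W i / W i" if "i \<in> ?I" for i
      using ellipsoids[of \<phi>, OF \<phi> ell] that W[OF that] by (simp add: field_simps)
    hence "(\<Prod>i\<in>?I. (W i * \<phi> i (V i / W i)) powr ?r) = (\<Prod>i\<in>?I. (W i * \<phi> i (b\<^sup>2 / W i / W i)) powr ?r)"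
      by (intro prod.cong) auto
    with ellipsoids[of \<phi>, OF \<phi> ell] balls[of \<phi>, OF \<phi>] show "mixed_asa \<phi> K = mixed_asa \<phi> ?L" by simp
  next
    fix \<phi> :: "nat \<Rightarrow> real \<Rightarrow> real" and r :: "nat \<Rightarrow> real"
    assume hom: "\<forall>i\<in>?I. \<phi> i \<in> Conc \<and> 0 \<le> r i \<and> r i < 1 \<and> homogeneous (r i) (\<phi> i)"
    hence \<phi>: "\<And>i. i \<in> ?I \<Longrightarrow> \<phi> i \<in> Conc" by blast
    let ?c = "\<lambda>i. W i * \<phi> i (V i / W i)" let ?d = "\<lambda>i. b * \<phi> i 1"
    have bd: "mixed_asa \<phi> K \<le> real ?n * (\<Prod>i\<in>?I. ?c i powr ?r)" by (rule bound) (rule \<phi>)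
    have on: "mixed_asa \<phi> (\<lambda>i. cball (0::real^'n) 1) = real ?n * (\<Prod>i\<in>?I. ?d i powr ?r)" by (rule one) (rule \<phi>)
    have c0: "0 < ?c i" if "i \<in> ?I" for i using V[OF that] W[OF that] Conc_pos[OF \<phi>[OF that], of "V i / W i"] by simp
    have d0: "0 < ?d i" if "i \<in> ?I" for i using b Conc_pos[OF \<phi>[OF that], of 1] by simp
    have root_n: "(x powr ?r) ^ ?n = x" if "0 < x" for x :: real
      using that n by (simp add: powr_realpow[symmetric] powr_powr)
    have prod_n: "(\<Prod>i\<in>?I. x i powr ?r) ^ ?n = (\<Prod>i\<in>?I. x i)" if "\<And>i. i \<in> ?I \<Longrightarrow> 0 < x i" for x :: "nat \<Rightarrow> real"
      unfolding prod_power_distrib by (intro prod.cong refl root_n that)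
    have ratio: "((real ?n * (\<Prod>i\<in>?I. ?c i powr ?r)) / (real ?n * (\<Prod>i\<in>?I. ?d i powr ?r))) ^ ?n = (\<Prod>i\<in>?I. ?c i / ?d i)"
      using prod_n[of ?c] prod_n[of ?d] c0 d0 n by (simp add: power_divide prod_dividef)
    have target: "?c i / ?d i \<le> (V i / b) powr (2 * r i - 1)"
      and target_eq: "V i * W i = b\<^sup>2 \<Longrightarrow> ?c i / ?d i = (V i / b) powr (2 * r i - 1)" if i: "i \<in> ?I" for i
    proof -
      have Vi: "0 < V i" and Wi: "0 < W i" using V[OF i] W[OF i] .
      have r: "0 \<le> r i" "r i < 1" "homogeneous (r i) (\<phi> i)" using hom i by auto
      have "\<phi> i (V i / W i * 1) = (V i / W i) powr r i * \<phi> i 1"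
        using r(3) Vi Wi unfolding homogeneous_def by (metis divide_pos_pos zero_less_one)
      hence "?c i / ?d i = W i * (V i / W i) powr r i / b"
        using Conc_pos[OF \<phi>[OF i], of 1] by simp
      \<comment> \<open>Origin of the exponents: with the Santalo quotient
        \<open>Q = V i * W i / b\<^sup>2\<close>, the ratio \<open>V i / W i\<close> is
        \<open>(V i / b)\<^sup>2 / Q\<close> and \<open>W i / b\<close> is
        \<open>Q / (V i / b)\<close>. Collecting powers gives \<open>2 * r i - 1\<close> for
        \<open>V i / b\<close> and \<open>1 - r i\<close> for \<open>Q\<close>.\<close>
      also have "\<dots> = (V i / b) powr (2 * r i - 1) * (V i * W i / b\<^sup>2) powr (1 - r i)"
      proof (rule ln_inj_iff[THEN iffD1])
        show "ln (W i * (V i / W i) powr r i / b) = ln ((V i / b) powr (2 * r i - 1) * (V i * W i / b\<^sup>2) powr (1 - r i))"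
          using Vi Wi b by (simp add: ln_mult ln_div ln_powr ln_realpow) (simp add: algebra_simps)
      qed (use Vi Wi b in auto)
      finally have eq: "?c i / ?d i = (V i / b) powr (2 * r i - 1) * (V i * W i / b\<^sup>2) powr (1 - r i)" .
      \<comment> \<open>Because of \<open>r i < 1\<close> the exponent is positive, so the bound
        \<open>Q \<le> 1\<close> can be used; for ellipsoids \<open>Q = 1\<close> and nothing is
        lost.\<close>
      have "(V i * W i / b\<^sup>2) powr (1 - r i) \<le> 1 powr (1 - r i)"
        using bs[OF i] Vi Wi b r by (intro powr_mono2) auto
      thus "?c i / ?d i \<le> (V i / b) powr (2 * r i - 1)" unfolding eq by (simp add: mult_left_le)
      show "?c i / ?d i = (V i / b) powr (2 * r i - 1)" if "V i * W i = b\<^sup>2" unfolding eq using that b by simp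
    qed
    have "(mixed_asa \<phi> K / mixed_asa \<phi> (\<lambda>i. cball (0::real^'n) 1)) ^ ?n
       \<le> ((real ?n * (\<Prod>i\<in>?I. ?c i powr ?r)) / (real ?n * (\<Prod>i\<in>?I. ?d i powr ?r))) ^ ?n"
      unfolding on using bd mixed_asa_nonneg[of \<phi> K]
      by (intro power_mono divide_right_mono divide_nonneg_nonneg mult_nonneg_nonneg prod_nonneg) auto
    also have "\<dots> = (\<Prod>i\<in>?I. ?c i / ?d i)" by (rule ratio)
    also have "\<dots> \<le> (\<Prod>i\<in>?I. (V i / b) powr (2 * r i - 1))"
    proof (intro prod_mono conjI)
      fix i assume i: "i \<in> ?I"
      show "0 \<le> ?c i / ?d i" using c0[OF i] d0[OF i] by (intro divide_nonneg_nonneg less_imp_le)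
      show "?c i / ?d i \<le> (V i / b) powr (2 * r i - 1)" by (rule target[OF i])
    qed
    finally show "(mixed_asa \<phi> K / mixed_asa \<phi> (\<lambda>i. cball (0::real^'n) 1)) ^ ?n
       \<le> (\<Prod>i\<in>?I. (vol (K i) / vol (cball (0::real^'n) 1)) powr (2 * r i - 1))" unfolding V_def b_def .
    assume ell: "(\<forall>i\<in>?I. ellipsoid (K i)) \<and> (\<forall>i\<in>?I. \<forall>j\<in>?I. dilates (K i) (K j))"
    have "(mixed_asa \<phi> K / mixed_asa \<phi> (\<lambda>i. cball (0::real^'n) 1)) ^ ?n = (\<Prod>i\<in>?I. ?c i / ?d i)"
      unfolding on using ellipsoids[of \<phi>, OF \<phi> ell] ratio by simp
    also have "\<dots> = (\<Prod>i\<in>?I. (V i / b) powr (2 * r i - 1))"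
      using ellipsoids[of \<phi>, OF \<phi> ell] target_eq by (intro prod.cong) auto
    finally show "(mixed_asa \<phi> K / mixed_asa \<phi> (\<lambda>i. cball (0::real^'n) 1)) ^ ?n
       = (\<Prod>i\<in>?I. (vol (K i) / vol (cball (0::real^'n) 1)) powr (2 * r i - 1))" unfolding V_def b_def .
  qed
qed

end
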